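(* Let $(x_0,y_0,z_0)$ satisfy $x_0>y_0=z_0>0$, and let $\{(x_n,y_n,z_n)\}_{n\ge0}$, $(a_n,b_n,c_n)$, $\mathcal E_n^{(a_0,b_0)}$, $\mathcal E^{(a_0,b_0)}$ and $\mathcal F$ be as defined in the context. Then $a_0>b_0=c_0$ and $$a_n=\frac{x_n}{y_n(2x_n+y_n)}\asymp 2^n,\qquad b_n=c_n=\frac{1}{2x_n+y_n}\asymp\left(\frac32\right)^n .$$ Moreover, $\mathcal E^{(a_0,b_0)}(u)=\lim_{n\to\infty}\mathcal E_n^{(a_0,b_0)}(u)$ defines a strongly local regular Dirichlet form on $L^2(K,\mu)$ with domain $\mathcal F$ which is independent of $(a_0,b_0)$ (among all initial data with $a_0>b_0=c_0>0$); it satisfies $$\mathcal E^{(a_0,b_0)}(u)=\sum_{i=1}^3\mathcal E^{(a_1,b_1)}(u\circ F_i),$$ but it does not satisfy the energy self-similar identity, i.e. there are no positive numbers $r_1,r_2,r_3$ such that $\mathcal E^{(a_0,b_0)}(u)=\sum_{i=1}^3\frac1{r_i}\mathcal E^{(a_0,b_0)}(u\circ F_i)$ for all $u\in\mathcal F$.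
   Context: Identify $\mathbb R^2$ with $\mathbb C$ and let $p_1=0$, $p_2=1$, $p_3=e^{\pi\sqrt{-1}/3}$, $F_i(x)=\frac12(x-p_i)+p_i$ ($i=1,2,3$). The Sierpinski gasket $K$ is the unique nonempty compact set with $K=\bigcup_{i=1}^3F_i(K)$. Let $V_0=\{p_1,p_2,p_3\}$, $V_n=\bigcup_{i=1}^3F_i(V_{n-1})$, $W_n=\{1,2,3\}^n$, $F_\omega=F_{\omega_1}\circ\cdots\circ F_{\omega_n}$ for $\omega\in W_n$, and let $\mu$ be the normalized $\frac{\log3}{\log2}$-dimensional Hausdorff measure on $K$. Given $x_0>y_0=z_0>0$, let $\{(x_n,y_n,z_n)\}_{n\ge 0}$ be the unique sequence of positive triples, starting from $(x_0,y_0,z_0)$, satisfying for all $n\ge1$ $$x_{n-1}=x_n+\phi(x_n;y_n,z_n),\quad y_{n-1}=y_n+\phi(y_n;z_n,x_n),\quad z_{n-1}=z_n+\phi(z_n;x_n,y_n),$$ with $\phi(x;y,z)=\frac{(x+y)(x+z)}{2(x+y+z)}$; it satisfies $x_n\geq y_n=z_n>0$. For $n\ge0$ put $r_n=x_ny_n+y_nz_n+z_nx_n$ and $a_n=x_n/r_n$, $b_n=y_n/r_n$, $c_n=z_n/r_n$ (conductances on the level-$n$ cells). Equivalently one may start from $(a_0,b_0,c_0)$ and recover $x_0=a_0/\eta_0$, $y_0=b_0/\eta_0$, $z_0=c_0/\eta_0$ with $\eta_0=a_0b_0+b_0c_0+c_0a_0$. For $u\in C(K)$, writing $u_\omega=u\circ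 F_\omega$, let $$\mathcal E_n^{(a_0,b_0)}(u)=\sum_{\omega\in W_n}\Big[b_n(u_\omega(p_1)-u_\omega(p_2))^2+b_n(u_\omega(p_1)-u_\omega(p_3))^2+a_n(u_\omega(p_2)-u_\omega(p_3))^2\Big].$$ This is nondecreasing in $n$; $\mathcal E^{(a_0,b_0)}(u)=\lim_{n\to\infty}\mathcal E_n^{(a_0,b_0)}(u)\in[0,\infty]$ and $\mathcal F=\{u\in C(K):\mathcal E^{(a_0,b_0)}(u)<\infty\}$. $\mathcal E^{(a_1,b_1)}$ denotes the form obtained by the same construction from the initial conductances $(a_1,b_1,c_1)$ on $V_0$. For nonnegative $f,g$, $f\asymp g$ means that $C^{-1}g\le f\le Cg$ for a constant $C>0$; here $C$ does not depend on $n$ (but may depend on $(a_0,b_0)$). *)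

theory Defs
  imports "HOL-Analysis.Analysis"
begin

section \<open>Hausdorff measure\<close>

text \<open>
  Intended for exponents \<open>s > 0\<close>: since \<open>0 powr s = 0\<close> and the empty set has diameter \<open>0\<close>,
  finite covers are covered by padding with empty sets.  Boundedness is required because
  \<^const>\<open>diameter\<close> is meaningless for unbounded sets.
\<close>

definition hausdorff_pre :: "real \<Rightarrow> real \<Rightarrow> 'a::metric_space set \<Rightarrow> ennreal" where
  "hausdorff_pre s d A =
     (INF U \<in> {U :: nat \<Rightarrow> 'a set. A \<subseteq> (\<Union>i. U i) \<and> (\<forall>i. bounded (U i) \<and> diameter (U i) \<le> d)}.
        \<Sum>i. ennreal (diameter (U i) powr s))"

definition hausdorff_outer :: "real \<Rightarrow> 'a::metric_space set \<Rightarrow> ennreal" where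
  "hausdorff_outer s A = (SUP d \<in> {0<..}. hausdorff_pre s d A)"

definition hausdorff_measure :: "real \<Rightarrow> 'a::metric_space measure" where
  "hausdorff_measure s = measure_of UNIV (sets borel) (hausdorff_outer s)"


section \<open>The Sierpinski gasket\<close>

definition sg_vertex :: "nat \<Rightarrow> complex" where
  "sg_vertex i = (if i = 1 then 0 else if i = 2 then 1 else exp (of_real pi * \<i> / 3))"

definition sg_map :: "nat \<Rightarrow> complex \<Rightarrow> complex" where
  "sg_map i x = (x - sg_vertex i) / 2 + sg_vertex i"

definition gasket :: "complex set" where
  "gasket = (THE K. compact K \<and> K \<noteq> {} \<and> K = (\<Union>i\<in>{1,2,3}. sg_map i ` K))"

definition sg_words :: "nat \<Rightarrow> nat list set" where
  "sg_words n = {w. length w = n \<and> set w \<subseteq> {1,2,3}}"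

definition sg_word_map :: "nat list \<Rightarrow> complex \<Rightarrow> complex" where
  "sg_word_map w = foldr (\<lambda>i f. sg_map i \<circ> f) w id"

definition gasket_measure :: "complex measure" where
  "gasket_measure =
     scale_measure (inverse (emeasure (hausdorff_measure (ln 3 / ln 2)) gasket))
       (restrict_space (hausdorff_measure (ln 3 / ln 2)) gasket)"


section \<open>Resistances, conductances and the energy\<close>

definition phi :: "real \<Rightarrow> real \<Rightarrow> real \<Rightarrow> real" where
  "phi x y z = (x + y) * (x + z) / (2 * (x + y + z))"

definition resistance_sequence :: "(nat \<Rightarrow> real \<times> real \<times> real) \<Rightarrow> bool" where
  "resistance_sequence s \<longleftrightarrow>
     (\<forall>n. case s n of (x, y, z) \<Rightarrow> x > 0 \<and> y > 0 \<and> z > 0) \<and>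
     (\<forall>n\<ge>1. case s n of (x, y, z) \<Rightarrow>
        s (n - 1) = (x + phi x y z, y + phi y z x, z + phi z x y))"

definition resistances :: "real \<times> real \<times> real \<Rightarrow> nat \<Rightarrow> real \<times> real \<times> real" where
  "resistances t = (THE s. resistance_sequence s \<and> s 0 = t)"

text \<open>
  The passage from resistances \<open>(x, y, z)\<close> to conductances \<open>(x/r, y/r, z/r)\<close>,
  \<open>r = xy + yz + zx\<close>, and the passage back \<open>(a, b, c) \<mapsto> (a/\<eta>, b/\<eta>, c/\<eta>)\<close>,
  \<open>\<eta> = ab + bc + ca\<close>, are given by the same formula.
\<close>

definition star_delta :: "real \<times> real \<times> real \<Rightarrow> real \<times> real \<times> real" where
  "star_delta t = (case t of (x, y, z) \<Rightarrow>
     let r = x * y + y * z + z * x in (x / r, y / r, z / r))"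

text \<open>The conductances \<open>(a\<^sub>n, b\<^sub>n, c\<^sub>n)\<close> generated by the initial conductances \<open>(a0, b0, b0)\<close>.\<close>

definition conductances :: "real \<Rightarrow> real \<Rightarrow> nat \<Rightarrow> real \<times> real \<times> real" where
  "conductances a0 b0 n = star_delta (resistances (star_delta (a0, b0, b0)) n)"

definition energy_level :: "real \<Rightarrow> real \<Rightarrow> nat \<Rightarrow> (complex \<Rightarrow> real) \<Rightarrow> real" where
  "energy_level a0 b0 n u = (case conductances a0 b0 n of (a, b, c) \<Rightarrow>
     \<Sum>w\<in>sg_words n. let v = u \<circ> sg_word_map w in
        b * (v (sg_vertex 1) - v (sg_vertex 2))\<^sup>2
      + b * (v (sg_vertex 1) - v (sg_vertex 3))\<^sup>2
      + a * (v (sg_vertex 2) - v (sg_vertex 3))\<^sup>2)"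

definition energy :: "real \<Rightarrow> real \<Rightarrow> (complex \<Rightarrow> real) \<Rightarrow> ennreal" where
  "energy a0 b0 u = lim (\<lambda>n. ennreal (energy_level a0 b0 n u))"

text \<open>Elements of \<open>C(K)\<close> are represented by functions on the plane; only their values on \<open>K\<close> matter.\<close>

definition energy_domain :: "real \<Rightarrow> real \<Rightarrow> (complex \<Rightarrow> real) set" where
  "energy_domain a0 b0 = {u. continuous_on gasket u \<and> energy a0 b0 u < \<infinity>}"

definition energy_form :: "real \<Rightarrow> real \<Rightarrow> (complex \<Rightarrow> real) \<Rightarrow> (complex \<Rightarrow> real) \<Rightarrow> real" where
  "energy_form a0 b0 u v =
     (enn2real (energy a0 b0 (\<lambda>x. u x + v x)) - enn2real (energy a0 b0 (\<lambda>x. u x - v x))) / 4"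

definition comparable :: "(nat \<Rightarrow> real) \<Rightarrow> (nat \<Rightarrow> real) \<Rightarrow> bool" where
  "comparable f g \<longleftrightarrow> (\<exists>C>0. \<forall>n. inverse C * g n \<le> f n \<and> f n \<le> C * g n)"


section \<open>Dirichlet forms\<close>

definition square_integrable :: "'a measure \<Rightarrow> ('a \<Rightarrow> real) set" where
  "square_integrable M = {f \<in> borel_measurable M. integrable M (\<lambda>x. (f x)\<^sup>2)}"

text \<open>The norm square \<open>E\<^sub>1(u) = E(u, u) + \<parallel>u\<parallel>\<^sup>2\<close>.\<close>

definition form_one ::
  "'a measure \<Rightarrow> (('a \<Rightarrow> real) \<Rightarrow> ('a \<Rightarrow> real) \<Rightarrow> real) \<Rightarrow> ('a \<Rightarrow> real) \<Rightarrow> real" where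
  "form_one M E u = E u u + (\<integral>x. (u x)\<^sup>2 \<partial>M)"

text \<open>
  A form on \<open>L\<^sup>2(M)\<close> is given by a set \<open>D\<close> of representatives of the \<open>L\<^sup>2\<close>-classes in its domain and
  by its values on these representatives.  \<open>D\<close> need not contain all representatives of a class, but
  \<open>E\<close> must depend on the classes only.
\<close>

definition dirichlet_form ::
  "'a measure \<Rightarrow> ('a \<Rightarrow> real) set \<Rightarrow> (('a \<Rightarrow> real) \<Rightarrow> ('a \<Rightarrow> real) \<Rightarrow> real) \<Rightarrow> bool" where
  "dirichlet_form M D E \<longleftrightarrow>
     \<comment> \<open>dense linear subspace of \<open>L\<^sup>2(M)\<close>\<close>
     D \<subseteq> square_integrable M \<and>
     (\<lambda>x. 0) \<in> D \<and>
     (\<forall>u\<in>D. \<forall>v\<in>D. (\<lambda>x. u x + v x) \<in> D) \<and>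
     (\<forall>r. \<forall>u\<in>D. (\<lambda>x. r * u x) \<in> D) \<and>
     (\<forall>f\<in>square_integrable M. \<forall>e>0. \<exists>u\<in>D. (\<integral>x. (f x - u x)\<^sup>2 \<partial>M) < e) \<and>
     \<comment> \<open>well-defined nonnegative symmetric bilinear form\<close>
     (\<forall>u\<in>D. \<forall>v\<in>D. \<forall>w\<in>D. (AE x in M. u x = v x) \<longrightarrow> E u w = E v w) \<and>
     (\<forall>u\<in>D. \<forall>v\<in>D. E u v = E v u) \<and>
     (\<forall>u\<in>D. \<forall>v\<in>D. \<forall>w\<in>D. E (\<lambda>x. u x + v x) w = E u w + E v w) \<and>
     (\<forall>r. \<forall>u\<in>D. \<forall>w\<in>D. E (\<lambda>x. r * u x) w = r * E u w) \<and>
     (\<forall>u\<in>D. 0 \<le> E u u) \<and>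
     \<comment> \<open>closed: complete with respect to \<open>E\<^sub>1\<close>\<close>
     (\<forall>s :: nat \<Rightarrow> 'a \<Rightarrow> real. (\<forall>n. s n \<in> D) \<longrightarrow>
        (\<forall>e>0. \<exists>N. \<forall>m\<ge>N. \<forall>n\<ge>N. form_one M E (\<lambda>x. s m x - s n x) < e) \<longrightarrow>
        (\<exists>u\<in>D. (\<lambda>n. form_one M E (\<lambda>x. s n x - u x)) \<longlonglongrightarrow> 0)) \<and>
     \<comment> \<open>Markovian: the unit contraction operates\<close>
     (\<forall>u\<in>D. \<exists>v\<in>D. (AE x in M. v x = min (max (u x) 0) 1) \<and> E v v \<le> E u u)"

definition continuous_compact_support :: "'a::metric_space set \<Rightarrow> ('a \<Rightarrow> real) set" where
  "continuous_compact_support X =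
     {f. continuous_on X f \<and> (\<exists>C. compact C \<and> C \<subseteq> X \<and> (\<forall>x\<in>X - C. f x = 0))}"

definition radon_full_support :: "'a::metric_space set \<Rightarrow> 'a measure \<Rightarrow> bool" where
  "radon_full_support X M \<longleftrightarrow>
     space M = X \<and> sets M = sets (restrict_space borel X) \<and>
     (\<forall>C. compact C \<and> C \<subseteq> X \<longrightarrow> emeasure M C < \<infinity>) \<and>
     (\<forall>U. open U \<and> U \<inter> X \<noteq> {} \<longrightarrow> emeasure M (U \<inter> X) > 0)"

text \<open>
  \<open>X\<close> is meant to be a locally compact separable metric space.  The standing assumption of
  regularity that \<open>M\<close> is a Radon measure with support \<open>X\<close> is part of the definition.  The last two
  conditions say that \<open>D \<inter> C\<^sub>c(X)\<close> is dense in \<open>D\<close> for \<open>E\<^sub>1\<close>, and in \<open>C\<^sub>c(X)\<close> for the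
  supremum norm.
\<close>

definition regular_dirichlet_form ::
  "'a::metric_space set \<Rightarrow> 'a measure \<Rightarrow> ('a \<Rightarrow> real) set \<Rightarrow>
    (('a \<Rightarrow> real) \<Rightarrow> ('a \<Rightarrow> real) \<Rightarrow> real) \<Rightarrow> bool" where
  "regular_dirichlet_form X M D E \<longleftrightarrow>
     radon_full_support X M \<and> dirichlet_form M D E \<and>
     (\<forall>u\<in>D. \<forall>e>0. \<exists>w\<in>D. \<exists>v\<in>continuous_compact_support X.
        (AE x in M. w x = v x) \<and> form_one M E (\<lambda>x. u x - w x) < e) \<and>
     (\<forall>f\<in>continuous_compact_support X. \<forall>e>0. \<exists>w\<in>D. \<exists>v\<in>continuous_compact_support X.
        (AE x in M. w x = v x) \<and> (\<forall>x\<in>X. \<bar>f x - v x\<bar> < e))"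

text \<open>The support, as a closed subset of \<open>X\<close>, of the measure \<open>|u| dM\<close>.\<close>

definition ae_support :: "'a::metric_space set \<Rightarrow> 'a measure \<Rightarrow> ('a \<Rightarrow> real) \<Rightarrow> 'a set" where
  "ae_support X M u = {x\<in>X. \<forall>U. open U \<and> x \<in> U \<longrightarrow> \<not> (AE y in M. y \<in> U \<longrightarrow> u y = 0)}"

definition strongly_local ::
  "'a::metric_space set \<Rightarrow> 'a measure \<Rightarrow> ('a \<Rightarrow> real) set \<Rightarrow>
    (('a \<Rightarrow> real) \<Rightarrow> ('a \<Rightarrow> real) \<Rightarrow> real) \<Rightarrow> bool" where
  "strongly_local X M D E \<longleftrightarrow>
     (\<forall>u\<in>D. \<forall>v\<in>D. compact (ae_support X M u) \<longrightarrow> compact (ae_support X M v) \<longrightarrow>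
        (\<exists>U k. open U \<and> ae_support X M u \<subseteq> U \<and> (AE y in M. y \<in> U \<longrightarrow> v y = k)) \<longrightarrow>
        E u v = 0)"

end

theory Submission
  imports Defs
begin

text \<open>
  The resistances.  A solution of the recursion that starts with \<open>y = z\<close> keeps this symmetry, and the
  recursion is homogeneous, so everything is governed by the ratio \<open>t = y / x\<close>.  One step maps the new ratio
  to the old one by an increasing bijection \<open>ratio_map\<close> of the unit interval, whence the sequence exists and
  is unique.  Along the sequence \<open>ratio_map t / t\<close> stays above a constant larger than one, so the ratios decrease to
  zero geometrically.  Up to factors whose logarithms are summable, \<open>y\<close> is then halved and \<open>x\<close> multiplied
  by \<open>2/3\<close> in every step, and the growth \<open>2 ^ n\<close>, \<open>(3/2) ^ n\<close> of the conductances follows.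

  The energies.  Expressed by conductances, the recursion says that the triangle on level \<open>n\<close> is the trace of the
  three triangles on level \<open>n + 1\<close>: for given vertex values, the energy of the subdivided triangle is the old
  energy plus a nonnegative quadratic remainder, which vanishes for the harmonic midpoint values
  (\<open>triple_energy_subdivide\<close>).  So the energies increase with the level.  An edge of level \<open>n\<close> has conductance
  at least \<open>b n\<close>, hence a function of energy \<open>E\<close> changes along it by at most \<open>sqrt (E / b n)\<close>.  These bounds are
  summable because \<open>b n\<close> grows like \<open>(3/2) ^ n\<close>.  This single estimate is used twice.  It bounds the
  oscillation of a continuous function by its energy (\<open>oscillation_bound\<close>), so Cauchy sequences for the form
  converge uniformly and the form is closed.  It also shows that repeated harmonic subdivision converges
  uniformly (\<open>uniform_limit_harmonic\<close>), so that piecewise harmonic functions are continuous and of finite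
  energy; by the maximum principle they approximate all continuous functions, which gives regularity.
  Strong locality holds because it holds on every level whose cells are small enough.  The domain depends only on the
  growth of the conductances.

  The measure.  Hausdorff outer measure is additive on separated sets, so by Caratheodory's criterion it is a
  measure on Borel sets.  It is finite on the gasket by the covers by cells, and positive because a set of
  diameter about \<open>2 ^ - k\<close> meets at most \<open>225\<close> cells of level \<open>k\<close>.

  The failure of self-similarity.  Restricting a function to a first-level cell replaces the conductances
  \<open>(a 0, b 0)\<close> by \<open>(a 1, b 1)\<close>.  If the energy were self-similar, the two energies would be proportional on
  functions vanishing at the three vertices.  Harmonic extensions of midpoint values would then yield
  \<open>a 2 / b 2 = a 1 / b 1\<close>, whereas the quotient \<open>a n / b n = x n / y n\<close> is strictly increasing.
\<close>

section \<open>Metric outer measures\<close>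

text \<open>
  Consecutive sets of the chain may touch, but \<open>R i\<close> and \<open>R j\<close> are separated as soon as
  \<open>i + 2 \<le> j\<close>.  Hence separated additivity applies to every second set of the chain; the parameter
  \<open>p\<close> selects the parity.
\<close>

lemma separated_chain_sum_le:
  fixes f :: "'a::metric_space set \<Rightarrow> ennreal" and R :: "nat \<Rightarrow> 'a set" and g :: "'a \<Rightarrow> real"
  assumes mono: "\<And>A B. A \<subseteq> B \<Longrightarrow> f A \<le> f B"
    and empty: "f {} = 0"
    and sep: "\<And>A B r. 0 < r \<Longrightarrow> (\<And>x y. x \<in> A \<Longrightarrow> y \<in> B \<Longrightarrow> r \<le> dist x y) \<Longrightarrow> f A + f B \<le> f (A \<union> B)"
    and R: "\<And>i j x y. x \<in> R i \<Longrightarrow> y \<in> R j \<Longrightarrow> i + 2 \<le> j \<Longrightarrow> 1 / (real i + 2) - 1 / (real i + 3) \<le> dist x y"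
    and sub: "\<And>k. R k \<subseteq> A"
  shows "(\<Sum>k<m. f (R (2 * k + p))) \<le> f A"
proof -
  have "(\<Sum>k<m. f (R (2 * k + p))) \<le> f (\<Union>k<m. R (2 * k + p))"
  proof (induction m)
    case 0
    then show ?case by (simp add: empty)
  next
    case (Suc m)
    show ?case
    proof (cases m)
      case 0
      then show ?thesis by (simp add: empty lessThan_Suc)
    next
      case (Suc m')
      let ?U = "\<Union>k<m. R (2 * k + p)"
      let ?r = "1 / (real (2 * m' + p) + 2) - 1 / (real (2 * m' + p) + 3)"
      have r_anti: "?r \<le> 1 / (real (2 * k + p) + 2) - 1 / (real (2 * k + p) + 3)" if "k \<le> m'" for k
      proof -
        have "1 / (t + 2) - 1 / (t + 3) = 1 / ((t + 2) * (t + 3))" if "0 \<le> t" for t :: real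
          using that by (simp add: field_simps)
        moreover have "1 / ((real (2 * m' + p) + 2) * (real (2 * m' + p) + 3))
            \<le> 1 / ((real (2 * k + p) + 2) * (real (2 * k + p) + 3))"
          using that by (intro divide_left_mono mult_mono mult_pos_pos) auto
        ultimately show ?thesis by simp
      qed
      have "f ?U + f (R (2 * m + p)) \<le> f (?U \<union> R (2 * m + p))"
      proof (rule sep)
        have "0 \<le> real (2 * m' + p)" by simp
        then have "1 / (real (2 * m' + p) + 3) < 1 / (real (2 * m' + p) + 2)" by (intro divide_strict_left_mono mult_pos_pos) linarith+
        then show "0 < ?r" by linarith
        show "?r \<le> dist x y" if xy: "x \<in> ?U" "y \<in> R (2 * m + p)" for x y
        proof -
          obtain k where k: "k < m" "x \<in> R (2 * k + p)" using xy(1) by auto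
          have "1 / (real (2 * k + p) + 2) - 1 / (real (2 * k + p) + 3) \<le> dist x y"
            using k xy(2) by (intro R) auto
          with r_anti[of k] k Suc show ?thesis by linarith
        qed
      qed
      with Suc.IH have "(\<Sum>k<m. f (R (2 * k + p))) + f (R (2 * m + p)) \<le> f (?U \<union> R (2 * m + p))"
        by (meson add_right_mono order_trans)
      also have "?U \<union> R (2 * m + p) = (\<Union>k<Suc m. R (2 * k + p))"
        by (auto simp: less_Suc_eq)
      finally show ?thesis by simp
    qed
  qed
  also have "\<dots> \<le> f A"
    using sub by (intro mono) auto
  finally show ?thesis .
qed

text \<open>
  The part of \<open>A\<close> outside \<open>C\<close> is exhausted by the sets of points at distance at least \<open>1 / (n + 1)\<close>
  from \<open>C\<close>, for which separated additivity gives the claim.  What they miss lies in the annuli \<open>R k\<close>,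
  \<open>k \<ge> n\<close>.  The annuli of each parity have total measure at most \<open>f A\<close>, so their series converges and
  its tail is negligible.
\<close>

lemma caratheodory_closed:
  fixes f :: "'a::metric_space set \<Rightarrow> ennreal"
  assumes mono: "\<And>A B. A \<subseteq> B \<Longrightarrow> f A \<le> f B"
    and empty: "f {} = 0"
    and csub: "\<And>A :: nat \<Rightarrow> 'a set. f (\<Union>i. A i) \<le> (\<Sum>i. f (A i))"
    and sep: "\<And>A B r. 0 < r \<Longrightarrow> (\<And>x y. x \<in> A \<Longrightarrow> y \<in> B \<Longrightarrow> r \<le> dist x y) \<Longrightarrow> f A + f B \<le> f (A \<union> B)"
    and C: "closed C"
  shows "f (A \<inter> C) + f (A - C) \<le> f A"
proof (cases "f A = \<infinity> \<or> C = {}")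
  case True
  then show ?thesis by (auto simp: empty)
next
  case False
  then have fin: "f A < \<infinity>" and ne: "C \<noteq> {}" by (auto simp: less_top)
  define B where "B n = {x \<in> A. 1 / (real n + 1) \<le> infdist x C}" for n :: nat
  define R where "R n = {x \<in> A. 1 / (real n + 2) \<le> infdist x C \<and> infdist x C < 1 / (real n + 1)}" for n :: nat
  have R_sep: "1 / (real i + 2) - 1 / (real i + 3) \<le> dist x y"
    if "x \<in> R i" "y \<in> R j" "i + 2 \<le> j" for i j x y
  proof -
    have "infdist y C < 1 / (real j + 1)" "1 / (real i + 2) \<le> infdist x C"
      using that by (auto simp: R_def)
    moreover have "1 / (real j + 1) \<le> 1 / (real i + 3)"
      using that(3) by (intro divide_left_mono) auto
    moreover have "infdist x C \<le> infdist y C + dist x y"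
      by (metis infdist_triangle)
    ultimately show ?thesis by linarith
  qed
  have sum_R: "(\<Sum>k<m. f (R (2 * k + p))) \<le> f A" for m p
    by (rule separated_chain_sum_le[OF mono empty sep R_sep]) (auto simp: R_def)
  have total: "(\<Sum>k. f (R k)) \<le> 2 * f A"
  proof (rule suminf_le_const[OF summableI])
    fix n
    have "(\<Sum>k<n. f (R k)) \<le> (\<Sum>k<2 * n. f (R k))"
      by (intro sum_mono2) auto
    also have "\<dots> = (\<Sum>k<n. f (R (2 * k + 0))) + (\<Sum>k<n. f (R (2 * k + 1)))"
      by (induction n) (auto simp: algebra_simps)
    also have "\<dots> \<le> f A + f A"
      by (intro add_mono sum_R)
    finally show "(\<Sum>k<n. f (R k)) \<le> 2 * f A" by (simp add: mult_2)
  qed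
  then have total_fin: "(\<Sum>k. f (R k)) < \<infinity>"
    using fin by (auto simp: ennreal_mult_less_top intro: le_less_trans)
  show ?thesis
  proof (rule ennreal_le_epsilon)
    fix e :: real assume "0 < e"
    let ?T = "\<Sum>k. f (R k)"
    obtain n where n: "(\<Sum>k. f (R (k + n))) \<le> ennreal e"
    proof -
      have "(\<lambda>n. \<Sum>k<n. f (R k)) \<longlonglongrightarrow> ?T"
        by (intro summable_LIMSEQ summableI)
      then have "(\<lambda>n. (\<Sum>k<n. f (R k)) + ennreal e) \<longlonglongrightarrow> ?T + ennreal e"
        by (intro tendsto_intros)
      moreover have "?T < ?T + ennreal e"
        using total_fin \<open>0 < e\<close> by (simp add: less_top)
      ultimately have "\<forall>\<^sub>F n in sequentially. ?T < (\<Sum>k<n. f (R k)) + ennreal e"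
        by (simp add: order_tendstoD(1))
      then obtain n where n: "?T < (\<Sum>k<n. f (R k)) + ennreal e"
        by (auto simp: eventually_sequentially)
      have "?T = (\<Sum>k. f (R (k + n))) + (\<Sum>k<n. f (R k))"
        by (intro suminf_offset summableI)
      moreover have "(\<Sum>k<n. f (R k)) < \<infinity>"
        by (rule le_less_trans[OF sum_le_suminf[OF summableI] total_fin]) auto
      ultimately have "(\<Sum>k. f (R (k + n))) \<le> ennreal e"
        using n by (auto simp: add.commute ennreal_add_left_cancel_less less_imp_le)
      then show ?thesis by (rule that)
    qed
    \<comment> \<open>The set \<open>B n\<close> is put in front of the annuli, so that one application of subadditivity suffices.\<close>
    have cover: "A - C \<subseteq> (\<Union>k. case k of 0 \<Rightarrow> B n | Suc k \<Rightarrow> R (k + n))"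
    proof
      fix x assume x: "x \<in> A - C"
      then have pos: "0 < infdist x C"
        using C ne by (simp add: infdist_pos_not_in_closed)
      show "x \<in> (\<Union>k. case k of 0 \<Rightarrow> B n | Suc k \<Rightarrow> R (k + n))"
      proof (cases "1 / (real n + 1) \<le> infdist x C")
        case True
        then have "x \<in> B n" using x by (simp add: B_def)
        then show ?thesis by (intro UN_I[of 0]) auto
      next
        case False
        obtain m where "1 / real (Suc m) < infdist x C"
          using nat_approx_posE[OF pos] by auto
        then have ex: "\<exists>m. 1 / (real m + 2) \<le> infdist x C"
        proof (intro exI[of _ m])
          have "1 / (real m + 2) \<le> 1 / real (Suc m)"
            by (intro divide_left_mono) auto
          with \<open>1 / real (Suc m) < infdist x C\<close> show "1 / (real m + 2) \<le> infdist x C" by linarith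
        qed
        define l where "l = (LEAST m. 1 / (real m + 2) \<le> infdist x C)"
        have l: "1 / (real l + 2) \<le> infdist x C"
          unfolding l_def by (rule LeastI_ex[OF ex])
        have nl: "n \<le> l"
        proof (rule ccontr)
          assume "\<not> n \<le> l"
          then have "1 / (real n + 1) \<le> 1 / (real l + 2)"
            by (intro divide_left_mono) auto
          with l False show False by linarith
        qed
        have "infdist x C < 1 / (real l + 1)"
        proof (cases "l = n")
          case True
          then show ?thesis using False by simp
        next
          case False
          with nl have "l - 1 < l" "real (l - 1) = real l - 1" by auto
          from not_less_Least[OF this(1)[unfolded l_def]] this(2) show ?thesis
            unfolding l_def[symmetric] by (simp add: algebra_simps)
        qed
        with l x have "x \<in> R (l - n + n)" using nl by (simp add: R_def)
        then show ?thesis by (intro UN_I[of "Suc (l - n)"]) auto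
      qed
    qed
    have "f (A - C) \<le> (\<Sum>k. f (case k of 0 \<Rightarrow> B n | Suc k \<Rightarrow> R (k + n)))"
      using mono[OF cover] csub order_trans by blast
    also have "\<dots> = f (B n) + (\<Sum>k. f (R (k + n)))"
      using suminf_offset[of "\<lambda>k. f (case k of 0 \<Rightarrow> B n | Suc k \<Rightarrow> R (k + n))" 1]
      by (simp add: add.commute)
    also have "\<dots> \<le> f (B n) + ennreal e"
      using n by (intro add_left_mono)
    finally have 1: "f (A - C) \<le> f (B n) + ennreal e" .
    have 2: "f (A \<inter> C) + f (B n) \<le> f (A \<inter> C \<union> B n)"
    proof (rule sep)
      show "0 < 1 / (real n + 1)" by simp
      show "1 / (real n + 1) \<le> dist x y" if "x \<in> A \<inter> C" "y \<in> B n" for x y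
        using that infdist_le[of x C y] by (auto simp: B_def dist_commute)
    qed
    have "f (A \<inter> C) + f (A - C) \<le> f (A \<inter> C) + (f (B n) + ennreal e)"
      using 1 by (rule add_left_mono)
    also have "\<dots> = f (A \<inter> C) + f (B n) + ennreal e" by (simp add: add.assoc)
    also have "\<dots> \<le> f A + ennreal e"
      by (intro add_right_mono order_trans[OF 2] mono) (auto simp: B_def)
    finally show "f (A \<inter> C) + f (A - C) \<le> f A + ennreal e" .
  qed
qed

text \<open>
  The sets that split every set additively form a \<open>\<sigma>\<close>-algebra on which \<open>f\<close> is a measure;
  closed sets belong to it by Caratheodory's criterion, hence all Borel sets do.
\<close>

lemma metric_outer_measure_is_borel_measure:
  fixes f :: "'a::metric_space set \<Rightarrow> ennreal"
  assumes mono: "\<And>A B. A \<subseteq> B \<Longrightarrow> f A \<le> f B"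
    and empty: "f {} = 0"
    and csub: "\<And>A :: nat \<Rightarrow> 'a set. f (\<Union>i. A i) \<le> (\<Sum>i. f (A i))"
    and sep: "\<And>A B r. 0 < r \<Longrightarrow> (\<And>x y. x \<in> A \<Longrightarrow> y \<in> B \<Longrightarrow> r \<le> dist x y) \<Longrightarrow> f A + f B \<le> f (A \<union> B)"
  shows "countably_additive (sets borel) f"
proof -
  interpret S: sigma_algebra UNIV "UNIV :: 'a set set"
    using sigma_algebra_Pow[of "UNIV :: 'a set"] by simp
  have "outer_measure_space UNIV f"
    using assms by (auto simp: outer_measure_space_def positive_def increasing_def countably_subadditive_def)
  then have ms: "measure_space UNIV (lambda_system UNIV UNIV f) f"
    by (rule S.caratheodory_lemma)
  then interpret L: sigma_algebra UNIV "lambda_system UNIV UNIV f"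
    by (simp add: measure_space_def)
  have "C \<in> lambda_system UNIV UNIV f" if "closed C" for C
  proof -
    have "f (A \<inter> C) + f (A - C) = f A" for A
    proof (rule antisym)
      show "f (A \<inter> C) + f (A - C) \<le> f A"
        using mono empty csub sep that by (rule caratheodory_closed)
      have "f A \<le> f (\<Union>i. binaryset (A \<inter> C) (A - C) i)"
        by (intro mono) (auto simp: UN_binaryset_eq)
      also have "\<dots> \<le> (\<Sum>i. f (binaryset (A \<inter> C) (A - C) i))" by (rule csub)
      also have "\<dots> = f (A \<inter> C) + f (A - C)"
        by (simp add: suminf_binaryset_eq empty)
      finally show "f A \<le> f (A \<inter> C) + f (A - C)" .
    qed
    then show ?thesis by (simp add: S.lambda_system_eq)
  qed
  then have "sigma_sets UNIV (Collect closed) \<subseteq> lambda_system UNIV UNIV f"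
    by (intro L.sigma_sets_subset) auto
  then have "sets borel \<subseteq> lambda_system UNIV UNIV f"
    by (simp add: borel_eq_closed)
  with ms show ?thesis
    unfolding measure_space_def countably_additive_def by (meson subset_trans subsetD)
qed

section \<open>Hausdorff measure\<close>

lemma hausdorff_pre_mono: "A \<subseteq> B \<Longrightarrow> hausdorff_pre s d A \<le> hausdorff_pre s d B"
  unfolding hausdorff_pre_def by (rule INF_superset_mono) auto

lemma hausdorff_pre_antimono: "d \<le> e \<Longrightarrow> hausdorff_pre s e A \<le> hausdorff_pre s d A"
  unfolding hausdorff_pre_def by (rule INF_superset_mono) (auto intro: order_trans)

lemma hausdorff_pre_le_outer: "0 < d \<Longrightarrow> hausdorff_pre s d A \<le> hausdorff_outer s A"
  unfolding hausdorff_outer_def by (rule SUP_upper) auto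

lemma hausdorff_outer_mono: "A \<subseteq> B \<Longrightarrow> hausdorff_outer s A \<le> hausdorff_outer s B"
  unfolding hausdorff_outer_def by (rule SUP_mono') (rule hausdorff_pre_mono)

lemma hausdorff_pre_le_cover:
  assumes "A \<subseteq> (\<Union>i. U i)" "\<And>i. bounded (U i)" "\<And>i. diameter (U i) \<le> d"
  shows "hausdorff_pre s d A \<le> (\<Sum>i. ennreal (diameter (U i) powr s))"
  unfolding hausdorff_pre_def using assms by (intro INF_lower) auto

lemma hausdorff_outer_empty: "hausdorff_outer s {} = 0"
proof -
  have "hausdorff_pre s d {} \<le> 0" if "0 < d" for d
    using hausdorff_pre_le_cover[of "{}" "\<lambda>_. {}" d s] that by simp
  then have "hausdorff_outer s ({} :: 'a set) \<le> 0"
    unfolding hausdorff_outer_def by (intro SUP_least) auto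
  then show ?thesis by simp
qed

text \<open>
  Almost optimal covers of the \<open>A i\<close>, with errors \<open>e / 2 ^ (i + 1)\<close>, are merged into one sequence
  by the pairing function.
\<close>

lemma hausdorff_pre_countably_subadditive:
  "hausdorff_pre s d (\<Union>i. A i) \<le> (\<Sum>i. hausdorff_pre s d (A i))"
proof (rule ennreal_le_epsilon)
  fix e :: real assume fin: "(\<Sum>i. hausdorff_pre s d (A i)) < top" and e: "0 < e"
  have "\<exists>U. (A i \<subseteq> (\<Union>j. U j) \<and> (\<forall>j. bounded (U j) \<and> diameter (U j) \<le> d)) \<and>
      (\<Sum>j. ennreal (diameter (U j) powr s)) < hausdorff_pre s d (A i) + ennreal (e * (1/2)^Suc i)" for i
  proof -
    have "hausdorff_pre s d (A i) < top"
      using ennreal_suminf_lessD[OF fin] by simp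
    then have "hausdorff_pre s d (A i) < hausdorff_pre s d (A i) + ennreal (e * (1/2)^Suc i)"
      using e by (simp add: less_top)
    then have "(INF U \<in> {U. A i \<subseteq> (\<Union>j. U j) \<and> (\<forall>j. bounded (U j) \<and> diameter (U j) \<le> d)}.
        \<Sum>j. ennreal (diameter (U j) powr s)) < hausdorff_pre s d (A i) + ennreal (e * (1/2)^Suc i)"
      unfolding hausdorff_pre_def[symmetric] .
    then show ?thesis unfolding INF_less_iff by auto
  qed
  then obtain U where U: "\<And>i. A i \<subseteq> (\<Union>j. U i j)" "\<And>i j. bounded (U i j)" "\<And>i j. diameter (U i j) \<le> d"
    and le: "\<And>i. (\<Sum>j. ennreal (diameter (U i j) powr s)) < hausdorff_pre s d (A i) + ennreal (e * (1/2)^Suc i)"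
    by metis
  let ?V = "\<lambda>n. (case prod_decode n of (i, j) \<Rightarrow> U i j)"
  have "hausdorff_pre s d (\<Union>i. A i) \<le> (\<Sum>n. ennreal (diameter (?V n) powr s))"
  proof (rule hausdorff_pre_le_cover)
    show "(\<Union>i. A i) \<subseteq> (\<Union>n. ?V n)"
    proof
      fix x assume "x \<in> (\<Union>i. A i)"
      then obtain i j where "x \<in> U i j" using U(1) by fast
      then show "x \<in> (\<Union>n. ?V n)" by (intro UN_I[of "prod_encode (i, j)"]) auto
    qed
  qed (auto split: prod.split simp: U)
  also have "\<dots> = (\<Sum>n. (\<lambda>(i, j). ennreal (diameter (U i j) powr s)) (prod_decode n))"
    by (intro suminf_cong) (auto split: prod.split)
  also have "\<dots> = (\<Sum>i. \<Sum>j. ennreal (diameter (U i j) powr s))"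
    by (rule suminf_ennreal_2dimen) simp
  also have "\<dots> \<le> (\<Sum>i. hausdorff_pre s d (A i) + ennreal (e * (1/2)^Suc i))"
    using le by (intro suminf_le summableI) (auto intro: less_imp_le)
  also have "\<dots> = (\<Sum>i. hausdorff_pre s d (A i)) + (\<Sum>i. ennreal (e * (1/2)^Suc i))"
    by (intro suminf_add[symmetric] summableI)
  also have "(\<Sum>i. ennreal (e * (1/2)^Suc i)) = ennreal e"
    using e sums_mult[OF power_half_series, of e] by (intro suminf_ennreal_eq) auto
  finally show "hausdorff_pre s d (\<Union>i. A i) \<le> (\<Sum>i. hausdorff_pre s d (A i)) + ennreal e" .
qed

lemma hausdorff_outer_countably_subadditive:
  "hausdorff_outer s (\<Union>i. A i) \<le> (\<Sum>i. hausdorff_outer s (A i))"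
proof -
  have "hausdorff_pre s d (\<Union>i. A i) \<le> (\<Sum>i. hausdorff_outer s (A i))" if "0 < d" for d
    using that by (intro order_trans[OF hausdorff_pre_countably_subadditive] suminf_le summableI
      hausdorff_pre_le_outer)
  then show ?thesis unfolding hausdorff_outer_def[of s "\<Union>i. A i"] by (intro SUP_least) auto
qed

text \<open>
  A covering set whose diameter is smaller than the separation meets only one of \<open>A\<close> and \<open>B\<close>, so a
  cover of the union splits into a cover of each.
\<close>

lemma hausdorff_pre_separated:
  assumes d: "d < r" and r: "\<And>x y. x \<in> A \<Longrightarrow> y \<in> B \<Longrightarrow> r \<le> dist x y"
  shows "hausdorff_pre s d A + hausdorff_pre s d B \<le> hausdorff_pre s d (A \<union> B)"
  unfolding hausdorff_pre_def[of s d "A \<union> B"]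
proof (rule INF_greatest)
  fix U :: "nat \<Rightarrow> 'a set"
  assume "U \<in> {U. A \<union> B \<subseteq> (\<Union>i. U i) \<and> (\<forall>i. bounded (U i) \<and> diameter (U i) \<le> d)}"
  then have cov: "A \<union> B \<subseteq> (\<Union>i. U i)" and bd: "\<And>i. bounded (U i)" and dm: "\<And>i. diameter (U i) \<le> d"
    by auto
  have d0: "0 \<le> d" using dm[of 0] diameter_ge_0[OF bd[of 0]] by linarith
  define V where "V i = (if U i \<inter> A = {} then {} else U i)" for i
  define W where "W i = (if U i \<inter> A = {} then U i else {})" for i
  have "U i \<inter> B = {}" if "U i \<inter> A \<noteq> {}" for i
  proof (rule ccontr)
    assume "U i \<inter> B \<noteq> {}"
    with that obtain x y where "x \<in> U i" "x \<in> A" "y \<in> U i" "y \<in> B" by auto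
    then show False
      using r[of x y] diameter_bounded_bound[OF bd[of i], of x y] dm[of i] d by fastforce
  qed
  note disj = this
  have W: "B \<subseteq> (\<Union>i. W i)"
  proof
    fix x assume x: "x \<in> B"
    then obtain i where "x \<in> U i" using cov by auto
    with x disj[of i] show "x \<in> (\<Union>i. W i)" by (intro UN_I[of i]) (auto simp: W_def)
  qed
  have V: "A \<subseteq> (\<Union>i. V i)"
  proof
    fix x assume x: "x \<in> A"
    then obtain i where "x \<in> U i" using cov by auto
    with x show "x \<in> (\<Union>i. V i)" by (intro UN_I[of i]) (auto simp: V_def)
  qed
  have "hausdorff_pre s d A + hausdorff_pre s d B
      \<le> (\<Sum>i. ennreal (diameter (V i) powr s)) + (\<Sum>i. ennreal (diameter (W i) powr s))"
    using V W bd dm d0 by (intro add_mono hausdorff_pre_le_cover) (auto simp: V_def W_def)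
  also have "\<dots> = (\<Sum>i. ennreal (diameter (V i) powr s) + ennreal (diameter (W i) powr s))"
    by (intro suminf_add summableI)
  also have "\<dots> = (\<Sum>i. ennreal (diameter (U i) powr s))"
    by (intro suminf_cong) (auto simp: V_def W_def)
  finally show "hausdorff_pre s d A + hausdorff_pre s d B \<le> (\<Sum>i. ennreal (diameter (U i) powr s))" .
qed

lemma hausdorff_outer_separated:
  assumes "0 < r" and r: "\<And>x y. x \<in> A \<Longrightarrow> y \<in> B \<Longrightarrow> r \<le> dist x y"
  shows "hausdorff_outer s A + hausdorff_outer s B \<le> hausdorff_outer s (A \<union> B)"
proof -
  have *: "hausdorff_pre s d A + hausdorff_pre s e B \<le> hausdorff_outer s (A \<union> B)" if "0 < d" "0 < e" for d e
  proof -
    let ?m = "min (min d e) (r / 2)"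
    have "hausdorff_pre s d A + hausdorff_pre s e B \<le> hausdorff_pre s ?m A + hausdorff_pre s ?m B"
      by (intro add_mono hausdorff_pre_antimono) auto
    also have "\<dots> \<le> hausdorff_pre s ?m (A \<union> B)"
      using assms by (intro hausdorff_pre_separated[where r = r]) auto
    also have "\<dots> \<le> hausdorff_outer s (A \<union> B)"
      using that assms by (intro hausdorff_pre_le_outer) auto
    finally show ?thesis .
  qed
  have ne: "{0 :: real<..} \<noteq> {}" by (auto intro: exI[of _ 1])
  have "hausdorff_pre s d A + hausdorff_outer s B \<le> hausdorff_outer s (A \<union> B)" if "0 < d" for d
  proof -
    have "hausdorff_pre s d A + (SUP e\<in>{0<..}. hausdorff_pre s e B)
        = (SUP e\<in>{0<..}. hausdorff_pre s d A + hausdorff_pre s e B)"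
      using ne by (rule ennreal_SUP_add_right)
    also have "\<dots> \<le> hausdorff_outer s (A \<union> B)"
      using * that by (intro SUP_least) auto
    finally show ?thesis by (simp add: hausdorff_outer_def[of s B])
  qed
  moreover have "(SUP d\<in>{0<..}. hausdorff_pre s d A) + hausdorff_outer s B
        = (SUP d\<in>{0<..}. hausdorff_pre s d A + hausdorff_outer s B)"
    by (rule ennreal_SUP_add_left[symmetric]) (rule ne)
  ultimately show ?thesis
    unfolding hausdorff_outer_def[of s A] by (auto intro: SUP_least)
qed

lemma emeasure_hausdorff_measure:
  fixes A :: "'a::metric_space set"
  assumes "A \<in> sets borel"
  shows "emeasure (hausdorff_measure s) A = hausdorff_outer s A"
  unfolding hausdorff_measure_def
proof (rule emeasure_measure_of_sigma[OF _ _ _ assms])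
  show "sigma_algebra UNIV (sets (borel :: 'a measure))"
    by (metis sets.sigma_algebra_axioms space_borel)
  show "positive (sets borel) (hausdorff_outer s)"
    by (simp add: positive_def hausdorff_outer_empty)
  show "countably_additive (sets borel) (hausdorff_outer s :: 'a set \<Rightarrow> ennreal)"
    by (rule metric_outer_measure_is_borel_measure[OF hausdorff_outer_mono hausdorff_outer_empty
          hausdorff_outer_countably_subadditive hausdorff_outer_separated])
qed

lemma sets_hausdorff_measure: "sets (hausdorff_measure s :: 'a::metric_space measure) = sets borel"
  unfolding hausdorff_measure_def
  using sets.sets_measure_of_eq[of "borel :: 'a measure" "hausdorff_outer s"] by simp

lemma space_hausdorff_measure: "space (hausdorff_measure s :: 'a::metric_space measure) = UNIV"
  by (metis sets_eq_imp_space_eq sets_hausdorff_measure space_borel)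

text \<open>
  Applied to the expanding inverse of a cell map, this carries positivity of the measure from the
  whole gasket to each of its cells.
\<close>

lemma hausdorff_outer_lipschitz_null:
  assumes L: "0 < L" and lip: "\<And>x y. dist (f x) (f y) \<le> L * dist x y" and s: "0 < s"
    and null: "hausdorff_outer s A = 0"
  shows "hausdorff_outer s (f ` A) = 0"
proof -
  have "hausdorff_pre s d (f ` A) \<le> 0" if d: "0 < d" for d
  proof (rule ennreal_le_epsilon)
    fix e :: real assume e: "0 < e"
    have "hausdorff_pre s (d / L) A \<le> hausdorff_outer s A"
      using d L by (intro hausdorff_pre_le_outer) auto
    then have "hausdorff_pre s (d / L) A < ennreal (e / L powr s)"
      using null e L by simp
    then obtain U where U: "A \<subseteq> (\<Union>i. U i)" "\<And>i. bounded (U i)" "\<And>i. diameter (U i) \<le> d / L"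
      and le: "(\<Sum>i. ennreal (diameter (U i) powr s)) < ennreal (e / L powr s)"
      unfolding hausdorff_pre_def INF_less_iff by auto
    have dist_le: "dist x y \<le> L * diameter (U i)" if "x \<in> f ` U i" "y \<in> f ` U i" for x y i
    proof -
      from that obtain u v where uv: "u \<in> U i" "v \<in> U i" "x = f u" "y = f v" by auto
      have "dist x y \<le> L * dist u v" using lip uv by simp
      also have "\<dots> \<le> L * diameter (U i)"
        using L uv diameter_bounded_bound[OF U(2)] by (intro mult_left_mono) auto
      finally show ?thesis .
    qed
    have diam: "diameter (f ` U i) \<le> L * diameter (U i)" for i
    proof (cases "U i = {}")
      case False
      then have "(SUP (x, y) \<in> f ` U i \<times> f ` U i. dist x y) \<le> L * diameter (U i)"
        using dist_le[of _ i] by (intro cSUP_least) auto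
      then show ?thesis using False by (simp add: diameter_def[of "f ` U i"])
    qed simp
    have bd: "bounded (f ` U i)" for i
      using dist_le[of _ i] unfolding bounded_two_points by blast
    have "hausdorff_pre s d (f ` A) \<le> (\<Sum>i. ennreal (diameter (f ` U i) powr s))"
    proof (rule hausdorff_pre_le_cover[OF _ bd])
      show "diameter (f ` U i) \<le> d" for i
        using diam[of i] mult_left_mono[OF U(3)[of i], of L] L by simp
      show "f ` A \<subseteq> (\<Union>i. f ` U i)" using U(1) by (metis image_UN image_mono)
    qed
    also have "\<dots> \<le> (\<Sum>i. ennreal (L powr s) * ennreal (diameter (U i) powr s))"
    proof (intro suminf_le summableI)
      fix i
      have "diameter (f ` U i) powr s \<le> (L * diameter (U i)) powr s"
        using diam[of i] diameter_ge_0[OF bd[of i]] s by (intro powr_mono2) auto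
      also have "\<dots> = L powr s * diameter (U i) powr s"
        by (rule powr_mult)
      finally show "ennreal (diameter (f ` U i) powr s) \<le> ennreal (L powr s) * ennreal (diameter (U i) powr s)"
        by (simp add: ennreal_mult'[symmetric] ennreal_leI)
    qed
    also have "\<dots> = ennreal (L powr s) * (\<Sum>i. ennreal (diameter (U i) powr s))"
      by (rule ennreal_suminf_cmult)
    also have "\<dots> \<le> ennreal (L powr s) * ennreal (e / L powr s)"
      using le by (intro mult_left_mono) auto
    also have "\<dots> = ennreal e"
      using L e by (simp flip: ennreal_mult)
    finally show "hausdorff_pre s d (f ` A) \<le> 0 + ennreal e" by simp
  qed
  then show ?thesis by (simp add: hausdorff_outer_def)
qed

section \<open>Geometry of the gasket\<close>

subsection \<open>Barycentric coordinates\<close>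

text \<open>
  Barycentric coordinates with respect to the three vertices.  In these coordinates \<^term>\<open>sg_map j\<close>
  halves everything and adds one half to the \<open>j\<close>-th coordinate, so that questions about the position
  of cells become arithmetic.
\<close>

definition bary :: "nat \<Rightarrow> complex \<Rightarrow> real" where
  "bary i z = (if i = 1 then 1 - Re z - Im z / sqrt 3
     else if i = 2 then Re z - Im z / sqrt 3 else 2 * Im z / sqrt 3)"

lemma sg_vertex_simps:
  "sg_vertex 1 = 0" "sg_vertex 2 = 1" "sg_vertex 3 = Complex (1/2) (sqrt 3 / 2)"
proof -
  have "exp (complex_of_real pi * \<i> / 3) = cis (pi / 3)"
    by (simp add: cis_conv_exp mult.commute)
  also have "\<dots> = Complex (1/2) (sqrt 3 / 2)"
    by (simp add: complex_eq_iff cos_60 sin_60)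
  finally show "sg_vertex 3 = Complex (1/2) (sqrt 3 / 2)" by (simp add: sg_vertex_def)
qed (auto simp: sg_vertex_def)

lemma bary_sum: "bary 1 z + bary 2 z + bary 3 z = 1"
  by (simp add: bary_def)

lemma bary_vertex:
  "i \<in> {1,2,3} \<Longrightarrow> j \<in> {1,2,3} \<Longrightarrow> bary i (sg_vertex j) = (if i = j then 1 else 0)"
  by (elim insertE) (auto simp: bary_def sg_vertex_simps sg_vertex_simps(1)[simplified])

lemma bary_sg_map:
  assumes "i \<in> {1,2,3}" "j \<in> {1,2,3}"
  shows "bary i (sg_map j z) = (bary i z + (if i = j then 1 else 0)) / 2"
proof -
  have "bary i (sg_map j z) = (bary i z + bary i (sg_vertex j)) / 2"
    by (simp add: bary_def sg_map_def add_divide_distrib diff_divide_distrib)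
  with bary_vertex[OF assms] show ?thesis by simp
qed

lemma bary_eqI:
  assumes "bary 2 z = bary 2 w" "bary 3 z = bary 3 w"
  shows "z = w"
  using assms by (simp add: bary_def complex_eq_iff)

lemma bary_lipschitz: "\<bar>bary i z - bary i w\<bar> \<le> 2 * dist z w"
proof -
  have re: "\<bar>Re z - Re w\<bar> \<le> dist z w" and im: "\<bar>Im z - Im w\<bar> \<le> dist z w"
    using abs_Re_le_cmod[of "z - w"] abs_Im_le_cmod[of "z - w"] by (auto simp: dist_norm)
  have s3: "1 \<le> sqrt (3::real)" by simp
  have s32: "2 / sqrt 3 \<le> (2::real)" by (simp add: divide_le_eq)
  have "\<bar>Im z / sqrt 3 - Im w / sqrt 3\<bar> = \<bar>Im z - Im w\<bar> / sqrt 3"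
    by (simp add: diff_divide_distrib[symmetric])
  also have "\<dots> \<le> \<bar>Im z - Im w\<bar> / 1"
    using s3 by (intro divide_left_mono) auto
  finally have "\<bar>Im z / sqrt 3 - Im w / sqrt 3\<bar> \<le> dist z w" using im by simp
  with re show ?thesis by (auto simp: bary_def)
qed

lemma continuous_on_bary: "continuous_on S (bary i)"
  unfolding bary_def by (cases "i = 1"; cases "i = 2") (auto intro!: continuous_intros)

lemma dist_sg_map: "dist (sg_map i x) (sg_map i y) = dist x y / 2"
proof -
  have "sg_map i x - sg_map i y = (x - y) / 2" by (simp add: sg_map_def field_simps)
  then show ?thesis by (simp only: dist_norm norm_divide norm_numeral)
qed

lemma sg_map_vertex: "sg_map i (sg_vertex i) = sg_vertex i"
  by (simp add: sg_map_def)

lemma sg_map_vertex_commute: "sg_map i (sg_vertex j) = sg_map j (sg_vertex i)"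
  by (simp add: sg_map_def field_simps)

lemma continuous_on_sg_map: "continuous_on S (sg_map i)"
  unfolding sg_map_def by (intro continuous_intros) auto

definition sg_inv :: "nat \<Rightarrow> complex \<Rightarrow> complex" where
  "sg_inv i z = 2 * z - sg_vertex i"

lemma sg_inv_map [simp]: "sg_inv i (sg_map i z) = z"
  by (simp add: sg_inv_def sg_map_def field_simps)

lemma continuous_on_sg_inv: "continuous_on S (sg_inv i)"
  unfolding sg_inv_def by (intro continuous_intros)

lemma three_cases: "i \<in> {1,2,3::nat} \<Longrightarrow> (i = 1 \<Longrightarrow> P) \<Longrightarrow> (i = 2 \<Longrightarrow> P) \<Longrightarrow> (i = 3 \<Longrightarrow> P) \<Longrightarrow> P"
  by auto

subsection \<open>Existence and uniqueness of the attractor\<close>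

definition sg_union :: "complex set \<Rightarrow> complex set" where
  "sg_union A = (\<Union>i\<in>{1,2,3}. sg_map i ` A)"

definition sg_triangle :: "complex set" where
  "sg_triangle = {z. \<forall>i\<in>{1,2,3}. 0 \<le> bary i z}"

lemma sg_union_mono: "A \<subseteq> B \<Longrightarrow> sg_union A \<subseteq> sg_union B"
  unfolding sg_union_def by blast

lemma compact_sg_union: "compact A \<Longrightarrow> compact (sg_union A)"
  unfolding sg_union_def
  by (intro compact_UN compact_continuous_image continuous_on_sg_map) auto

lemma compact_sg_triangle: "compact sg_triangle"
proof -
  have "closed sg_triangle"
    unfolding sg_triangle_def
    by (auto simp: Collect_conj_eq
      intro!: closed_Int closed_Collect_le continuous_on_bary continuous_on_const)
  moreover have "norm z \<le> 3" if z: "z \<in> sg_triangle" for z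
  proof -
    have b: "0 \<le> bary 1 z" "0 \<le> bary 2 z" "0 \<le> bary 3 z"
      using z by (auto simp: sg_triangle_def)
    with bary_sum[of z] have b23: "bary 2 z \<le> 1" "bary 3 z \<le> 1" by linarith+
    have re: "Re z = bary 2 z + bary 3 z / 2" and im: "Im z = bary 3 z * (sqrt 3 / 2)"
      by (auto simp: bary_def)
    have "sqrt 3 / 2 \<le> sqrt 4 / (2::real)"
      by (intro divide_right_mono real_sqrt_le_mono) auto
    then have "sqrt 3 / 2 \<le> (1::real)" by simp
    then have "Im z \<le> bary 3 z" "0 \<le> Im z"
      using b(3) mult_left_mono[of "sqrt 3 / 2" 1 "bary 3 z"] by (auto simp: im)
    with b b23 re cmod_le[of z] show ?thesis by linarith
  qed
  then have "bounded sg_triangle" by (auto simp: bounded_iff)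
  ultimately show ?thesis by (simp add: compact_eq_bounded_closed)
qed

lemma sg_union_triangle: "sg_union sg_triangle \<subseteq> sg_triangle"
  by (auto simp: sg_union_def sg_triangle_def bary_sg_map simp del: One_nat_def)

lemma sg_vertex_triangle: "i \<in> {1,2,3} \<Longrightarrow> sg_vertex i \<in> sg_triangle"
  by (auto simp: sg_triangle_def bary_vertex simp del: One_nat_def)

text \<open>
  Writing a point of \<open>A\<close> as an image of another point of \<open>A\<close> under a composition of \<open>n\<close> of the maps and
  replacing that point by one of \<open>B\<close> moves it by at most \<open>d / 2 ^ n\<close>.  Applied in both directions this
  shows that two compact attractors coincide.
\<close>

lemma sg_union_approx:
  assumes A: "bounded A" "A \<subseteq> sg_union A" and B: "B \<noteq> {}" "sg_union B \<subseteq> B"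
  shows "A \<subseteq> closure B"
proof -
  obtain d where d: "\<And>x y. x \<in> A \<Longrightarrow> y \<in> {SOME b. b \<in> B} \<Longrightarrow> dist x y \<le> d"
    using bounded_two_points[of "insert (SOME b. b \<in> B) A"] A(1) by auto
  have *: "\<forall>x\<in>A. \<exists>y\<in>B. dist x y \<le> d / 2 ^ n" for n
  proof (induction n)
    case 0
    have "(SOME b. b \<in> B) \<in> B" using B(1) by (simp add: some_in_eq)
    then show ?case using d by auto
  next
    case (Suc n)
    show ?case
    proof
      fix x assume "x \<in> A"
      then obtain i x' where i: "i \<in> {1,2,3}" "x' \<in> A" "x = sg_map i x'"
        using A(2) unfolding sg_union_def by blast
      then obtain y' where "y' \<in> B" "dist x' y' \<le> d / 2 ^ n" using Suc by blast
      moreover have "sg_map i y' \<in> B"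
        using i B(2) \<open>y' \<in> B\<close> unfolding sg_union_def by blast
      ultimately show "\<exists>y\<in>B. dist x y \<le> d / 2 ^ Suc n"
        using i by (intro bexI[of _ "sg_map i y'"]) (auto simp: dist_sg_map)
    qed
  qed
  show ?thesis
  proof
    fix x assume x: "x \<in> A"
    show "x \<in> closure B"
    proof (subst closure_approachable, intro allI impI)
      fix e :: real assume "0 < e"
      have "(\<lambda>n. d / 2 ^ n) \<longlonglongrightarrow> 0" by (rule LIMSEQ_divide_realpow_zero) auto
      then have "\<forall>\<^sub>F n in sequentially. d / 2 ^ n < e" using \<open>0 < e\<close> by (rule order_tendstoD)
      then obtain n where "d / 2 ^ n < e" by (auto simp: eventually_sequentially)
      with * x show "\<exists>y\<in>B. dist y x < e" by (metis dist_commute le_less_trans)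
    qed
  qed
qed

text \<open>
  The attractor is the intersection of the decreasing sequence of iterated images of the triangle.
  A point of the intersection lies in infinitely many of the sets \<open>sg_map i ` T n\<close> for one and the same
  \<open>i\<close>, because there are only three values of \<open>i\<close>; this gives the self-similarity.
\<close>

lemma gasket_exists:
  "\<exists>K. compact K \<and> K = sg_union K \<and> K \<subseteq> sg_triangle \<and> (\<forall>i\<in>{1,2,3}. sg_vertex i \<in> K)"
proof -
  define T where "T n = (sg_union ^^ n) sg_triangle" for n
  have T_Suc: "T (Suc n) = sg_union (T n)" for n by (simp add: T_def)
  have dec: "T (Suc n) \<subseteq> T n" for n
  proof (induction n)
    case 0
    then show ?case using sg_union_triangle by (simp add: T_def)
  next
    case (Suc n)
    then show ?case unfolding T_Suc by (rule sg_union_mono)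
  qed
  have anti: "n \<le> m \<Longrightarrow> T m \<subseteq> T n" for n m
    using lift_Suc_antimono_le[of T] dec by blast
  have comp: "compact (T n)" for n
    by (induction n) (auto simp: T_def compact_sg_triangle compact_sg_union)
  have vert: "sg_vertex i \<in> T n" if "i \<in> {1,2,3}" for i n
  proof (induction n)
    case 0
    then show ?case using sg_vertex_triangle[OF that] by (simp add: T_def)
  next
    case (Suc n)
    then show ?case unfolding T_Suc sg_union_def
      using that by (metis UN_I image_eqI sg_map_vertex)
  qed
  define K where "K = (\<Inter>n. T n)"
  have "K \<subseteq> sg_union K"
  proof
    fix x assume "x \<in> K"
    then have x: "x \<in> sg_union (T n)" for n using T_Suc by (auto simp: K_def)
    have "\<exists>i\<in>{1,2,3}. \<forall>n. x \<in> sg_map i ` T n"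
    proof (rule ccontr)
      assume "\<not> ?thesis"
      then obtain m where m: "\<And>i. i \<in> {1,2,3} \<Longrightarrow> x \<notin> sg_map i ` T (m i)" by metis
      define N where "N = Max (m ` {1,2,3})"
      obtain i where i: "i \<in> {1,2,3}" "x \<in> sg_map i ` T N"
        using x[of N] unfolding sg_union_def by blast
      have "m i \<le> N" using i(1) unfolding N_def by (intro Max_ge) auto
      then have "T N \<subseteq> T (m i)" by (rule anti)
      with i m[OF i(1)] show False by blast
    qed
    then obtain i where i: "i \<in> {1,2,3}" "\<And>n. x \<in> sg_map i ` T n" by blast
    have "sg_inv i x \<in> T n" for n using i(2)[of n] by auto
    moreover have "x = sg_map i (sg_inv i x)" using i(2)[of 0] by auto
    ultimately have "x \<in> sg_map i ` K" unfolding K_def by blast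
    then show "x \<in> sg_union K" using i(1) unfolding sg_union_def by blast
  qed
  moreover have "sg_union K \<subseteq> K"
  proof -
    have "sg_union K \<subseteq> T n" for n
      using sg_union_mono[of K "T n"] dec[of n] by (auto simp: K_def T_Suc)
    then show ?thesis by (auto simp: K_def)
  qed
  moreover have "compact K" unfolding K_def
    by (intro compact_Inter) (use comp in auto)
  moreover have "K \<subseteq> T 0" by (auto simp: K_def)
  then have "K \<subseteq> sg_triangle" by (simp add: T_def)
  moreover have "K = sg_union K" using calculation(1,2) by blast
  moreover have "sg_vertex i \<in> K" if "i \<in> {1,2,3}" for i
    using vert[OF that] by (auto simp: K_def)
  ultimately show ?thesis by (intro exI[of _ K]) auto
qed

lemma gasket_facts:
  "compact gasket \<and> gasket = sg_union gasket \<and> gasket \<subseteq> sg_triangle \<and> (\<forall>i\<in>{1,2,3}. sg_vertex i \<in> gasket)"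
proof -
  obtain K where K: "compact K" "K = sg_union K" "K \<subseteq> sg_triangle" "\<forall>i\<in>{1,2,3}. sg_vertex i \<in> K"
    using gasket_exists by blast
  have "gasket = K"
    unfolding gasket_def sg_union_def[symmetric]
  proof (rule the_equality)
    show "compact K \<and> K \<noteq> {} \<and> K = sg_union K" using K by auto
    fix L assume L: "compact L \<and> L \<noteq> {} \<and> L = sg_union L"
    have "L \<subseteq> closure K" "K \<subseteq> closure L"
      using L K by (intro sg_union_approx; auto intro: compact_imp_bounded)+
    then show "L = K"
      using L K(1) by (auto simp: compact_imp_closed)
  qed
  with K show ?thesis by simp
qed

lemma compact_gasket: "compact gasket"
  and gasket_eq_union: "gasket = sg_union gasket"
  and gasket_triangle: "gasket \<subseteq> sg_triangle"
  and sg_vertex_gasket: "i \<in> {1,2,3} \<Longrightarrow> sg_vertex i \<in> gasket"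
  using gasket_facts by blast+

lemma gasket_nonempty: "gasket \<noteq> {}"
  using sg_vertex_gasket[of 1] by auto

lemma sg_map_gasket: "i \<in> {1,2,3} \<Longrightarrow> x \<in> gasket \<Longrightarrow> sg_map i x \<in> gasket"
  using gasket_eq_union unfolding sg_union_def by blast

lemma gasket_cases:
  assumes "x \<in> gasket"
  obtains i y where "i \<in> {1,2,3}" "y \<in> gasket" "x = sg_map i y"
  using assms gasket_eq_union unfolding sg_union_def by blast

lemma bary_gasket: "x \<in> gasket \<Longrightarrow> i \<in> {1,2,3} \<Longrightarrow> 0 \<le> bary i x"
  using gasket_triangle by (auto simp: sg_triangle_def)

lemma bary_gasket_le_1: "x \<in> gasket \<Longrightarrow> i \<in> {1,2,3} \<Longrightarrow> bary i x \<le> 1"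
  using bary_gasket[of x 1] bary_gasket[of x 2] bary_gasket[of x 3] bary_sum[of x]
  by (auto simp del: One_nat_def)

text \<open>
  This shows that first-level cells meet only at images of vertices: if \<^term>\<open>sg_map i x\<close> also lies in the
  \<open>j\<close>-th cell, \<open>j \<noteq> i\<close>, its \<open>j\<close>-th coordinate is at least one half, so the \<open>j\<close>-th coordinate of \<open>x\<close> is at
  least one.
\<close>

lemma bary_ge_1:
  assumes i: "i \<in> {1,2,3}" and x: "x \<in> gasket" and "1 \<le> bary i x"
  shows "x = sg_vertex i"
proof -
  have nn: "0 \<le> bary 1 x" "0 \<le> bary 2 x" "0 \<le> bary 3 x"
    using bary_gasket[OF x] by auto
  from i have "bary m x = bary m (sg_vertex i)" if "m \<in> {2,3}" for m
    using that assms(3) nn bary_sum[of x] by (elim three_cases) (auto simp: bary_vertex simp del: One_nat_def)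
  then show ?thesis by (auto intro!: bary_eqI)
qed

subsection \<open>Words and cells\<close>

lemma sg_word_map_Nil [simp]: "sg_word_map [] = id"
  and sg_word_map_Cons [simp]: "sg_word_map (i # w) = sg_map i \<circ> sg_word_map w"
  by (auto simp: sg_word_map_def)

lemma sg_word_map_append: "sg_word_map (v @ w) = sg_word_map v \<circ> sg_word_map w"
  by (induction v) (auto simp: comp_assoc)

lemma sg_words_0 [simp]: "sg_words 0 = {[]}"
  by (auto simp: sg_words_def)

lemma sg_words_Suc: "sg_words (Suc n) = (\<Union>i\<in>{1,2,3}. (#) i ` sg_words n)"
proof -
  have "w \<in> (\<Union>i\<in>{1,2,3}. (#) i ` sg_words n)" if "w \<in> sg_words (Suc n)" for w
    using that by (cases w) (auto simp: sg_words_def)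
  then show ?thesis by (auto simp: sg_words_def)
qed

lemma finite_sg_words [simp]: "finite (sg_words n)"
  by (induction n) (auto simp: sg_words_Suc)

lemma sum_sg_words_Suc: "(\<Sum>w\<in>sg_words (Suc n). g w) = (\<Sum>i\<in>{1,2,3}. \<Sum>w\<in>sg_words n. g (i # w))"
  unfolding sg_words_Suc
  by (subst sum.UNION_disjoint) (auto simp: sum.reindex inj_on_def)

lemma card_sg_words: "card (sg_words n) = 3 ^ n"
  using sum_sg_words_Suc[of "\<lambda>_. 1::nat"] by (induction n) simp_all

lemma sg_word_map_gasket: "w \<in> sg_words n \<Longrightarrow> x \<in> gasket \<Longrightarrow> sg_word_map w x \<in> gasket"
  by (induction n arbitrary: w) (auto simp: sg_words_Suc sg_map_gasket simp del: One_nat_def)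

lemma dist_sg_word_map: "dist (sg_word_map w x) (sg_word_map w y) = dist x y / 2 ^ length w"
  by (induction w) (auto simp: dist_sg_map)

lemma gasket_cell_cover:
  assumes "x \<in> gasket"
  shows "\<exists>w\<in>sg_words n. \<exists>y\<in>gasket. x = sg_word_map w y"
  using assms
proof (induction n arbitrary: x)
  case (Suc n)
  from Suc.prems obtain i y where "i \<in> {1,2,3}" "y \<in> gasket" "x = sg_map i y" by (rule gasket_cases)
  moreover from Suc.IH[OF this(2)] obtain w z where "w \<in> sg_words n" "z \<in> gasket" "y = sg_word_map w z" by blast
  ultimately show ?case by (intro bexI[of _ "i # w"] bexI[of _ z]) (auto simp: sg_words_Suc)
qed auto

subsection \<open>Gluing functions along the first-level cells\<close>

definition glue :: "(nat \<Rightarrow> complex \<Rightarrow> real) \<Rightarrow> complex \<Rightarrow> real" where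
  "glue v z = (if 1/2 \<le> bary 1 z then v 1 (sg_inv 1 z)
     else if 1/2 \<le> bary 2 z then v 2 (sg_inv 2 z) else v 3 (sg_inv 3 z))"

text \<open>
  The cells \<open>i\<close> and \<open>j\<close> share the point \<open>sg_map i (sg_vertex j) = sg_map j (sg_vertex i)\<close>.
\<close>

definition gluable :: "(nat \<Rightarrow> complex \<Rightarrow> real) \<Rightarrow> bool" where
  "gluable v \<longleftrightarrow> (\<forall>i\<in>{1,2,3}. \<forall>j\<in>{1,2,3}. v i (sg_vertex j) = v j (sg_vertex i))"

text \<open>
  Suppose that \<^const>\<open>glue\<close> uses the branch \<open>j \<noteq> i\<close> at \<^term>\<open>sg_map i x\<close>.  Then the \<open>j\<close>-th coordinate of
  that point is at least one half, so the \<open>j\<close>-th coordinate of \<open>x\<close> is at least one and \<open>x\<close> is the \<open>j\<close>-th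
  vertex, where the two branches agree.
\<close>

lemma glue_sg_map:
  assumes v: "gluable v" and i: "i \<in> {1,2,3}" and x: "x \<in> gasket"
  shows "glue v (sg_map i x) = v i x"
proof -
  let ?z = "sg_map i x"
  \<comment> \<open>the branch that is used\<close>
  define j :: nat where "j = (if 1/2 \<le> bary 1 ?z then 1 else if 1/2 \<le> bary 2 ?z then 2 else 3)"
  have j: "j \<in> {1,2,3}" by (auto simp: j_def)
  have g: "glue v ?z = v j (sg_inv j ?z)" by (auto simp: glue_def j_def)
  show ?thesis
  proof (cases "i = j")
    case True
    then show ?thesis using g by simp
  next
    case False
    have half: "1/2 \<le> bary i ?z" using bary_gasket[OF x i] bary_sg_map[OF i i, of x] by simp
    have jn3: "j \<noteq> 3" using False half i by (auto simp: j_def split: if_splits simp del: One_nat_def)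
    then have "1/2 \<le> bary j ?z" unfolding j_def by (auto split: if_splits simp del: One_nat_def)
    then have "1 \<le> bary j x" using False bary_sg_map[OF j i, of x] by simp
    then have xj: "x = sg_vertex j" using j x by (simp add: bary_ge_1)
    then have "sg_inv j ?z = sg_vertex i"
      by (metis sg_inv_map sg_map_vertex_commute)
    with g v i j xj show ?thesis unfolding gluable_def by metis
  qed
qed

lemma continuous_on_gasketI:
  assumes "\<And>i. i \<in> {1,2,3} \<Longrightarrow> continuous_on gasket (u \<circ> sg_map i)"
  shows "continuous_on gasket u"
proof -
  have "continuous_on (sg_map i ` gasket) u" if i: "i \<in> {1,2,3}" for i
  proof -
    have "continuous_on (sg_map i ` gasket) ((u \<circ> sg_map i) \<circ> sg_inv i)"
      by (rule continuous_on_compose[OF continuous_on_sg_inv])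
         (use assms[OF i] in \<open>simp add: image_image\<close>)
    then show ?thesis by (rule continuous_on_eq) auto
  qed
  moreover have "closed (sg_map i ` gasket)" for i
    by (intro compact_imp_closed compact_continuous_image continuous_on_sg_map compact_gasket)
  ultimately have "continuous_on (\<Union>i\<in>{1,2,3}. sg_map i ` gasket) u"
    by (intro continuous_on_closed_Union) auto
  then show ?thesis using gasket_eq_union unfolding sg_union_def by simp
qed

lemma continuous_on_glue:
  assumes "gluable v" "\<And>i. i \<in> {1,2,3} \<Longrightarrow> continuous_on gasket (v i)"
  shows "continuous_on gasket (glue v)"
proof (rule continuous_on_gasketI)
  fix i :: nat assume i: "i \<in> {1,2,3}"
  show "continuous_on gasket (glue v \<circ> sg_map i)"
    using assms(2)[OF i] by (rule continuous_on_eq) (simp add: glue_sg_map[OF assms(1) i])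
qed

section \<open>The normalized Hausdorff measure of the gasket\<close>

abbreviation sg_dim :: real where "sg_dim \<equiv> ln 3 / ln 2"

abbreviation sg_cell :: "nat list \<Rightarrow> complex set" where "sg_cell w \<equiv> sg_word_map w ` gasket"

lemma sg_dim_pos: "0 < sg_dim"
  by simp

lemma half_power_powr_sg_dim: "((1/2) ^ n) powr sg_dim = (1/3) ^ n"
proof -
  have "(1/2) powr sg_dim = exp (- ln 3 :: real)"
    by (simp add: powr_def ln_div)
  then have "(1/2) powr sg_dim = 1/3" by (simp add: exp_minus)
  then show ?thesis
  proof (induction n)
    case (Suc n)
    then show ?case by (simp only: power_Suc powr_mult \<open>(1/2) powr sg_dim = 1/3\<close>)
  qed simp
qed

lemma diameter_sg_cell:
  assumes "w \<in> sg_words n"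
  shows "bounded (sg_cell w)" "diameter (sg_cell w) \<le> diameter gasket * (1/2) ^ n"
proof -
  have n: "length w = n" using assms by (simp add: sg_words_def)
  have bK: "bounded gasket" using compact_gasket by (rule compact_imp_bounded)
  have *: "dist x y \<le> diameter gasket * (1/2) ^ n" if "x \<in> sg_cell w" "y \<in> sg_cell w" for x y
  proof -
    from that obtain a b where ab: "a \<in> gasket" "b \<in> gasket" "x = sg_word_map w a" "y = sg_word_map w b" by auto
    have "dist x y = dist a b * (1/2) ^ n" using ab n by (simp add: dist_sg_word_map power_one_over)
    also have "\<dots> \<le> diameter gasket * (1/2) ^ n"
      using diameter_bounded_bound[OF bK ab(1,2)] by (intro mult_right_mono) auto
    finally show ?thesis .
  qed
  then show "bounded (sg_cell w)" unfolding bounded_two_points by blast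
  have "sg_cell w \<noteq> {}" using gasket_nonempty by simp
  then have "(SUP (x, y) \<in> sg_cell w \<times> sg_cell w. dist x y) \<le> diameter gasket * (1/2) ^ n"
    using * by (intro cSUP_least) auto
  then show "diameter (sg_cell w) \<le> diameter gasket * (1/2) ^ n"
    using \<open>sg_cell w \<noteq> {}\<close> by (simp add: diameter_def[of "sg_cell w"])
qed

lemma eventually_small_cells:
  assumes "0 < d"
  shows "\<forall>\<^sub>F n in sequentially. diameter gasket * (1/2) ^ n < d"
proof -
  have "(\<lambda>n. diameter gasket * (1/2) ^ n) \<longlonglongrightarrow> diameter gasket * 0"
    by (intro tendsto_intros) auto
  with assms show ?thesis by (auto dest: order_tendstoD(2))
qed

lemma small_cells: "0 < d \<Longrightarrow> \<exists>n. diameter gasket * (1/2) ^ n < d"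
  using eventually_small_cells by (auto simp: eventually_sequentially)

text \<open>
  The \<open>3 ^ n\<close> cells of level \<open>n\<close> have diameter at most \<open>D / 2 ^ n\<close>, and \<open>2\<close> to the power \<^term>\<open>sg_dim\<close>
  is \<open>3\<close>: the sum over this cover is at most \<open>D powr sg_dim\<close> for every \<open>n\<close>.
\<close>

lemma hausdorff_gasket_finite: "hausdorff_outer sg_dim gasket < \<infinity>"
proof -
  let ?D = "diameter gasket"
  have D0: "0 \<le> ?D" using compact_gasket by (intro diameter_ge_0 compact_imp_bounded)
  have "hausdorff_pre sg_dim d gasket \<le> ennreal (?D powr sg_dim)" if d: "0 < d" for d
  proof -
    obtain n where n: "?D * (1/2) ^ n < d" using small_cells[OF d] by blast
    obtain ws where ws: "set ws = sg_words n" "distinct ws"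
      using finite_distinct_list[OF finite_sg_words] by blast
    then have len: "length ws = 3 ^ n" using card_sg_words distinct_card by metis
    define U where "U i = (if i < 3 ^ n then sg_cell (ws ! i) else {})" for i
    have wsi: "ws ! i \<in> sg_words n" if "i < 3 ^ n" for i using ws(1) len that nth_mem by metis
    have "hausdorff_pre sg_dim d gasket \<le> (\<Sum>i. ennreal (diameter (U i) powr sg_dim))"
    proof (rule hausdorff_pre_le_cover)
      show "gasket \<subseteq> (\<Union>i. U i)"
      proof
        fix x assume "x \<in> gasket"
        then obtain w y where w: "w \<in> sg_words n" "y \<in> gasket" "x = sg_word_map w y"
          using gasket_cell_cover[of x n] by blast
        then obtain i where "i < 3 ^ n" "ws ! i = w"
          using ws len by (metis in_set_conv_nth)
        with w show "x \<in> (\<Union>i. U i)" by (intro UN_I[of i]) (auto simp: U_def)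
      qed
      show "bounded (U i)" for i using diameter_sg_cell(1)[OF wsi, of i] by (simp add: U_def)
      show "diameter (U i) \<le> d" for i
        using diameter_sg_cell(2)[OF wsi, of i] n d by (auto simp: U_def)
    qed
    also have "\<dots> = (\<Sum>i<3 ^ n. ennreal (diameter (U i) powr sg_dim))"
      by (rule suminf_finite) (auto simp: U_def)
    also have "\<dots> \<le> (\<Sum>i<(3::nat) ^ n. ennreal (?D powr sg_dim * (1/3) ^ n))"
    proof (intro sum_mono ennreal_leI)
      fix i assume "i \<in> {..<(3::nat) ^ n}"
      then have i: "i < 3 ^ n" by simp
      have "diameter (U i) powr sg_dim \<le> (?D * (1/2) ^ n) powr sg_dim"
        using diameter_sg_cell[OF wsi[OF i]] i by (intro powr_mono2) (auto simp: U_def diameter_ge_0)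
      also have "\<dots> = ?D powr sg_dim * (1/3) ^ n"
        by (simp only: powr_mult half_power_powr_sg_dim)
      finally show "diameter (U i) powr sg_dim \<le> ?D powr sg_dim * (1/3) ^ n" .
    qed
    also have "\<dots> = ennreal (3 ^ n * (?D powr sg_dim * (1/3) ^ n))"
      by (simp add: ennreal_mult ennreal_of_nat_eq_real_of_nat)
    also have "3 ^ n * (?D powr sg_dim * (1/3) ^ n) = ?D powr sg_dim"
      by (simp add: power_one_over)
    finally show ?thesis .
  qed
  then have "hausdorff_outer sg_dim gasket \<le> ennreal (?D powr sg_dim)"
    unfolding hausdorff_outer_def by (intro SUP_least) auto
  then show ?thesis by (rule le_less_trans) simp
qed

text \<open>
  For \<open>j = 2, 3\<close> the corner \<^term>\<open>sg_word_map w 0\<close> of a cell has the barycentric coordinate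
  \<^term>\<open>real (cell_pos j w) / 2 ^ length w\<close>, whose binary digits record where the letter \<open>j\<close> occurs in
  the word.
\<close>

fun cell_pos :: "nat \<Rightarrow> nat list \<Rightarrow> nat" where
  "cell_pos j [] = 0"
| "cell_pos j (i # w) = cell_pos j w + (if i = j then 2 ^ length w else 0)"

lemma bary_sg_word_map:
  assumes "j \<in> {1,2,3}" "set w \<subseteq> {1,2,3}"
  shows "bary j (sg_word_map w z) = (bary j z + real (cell_pos j w)) / 2 ^ length w"
  using assms(2)
proof (induction w)
  case (Cons i w)
  then have "i \<in> {1,2,3}" by simp
  with Cons assms(1) show ?case
    by (auto simp: bary_sg_map field_simps simp del: One_nat_def)
qed simp

lemma cell_pos_less: "cell_pos j w < 2 ^ length w"
  by (induction w) auto

lemma cell_pos_inj: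
  assumes "v \<in> sg_words n" "w \<in> sg_words n"
    and "cell_pos 2 v = cell_pos 2 w" "cell_pos 3 v = cell_pos 3 w"
  shows "v = w"
  using assms
proof (induction n arbitrary: v w)
  case (Suc n)
  from Suc.prems(1,2) obtain i v' k w' where v: "v = i # v'" "i \<in> {1,2,3}" "v' \<in> sg_words n"
    and w: "w = k # w'" "k \<in> {1,2,3}" "w' \<in> sg_words n"
    unfolding sg_words_Suc by blast
  have len: "length v' = n" "length w' = n" using v w by (auto simp: sg_words_def)
  have "(i = j \<longleftrightarrow> k = j) \<and> cell_pos j v' = cell_pos j w'" if "cell_pos j v = cell_pos j w" for j
    using that cell_pos_less[of j v'] cell_pos_less[of j w'] by (auto simp: v w len split: if_splits)
  with Suc.prems(3,4) have ik: "i = 2 \<longleftrightarrow> k = 2" "i = 3 \<longleftrightarrow> k = 3"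
    and eq: "cell_pos 2 v' = cell_pos 2 w'" "cell_pos 3 v' = cell_pos 3 w'" by blast+
  have "i = k" using ik v(2) w(2) by auto
  with Suc.IH[OF v(3) w(3) eq] v w show ?case by simp
qed simp

text \<open>
  The corners of the cells of level \<open>k\<close> form part of a triangular lattice of mesh \<open>2 ^ - k\<close>.  If two
  cells meet \<open>V\<close>, their integer coordinates differ by at most \<open>7\<close>: at most \<open>6\<close> comes from the diameter of
  \<open>V\<close> and at most \<open>1\<close> from the position inside the cells.  This leaves \<open>15 \<cdot> 15\<close> positions.
\<close>

lemma card_cells_meeting_small_set:
  assumes V: "\<And>x y. x \<in> V \<Longrightarrow> y \<in> V \<Longrightarrow> dist x y \<le> 3 * (1/2) ^ k"
  shows "card {w \<in> sg_words k. sg_cell w \<inter> V \<noteq> {}} \<le> 225"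
proof (cases "{w \<in> sg_words k. sg_cell w \<inter> V \<noteq> {}} = {}")
  case True
  then show ?thesis by (metis card.empty zero_le)
next
  case False
  let ?S = "{w \<in> sg_words k. sg_cell w \<inter> V \<noteq> {}}"
  obtain w0 where w0: "w0 \<in> ?S" using False by blast
  have near: "cell_pos j w \<in> {cell_pos j w0 - 7..cell_pos j w0 + 7}" if w: "w \<in> ?S" and j: "j \<in> {1,2,3}" for j w
  proof -
    from w w0 obtain x y where x: "x \<in> gasket" "sg_word_map w x \<in> V" and y: "y \<in> gasket" "sg_word_map w0 y \<in> V"
      by auto
    have len: "length w = k" "length w0 = k" "set w \<subseteq> {1,2,3}" "set w0 \<subseteq> {1,2,3}"
      using w w0 by (auto simp: sg_words_def)
    have "\<bar>bary j (sg_word_map w x) - bary j (sg_word_map w0 y)\<bar> \<le> 2 * dist (sg_word_map w x) (sg_word_map w0 y)"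
      by (rule bary_lipschitz)
    also have "\<dots> \<le> 2 * (3 * (1/2) ^ k)" using V[OF x(2) y(2)] by simp
    finally have "\<bar>(bary j x + real (cell_pos j w)) / 2 ^ k - (bary j y + real (cell_pos j w0)) / 2 ^ k\<bar> \<le> 6 / 2 ^ k"
      using len j by (simp add: bary_sg_word_map power_one_over)
    then have "\<bar>(bary j x + real (cell_pos j w)) - (bary j y + real (cell_pos j w0))\<bar> / 2 ^ k \<le> 6 / 2 ^ k"
      by (simp add: diff_divide_distrib[symmetric])
    then have "\<bar>(bary j x + real (cell_pos j w)) - (bary j y + real (cell_pos j w0))\<bar> \<le> 6"
      by (simp add: divide_le_cancel)
    moreover have "0 \<le> bary j x" "bary j x \<le> 1" "0 \<le> bary j y" "bary j y \<le> 1"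
      using x y j bary_gasket bary_gasket_le_1 by auto
    ultimately have "\<bar>real (cell_pos j w) - real (cell_pos j w0)\<bar> \<le> 7" by linarith
    then show ?thesis by auto
  qed
  have "card ?S = card ((\<lambda>w. (cell_pos 2 w, cell_pos 3 w)) ` ?S)"
    by (rule card_image[symmetric]) (auto simp: inj_on_def intro: cell_pos_inj)
  also have "\<dots> \<le> card ({cell_pos 2 w0 - 7..cell_pos 2 w0 + 7} \<times> {cell_pos 3 w0 - 7..cell_pos 3 w0 + 7})"
    using near by (intro card_mono) blast+
  also have "\<dots> \<le> 15 * 15" unfolding card_cartesian_product by (intro mult_mono) auto
  finally show ?thesis by simp
qed

text \<open>
  A cell of level \<open>n\<close> that meets \<open>V\<close> lies in a cell of level \<open>k\<close> that meets \<open>V\<close>.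
\<close>

lemma card_subcells_meeting_small_set:
  assumes V: "\<And>x y. x \<in> V \<Longrightarrow> y \<in> V \<Longrightarrow> dist x y \<le> 3 * (1/2) ^ k" and "k \<le> n"
  shows "card {w \<in> sg_words n. sg_cell w \<inter> V \<noteq> {}} \<le> 225 * 3 ^ (n - k)"
proof -
  let ?S = "\<lambda>n. {w \<in> sg_words n. sg_cell w \<inter> V \<noteq> {}}"
  have "?S n \<subseteq> (\<lambda>(v, w). v @ w) ` (?S k \<times> sg_words (n - k))"
  proof
    fix w assume w: "w \<in> ?S n"
    then have wn: "length w = n" "set w \<subseteq> {1,2,3}" by (auto simp: sg_words_def)
    let ?a = "take k w" and ?b = "drop k w"
    have a: "?a \<in> sg_words k" using wn assms(2) by (auto simp: sg_words_def dest: in_set_takeD)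
    have b: "?b \<in> sg_words (n - k)" using wn by (auto simp: sg_words_def dest: in_set_dropD)
    have "sg_cell w = sg_word_map ?a ` sg_cell ?b"
      by (metis append_take_drop_id image_comp sg_word_map_append)
    also have "\<dots> \<subseteq> sg_cell ?a" using sg_word_map_gasket[OF b] by auto
    finally have "?a \<in> ?S k" using a w by auto
    with b show "w \<in> (\<lambda>(v, w). v @ w) ` (?S k \<times> sg_words (n - k))"
      by (intro image_eqI[of _ _ "(?a, ?b)"]) auto
  qed
  then have "card (?S n) \<le> card ((\<lambda>(v, w). v @ w) ` (?S k \<times> sg_words (n - k)))"
    by (intro card_mono finite_imageI finite_cartesian_product) auto
  also have "\<dots> \<le> card (?S k \<times> sg_words (n - k))"
    by (intro card_image_le finite_cartesian_product) auto
  also have "\<dots> \<le> 225 * 3 ^ (n - k)"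
    unfolding card_cartesian_product card_sg_words
    by (intro mult_right_mono card_cells_meeting_small_set V) auto
  finally show ?thesis .
qed

text \<open>
  The level whose cells are as large as a covering set of diameter \<open>t\<close>.  The summand \<open>e\<close> is
  needed for \<open>t = 0\<close>, where every level qualifies and a high one must be taken.
\<close>

lemma level_of_diameter:
  fixes t e :: real
  assumes "0 \<le> t" "t \<le> 1" "0 < e"
  shows "\<exists>k. t \<le> (1/2) ^ k \<and> (1/3) ^ k \<le> 3 * t powr sg_dim + e"
proof (cases "t = 0")
  case True
  obtain k where "(1/3) ^ k < e" using real_arch_pow_inv[OF assms(3), of "1/3"] by auto
  with True show ?thesis by (intro exI[of _ k]) auto
next
  case False
  then have t: "0 < t" using assms by simp
  then have ex: "\<exists>k. (1/2) ^ k < t" using real_arch_pow_inv[of t "1/2"] by auto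
  define m where "m = (LEAST k. (1/2) ^ k < t)"
  have m: "(1/2) ^ m < t" unfolding m_def by (rule LeastI_ex[OF ex])
  then have "m \<noteq> 0" using assms by (intro notI) simp
  then obtain k where k: "m = Suc k" by (cases m) auto
  then have "\<not> (1/2) ^ k < t" unfolding m_def by (intro not_less_Least) simp
  moreover have "((1/2) ^ m) powr sg_dim \<le> t powr sg_dim"
    using m by (intro powr_mono2) auto
  then have "(1/3) ^ Suc k \<le> t powr sg_dim" by (simp only: half_power_powr_sg_dim k)
  ultimately show ?thesis using assms by (intro exI[of _ k]) auto
qed

text \<open>
  Thicken each set of a cover by its own scale \<open>2 ^ - k i\<close> to make it open, keep finitely many of them, and
  count the cells of a common fine level \<open>n\<close>.  The \<open>i\<close>-th set meets at most \<open>225 \<cdot> 3 ^ (n - k i)\<close> of the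
  \<open>3 ^ n\<close> cells, so \<open>225 \<cdot> (\<Sum>i. 3 ^ - k i) \<ge> 1\<close>, while \<open>3 ^ - k i\<close> is comparable with the summand
  \<open>diameter (U i) powr sg_dim\<close>.
\<close>

lemma hausdorff_gasket_pos: "0 < hausdorff_outer sg_dim gasket"
proof -
  have "ennreal (1/2000) \<le> hausdorff_pre sg_dim 1 gasket"
    unfolding hausdorff_pre_def
  proof (rule INF_greatest, rule ccontr)
    fix U :: "nat \<Rightarrow> complex set"
    assume "U \<in> {U. gasket \<subseteq> (\<Union>i. U i) \<and> (\<forall>i. bounded (U i) \<and> diameter (U i) \<le> 1)}"
    then have cov: "gasket \<subseteq> (\<Union>i. U i)" and bd: "\<And>i. bounded (U i)" and dm: "\<And>i. diameter (U i) \<le> 1"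
      by auto
    assume "\<not> ennreal (1/2000) \<le> (\<Sum>i. ennreal (diameter (U i) powr sg_dim))"
    then have small: "(\<Sum>i. ennreal (diameter (U i) powr sg_dim)) < ennreal (1/2000)" by simp
    have "\<exists>k. diameter (U i) \<le> (1/2) ^ k \<and>
        (1/3) ^ k \<le> 3 * diameter (U i) powr sg_dim + 1/2000 * (1/2) ^ Suc i" for i
      using diameter_ge_0[OF bd] dm by (intro level_of_diameter) auto
    then obtain k where k: "\<And>i. diameter (U i) \<le> (1/2) ^ k i"
      and k3: "\<And>i. (1/3) ^ k i \<le> 3 * diameter (U i) powr sg_dim + 1/2000 * (1/2) ^ Suc i"
      by metis
    \<comment> \<open>Two points of \<open>V i\<close> are within \<open>2 ^ - k i\<close> of points of \<open>U i\<close>, hence the factor \<open>3\<close> below.\<close>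
    define V where "V i = (\<Union>u\<in>U i. ball u ((1/2) ^ k i))" for i
    have V_dist: "dist x y \<le> 3 * (1/2) ^ k i" if "x \<in> V i" "y \<in> V i" for x y i
    proof -
      from that obtain u v where uv: "u \<in> U i" "v \<in> U i" "dist u x < (1/2) ^ k i" "dist v y < (1/2) ^ k i"
        by (auto simp: V_def)
      have "dist u v \<le> (1/2) ^ k i" using diameter_bounded_bound[OF bd uv(1,2)] k[of i] by linarith
      moreover have "dist x y \<le> dist u x + dist u v + dist v y"
        by (metis add.commute add.left_commute dist_commute dist_triangle_le dist_triangle add_left_mono)
      ultimately show ?thesis using uv by linarith
    qed
    have "U i \<subseteq> V i" for i by (auto simp: V_def)
    then have "(\<Union>i. U i) \<subseteq> (\<Union>i. V i)" by (intro UN_mono) simp_all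
    with cov have "gasket \<subseteq> (\<Union>i\<in>UNIV. V i)" by (rule subset_trans)
    moreover have "open (V i)" for i by (auto simp: V_def)
    ultimately obtain I where I: "finite I" "gasket \<subseteq> (\<Union>i\<in>I. V i)"
      using compactE_image[OF compact_gasket, of UNIV V] by metis
    define n where "n = Max (insert 0 (k ` I))"
    have kn: "k i \<le> n" if "i \<in> I" for i using that I by (simp add: n_def)
    have "sg_words n \<subseteq> (\<Union>i\<in>I. {w \<in> sg_words n. sg_cell w \<inter> V i \<noteq> {}})"
    proof
      fix w assume w: "w \<in> sg_words n"
      have "sg_word_map w (sg_vertex 1) \<in> gasket"
        using w by (intro sg_word_map_gasket sg_vertex_gasket) auto
      then obtain i where "i \<in> I" "sg_word_map w (sg_vertex 1) \<in> V i" using I by blast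
      moreover have "sg_word_map w (sg_vertex 1) \<in> sg_cell w"
        by (intro imageI sg_vertex_gasket) auto
      ultimately show "w \<in> (\<Union>i\<in>I. {w \<in> sg_words n. sg_cell w \<inter> V i \<noteq> {}})" using w by blast
    qed
    then have "card (sg_words n) \<le> card (\<Union>i\<in>I. {w \<in> sg_words n. sg_cell w \<inter> V i \<noteq> {}})"
      using I by (intro card_mono) auto
    also have "\<dots> \<le> (\<Sum>i\<in>I. card {w \<in> sg_words n. sg_cell w \<inter> V i \<noteq> {}})"
      by (rule card_UN_le[OF I(1)])
    also have "\<dots> \<le> (\<Sum>i\<in>I. 225 * 3 ^ (n - k i))"
      using V_dist kn by (intro sum_mono card_subcells_meeting_small_set) auto
    finally have "3 ^ n \<le> (\<Sum>i\<in>I. 225 * 3 ^ (n - k i) :: nat)" by (simp add: card_sg_words)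
    then have "real (3 ^ n) \<le> real (\<Sum>i\<in>I. 225 * 3 ^ (n - k i))" by (rule of_nat_mono)
    also have "\<dots> = (\<Sum>i\<in>I. 3 ^ n * (225 * (1/3) ^ k i))"
      unfolding of_nat_sum
    proof (rule sum.cong)
      fix i assume "i \<in> I"
      from power_diff[of "3::real", OF _ kn[OF this]]
      show "real (225 * 3 ^ (n - k i)) = 3 ^ n * (225 * (1/3) ^ k i)"
        by (simp add: power_one_over)
    qed simp
    also have "\<dots> = 3 ^ n * (225 * (\<Sum>i\<in>I. (1/3) ^ k i))"
      by (simp add: sum_distrib_left)
    finally have many: "1 \<le> 225 * (\<Sum>i\<in>I. (1/3::real) ^ k i)" by simp
    have "(\<Sum>i\<in>I. (1/3::real) ^ k i) \<le> (\<Sum>i\<in>I. 3 * diameter (U i) powr sg_dim + 1/2000 * (1/2) ^ Suc i)"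
      by (intro sum_mono k3)
    also have "\<dots> = 3 * (\<Sum>i\<in>I. diameter (U i) powr sg_dim) + 1/2000 * (\<Sum>i\<in>I. (1/2) ^ Suc i)"
      by (simp add: sum.distrib sum_distrib_left)
    finally have few: "(\<Sum>i\<in>I. (1/3::real) ^ k i)
      \<le> 3 * (\<Sum>i\<in>I. diameter (U i) powr sg_dim) + 1/2000 * (\<Sum>i\<in>I. (1/2) ^ Suc i)" .
    have half: "(\<Sum>i\<in>I. (1/2::real) ^ Suc i) \<le> 1"
      using sum_le_suminf[OF sums_summable[OF power_half_series] I(1)] sums_unique[OF power_half_series] by simp
    have "(\<Sum>i\<in>I. diameter (U i) powr sg_dim) \<le> 1/2000"
    proof -
      have "ennreal (\<Sum>i\<in>I. diameter (U i) powr sg_dim) = (\<Sum>i\<in>I. ennreal (diameter (U i) powr sg_dim))"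
        by (rule sum_ennreal[symmetric]) auto
      also have "\<dots> \<le> (\<Sum>i. ennreal (diameter (U i) powr sg_dim))"
        by (intro sum_le_suminf summableI I) auto
      also note small
      finally show ?thesis by (simp add: ennreal_less_iff sum_nonneg)
    qed
    \<comment> \<open>\<open>225 (3/2000 + 1/2000) < 1\<close>\<close>
    with many few half show False by linarith
  qed
  also have "\<dots> \<le> hausdorff_outer sg_dim gasket" by (intro hausdorff_pre_le_outer) auto
  finally show ?thesis by (rule less_le_trans[rotated]) simp
qed

lemma sg_word_map_left_inverse:
  "\<exists>f. (\<forall>x y. dist (f x) (f y) \<le> 2 ^ length w * dist x y) \<and> (\<forall>z. f (sg_word_map w z) = z)"
proof (induction w)
  case Nil
  show ?case by (intro exI[of _ id]) auto
next
  case (Cons i w)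
  then obtain f where f: "\<And>x y. dist (f x) (f y) \<le> 2 ^ length w * dist x y" "\<And>z. f (sg_word_map w z) = z" by blast
  have inv: "dist (sg_inv i x) (sg_inv i y) = 2 * dist x y" for x y
  proof -
    have "sg_inv i x - sg_inv i y = 2 * (x - y)" by (simp add: sg_inv_def)
    then show ?thesis by (simp only: dist_norm norm_mult norm_numeral)
  qed
  have "dist (f (sg_inv i x)) (f (sg_inv i y)) \<le> 2 ^ length (i # w) * dist x y" for x y
    using f(1)[of "sg_inv i x" "sg_inv i y"] by (simp add: inv)
  then show ?case using f(2) by (intro exI[of _ "f \<circ> sg_inv i"]) auto
qed

lemma hausdorff_sg_cell_pos: "0 < hausdorff_outer sg_dim (sg_cell w)"
proof (rule ccontr)
  assume "\<not> ?thesis"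
  then have 0: "hausdorff_outer sg_dim (sg_cell w) = 0" by simp
  obtain f where f: "\<And>x y. dist (f x) (f y) \<le> 2 ^ length w * dist x y" "\<And>z. f (sg_word_map w z) = z"
    using sg_word_map_left_inverse by blast
  have "hausdorff_outer sg_dim (f ` sg_cell w) = 0"
    by (rule hausdorff_outer_lipschitz_null[OF _ f(1) sg_dim_pos 0]) simp
  moreover have "f ` sg_cell w = gasket" using f(2) by (simp add: image_image)
  ultimately show False using hausdorff_gasket_pos by simp
qed

lemma gasket_borel [measurable]: "gasket \<in> sets borel"
  using compact_gasket by (simp add: borel_closed compact_imp_closed)

lemma sets_gasket_measure: "sets gasket_measure = sets (restrict_space borel gasket)"
  unfolding gasket_measure_def
  by (simp add: sets_restrict_space sets_hausdorff_measure)

lemma space_gasket_measure: "space gasket_measure = gasket"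
  unfolding gasket_measure_def by (simp add: space_scale_measure space_restrict_space space_hausdorff_measure)

lemma emeasure_gasket_measure:
  assumes "A \<in> sets borel" "A \<subseteq> gasket"
  shows "emeasure gasket_measure A = inverse (hausdorff_outer sg_dim gasket) * hausdorff_outer sg_dim A"
  using assms
  by (simp add: gasket_measure_def emeasure_restrict_space sets_hausdorff_measure emeasure_hausdorff_measure
      space_hausdorff_measure)

lemma emeasure_gasket_measure_gasket: "emeasure gasket_measure gasket = 1"
  using hausdorff_gasket_finite hausdorff_gasket_pos
  by (simp add: emeasure_gasket_measure mult.commute ennreal_inverse_mult less_top[symmetric] ennreal_divide_self flip: divide_ennreal_def)

interpretation gasket_measure: finite_measure gasket_measure
  by (rule finite_measureI) (simp add: space_gasket_measure emeasure_gasket_measure_gasket)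

lemma small_cell_around:
  assumes "x \<in> gasket" "0 < e"
  shows "\<exists>n. \<exists>w\<in>sg_words n. x \<in> sg_cell w \<and> sg_cell w \<subseteq> ball x e"
proof -
  obtain n where n: "diameter gasket * (1/2) ^ n < e" using small_cells[OF assms(2)] by blast
  obtain w y where w: "w \<in> sg_words n" "y \<in> gasket" "x = sg_word_map w y"
    using gasket_cell_cover[OF assms(1)] by blast
  have "dist x z < e" if "z \<in> sg_cell w" for z
    using diameter_bounded_bound[OF diameter_sg_cell(1)[OF w(1)], of x z] diameter_sg_cell(2)[OF w(1)] that w n
    by auto
  then show ?thesis using w by (intro exI[of _ n] bexI[of _ w]) auto
qed

lemma radon_full_support_gasket: "radon_full_support gasket gasket_measure"
  unfolding radon_full_support_def
proof (intro conjI allI impI)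
  show "space gasket_measure = gasket" by (rule space_gasket_measure)
  show "sets gasket_measure = sets (restrict_space borel gasket)" by (rule sets_gasket_measure)
  show "emeasure gasket_measure C < \<infinity>" for C
    using gasket_measure.emeasure_finite[of C] by (simp add: less_top[symmetric])
  fix U :: "complex set" assume U: "open U \<and> U \<inter> gasket \<noteq> {}"
  then obtain x where x: "x \<in> U" "x \<in> gasket" by blast
  with U obtain e where e: "0 < e" "ball x e \<subseteq> U" by (meson openE)
  obtain n w where w: "w \<in> sg_words n" "sg_cell w \<subseteq> ball x e"
    using small_cell_around[OF x(2) e(1)] by blast
  have "sg_cell w \<subseteq> U \<inter> gasket" using w e sg_word_map_gasket by blast
  then have "0 < hausdorff_outer sg_dim (U \<inter> gasket)"
    using hausdorff_outer_mono hausdorff_sg_cell_pos by (metis less_le_trans)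
  moreover have "U \<inter> gasket \<in> sets borel" using U by auto
  ultimately show "0 < emeasure gasket_measure (U \<inter> gasket)"
    using hausdorff_gasket_finite
    by (simp add: emeasure_gasket_measure ennreal_zero_less_mult_iff ennreal_inverse_positive less_top)
qed

subsection \<open>Density of continuous functions in the space of square-integrable functions\<close>

lemma square_add_le: "(a + b)\<^sup>2 \<le> 2 * a\<^sup>2 + 2 * (b::real)\<^sup>2"
  using zero_le_power2[of "a - b"] by (simp add: power2_eq_square algebra_simps)

lemma integral_square_add:
  fixes f g :: "'a \<Rightarrow> real"
  assumes [measurable]: "f \<in> borel_measurable M" "g \<in> borel_measurable M"
    and "integrable M (\<lambda>x. (f x)\<^sup>2)" "integrable M (\<lambda>x. (g x)\<^sup>2)"
  shows "integrable M (\<lambda>x. (f x + g x)\<^sup>2)"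
    and "(\<integral>x. (f x + g x)\<^sup>2 \<partial>M) \<le> 2 * (\<integral>x. (f x)\<^sup>2 \<partial>M) + 2 * (\<integral>x. (g x)\<^sup>2 \<partial>M)"
proof -
  have int: "integrable M (\<lambda>x. 2 * (f x)\<^sup>2 + 2 * (g x)\<^sup>2)" using assms(3,4) by simp
  show int2: "integrable M (\<lambda>x. (f x + g x)\<^sup>2)"
    by (rule Bochner_Integration.integrable_bound[OF int]) (use square_add_le in auto)
  have "(\<integral>x. (f x + g x)\<^sup>2 \<partial>M) \<le> (\<integral>x. 2 * (f x)\<^sup>2 + 2 * (g x)\<^sup>2 \<partial>M)"
    using int int2 square_add_le by (intro integral_mono) auto
  also have "\<dots> = 2 * (\<integral>x. (f x)\<^sup>2 \<partial>M) + 2 * (\<integral>x. (g x)\<^sup>2 \<partial>M)" using assms(3,4) by simp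
  finally show "(\<integral>x. (f x + g x)\<^sup>2 \<partial>M) \<le> 2 * (\<integral>x. (f x)\<^sup>2 \<partial>M) + 2 * (\<integral>x. (g x)\<^sup>2 \<partial>M)" .
qed

definition continuous_approximable :: "complex measure \<Rightarrow> (complex \<Rightarrow> real) \<Rightarrow> bool" where
  "continuous_approximable M f \<longleftrightarrow>
     (\<forall>e>0. \<exists>g. continuous_on UNIV g \<and> integrable M (\<lambda>x. (f x - g x)\<^sup>2) \<and> (\<integral>x. (f x - g x)\<^sup>2 \<partial>M) < e)"

context
  fixes M :: "complex measure" and K :: "complex set"
  assumes K: "compact K" and sp: "space M = K" and st: "sets M = sets (restrict_space borel K)"
    and fin: "finite_measure M"
begin

lemma continuous_measurable: "continuous_on K g \<Longrightarrow> g \<in> borel_measurable M"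
  using borel_measurable_continuous_on_restrict[of K g] measurable_cong_sets[OF st, of borel borel] by auto

text \<open>
  By regularity of finite Borel measures, \<open>A\<close> lies between a compact and an open set of almost the same
  measure; a Urysohn function for the two differs from the indicator only on their difference.
\<close>

lemma approximable_indicator:
  assumes A: "A \<in> sets M"
  shows "continuous_approximable M (indicator A)"
  unfolding continuous_approximable_def
proof (intro allI impI)
  fix e :: real assume e: "0 < e"
  interpret finite_measure M by (rule fin)
  have Kb: "K \<in> sets borel" using K by (simp add: borel_closed compact_imp_closed)
  have idm: "(\<lambda>x. x) \<in> measurable M borel" by (rule continuous_measurable) (rule continuous_on_id)
  have AK: "A \<subseteq> K" using sets.sets_into_space[OF A] sp by simp
  have Ab: "A \<in> sets borel" using A Kb unfolding st by (simp add: sets_restrict_space_iff)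
  define N where "N = distr M borel (\<lambda>x. x)"
  have N: "emeasure N B = emeasure M (B \<inter> K)" if "B \<in> sets borel" for B
    unfolding N_def using that by (simp add: emeasure_distr[OF idm] sp vimage_def Int_def)
  have sN: "sets N = sets borel" by (simp add: N_def)
  have "emeasure N (space N) = emeasure M (UNIV \<inter> K)" using N[of UNIV] by (simp add: N_def)
  then have fN: "emeasure N (space N) \<noteq> \<infinity>" by simp
  then interpret N: finite_measure N by (rule finite_measureI)
  let ?a = "emeasure N A"
  have afin: "?a < \<infinity>" using N.emeasure_finite[of A] by (simp add: less_top[symmetric])
  have sup: "?a = (SUP C \<in> {C. C \<subseteq> A \<and> compact C}. emeasure N C)"
    and inf: "?a = (INF U \<in> {U. A \<subseteq> U \<and> open U}. emeasure N U)"
    by (rule inner_regular[OF sN fN Ab], rule outer_regular[OF sN fN Ab])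
  have e2: "0 < ennreal (e / 3)" using e by simp
  have "?a < ?a + ennreal (e / 3)" using afin e2 by (simp add: less_top)
  then obtain U where U: "A \<subseteq> U" "open U" "emeasure N U < ?a + ennreal (e / 3)"
    using inf by (auto simp: INF_less_iff)
  have "\<exists>C. C \<subseteq> A \<and> compact C \<and> ?a < emeasure N C + ennreal (e / 3)"
  proof -
    have "(SUP C \<in> {C. C \<subseteq> A \<and> compact C}. emeasure N C) + ennreal (e / 3)
        = (SUP C \<in> {C. C \<subseteq> A \<and> compact C}. emeasure N C + ennreal (e / 3))"
      by (rule ennreal_SUP_add_left[symmetric]) (auto intro: exI[of _ "{}"])
    with sup \<open>?a < ?a + ennreal (e / 3)\<close>
    have "?a < (SUP C \<in> {C. C \<subseteq> A \<and> compact C}. emeasure N C + ennreal (e / 3))" by metis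
    then show ?thesis by (auto simp: less_SUP_iff)
  qed
  then obtain C where C: "C \<subseteq> A" "compact C" "?a < emeasure N C + ennreal (e / 3)" by blast
  have Cb: "C \<in> sets borel" using C by (simp add: borel_closed compact_imp_closed)
  have Ub: "U \<in> sets borel" using U by simp
  have "measure N U < measure N A + e / 3" "measure N A < measure N C + e / 3"
    using U(3) C(3) e by (simp_all add: N.emeasure_eq_measure ennreal_plus[symmetric] ennreal_less_iff del: ennreal_plus)
  moreover have "measure N (U - C) = measure N U - measure N C"
    using C U by (intro N.finite_measure_Diff) (auto simp: sN Cb Ub)
  ultimately have UC: "measure N (U - C) < e" using e by linarith
  obtain g :: "complex \<Rightarrow> real" where g: "continuous_on UNIV g" "\<And>x. g x \<in> closed_segment 1 0"
    "\<And>x. x \<in> C \<Longrightarrow> g x = 1" "\<And>x. x \<in> - U \<Longrightarrow> g x = 0"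
  proof (rule Urysohn)
    show "closed C" "closed (- U)" "C \<inter> - U = {}" using C U compact_imp_closed by auto
  qed blast
  have g01: "0 \<le> g x" "g x \<le> 1" for x using g(2)[of x] by (auto simp: closed_segment_eq_real_ivl)
  have gm [measurable]: "g \<in> borel_measurable M"
    by (rule continuous_measurable) (rule continuous_on_subset[OF g(1)], simp)
  have [measurable]: "A \<in> sets M" by fact
  have UCM: "(U - C) \<inter> K \<in> sets M" unfolding st using Ub Cb Kb by (auto simp: sets_restrict_space_iff)
  have le: "(indicator A x - g x)\<^sup>2 \<le> indicator ((U - C) \<inter> K) x" if "x \<in> space M" for x
  proof (cases "x \<in> U - C")
    case True
    have "\<bar>indicator A x - g x\<bar> \<le> 1" using g01[of x] by (auto simp: indicator_def)
    then have "(indicator A x - g x)\<^sup>2 \<le> 1" by (simp add: abs_square_le_1)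
    then show ?thesis using True that sp by simp
  next
    case False
    then have "indicator A x - g x = 0" using g(3,4)[of x] C U by (auto simp: indicator_def)
    then show ?thesis by simp
  qed
  have int: "integrable M (indicator ((U - C) \<inter> K) :: complex \<Rightarrow> real)"
    using UCM by (simp add: integrable_indicator_iff less_top[symmetric])
  have int2: "integrable M (\<lambda>x. (indicator A x - g x)\<^sup>2)"
    by (rule Bochner_Integration.integrable_bound[OF int]) (use le in \<open>auto\<close>)
  have "(\<integral>x. (indicator A x - g x)\<^sup>2 \<partial>M) \<le> (\<integral>x. indicator ((U - C) \<inter> K) x \<partial>M)"
    using int2 int le by (intro integral_mono) auto
  also have "\<dots> = measure M ((U - C) \<inter> K)" using UCM by simp
  also have "\<dots> = measure N (U - C)" using N[of "U - C"] Ub Cb by (simp add: measure_def)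
  finally show "\<exists>g. continuous_on UNIV g \<and> integrable M (\<lambda>x. (indicator A x - g x)\<^sup>2) \<and> (\<integral>x. (indicator A x - g x)\<^sup>2 \<partial>M) < e"
    using UC g(1) int2 by (intro exI[of _ g]) auto
qed

lemma approximable_limit:
  assumes f [measurable]: "f \<in> borel_measurable M"
    and approx: "\<And>e. 0 < e \<Longrightarrow> \<exists>h. h \<in> borel_measurable M \<and> continuous_approximable M h \<and>
      integrable M (\<lambda>x. (f x - h x)\<^sup>2) \<and> (\<integral>x. (f x - h x)\<^sup>2 \<partial>M) < e"
  shows "continuous_approximable M f"
  unfolding continuous_approximable_def
proof (intro allI impI)
  fix e :: real assume e: "0 < e"
  then obtain h where h [measurable]: "h \<in> borel_measurable M" and ch: "continuous_approximable M h"
    and fh: "integrable M (\<lambda>x. (f x - h x)\<^sup>2)" "(\<integral>x. (f x - h x)\<^sup>2 \<partial>M) < e / 4"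
    using approx[of "e / 4"] by auto
  then obtain g where g: "continuous_on UNIV g" and hg: "integrable M (\<lambda>x. (h x - g x)\<^sup>2)" "(\<integral>x. (h x - g x)\<^sup>2 \<partial>M) < e / 4"
    using ch[unfolded continuous_approximable_def, rule_format, of "e / 4"] e by auto
  have [measurable]: "g \<in> borel_measurable M"
    by (rule continuous_measurable) (rule continuous_on_subset[OF g], simp)
  have "integrable M (\<lambda>x. (f x - h x + (h x - g x))\<^sup>2)" "(\<integral>x. (f x - h x + (h x - g x))\<^sup>2 \<partial>M) < e"
    using integral_square_add[of "\<lambda>x. f x - h x" M "\<lambda>x. h x - g x"] fh hg by auto
  then show "\<exists>g. continuous_on UNIV g \<and> integrable M (\<lambda>x. (f x - g x)\<^sup>2) \<and> (\<integral>x. (f x - g x)\<^sup>2 \<partial>M) < e"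
    using g by (intro exI[of _ g]) simp
qed

lemma approximable_add:
  assumes f: "f \<in> borel_measurable M" "continuous_approximable M f"
    and h: "h \<in> borel_measurable M" "continuous_approximable M h"
  shows "continuous_approximable M (\<lambda>x. f x + h x)"
  unfolding continuous_approximable_def
proof (intro allI impI)
  fix e :: real assume e: "0 < e"
  note [measurable] = f(1) h(1)
  obtain g where g: "continuous_on UNIV g" and fg: "integrable M (\<lambda>x. (f x - g x)\<^sup>2)" "(\<integral>x. (f x - g x)\<^sup>2 \<partial>M) < e / 4"
    using f(2)[unfolded continuous_approximable_def, rule_format, of "e / 4"] e by auto
  obtain k where k: "continuous_on UNIV k" and hk: "integrable M (\<lambda>x. (h x - k x)\<^sup>2)" "(\<integral>x. (h x - k x)\<^sup>2 \<partial>M) < e / 4"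
    using h(2)[unfolded continuous_approximable_def, rule_format, of "e / 4"] e by auto
  have [measurable]: "g \<in> borel_measurable M" "k \<in> borel_measurable M"
    by (rule continuous_measurable, rule continuous_on_subset[OF g], simp,
        rule continuous_measurable, rule continuous_on_subset[OF k], simp)
  have eq: "f x - g x + (h x - k x) = f x + h x - (g x + k x)" for x by simp
  have "integrable M (\<lambda>x. (f x - g x + (h x - k x))\<^sup>2)" "(\<integral>x. (f x - g x + (h x - k x))\<^sup>2 \<partial>M) < e"
    using integral_square_add[of "\<lambda>x. f x - g x" M "\<lambda>x. h x - k x"] fg hk by auto
  then show "\<exists>g. continuous_on UNIV g \<and> integrable M (\<lambda>x. (f x + h x - g x)\<^sup>2) \<and> (\<integral>x. (f x + h x - g x)\<^sup>2 \<partial>M) < e"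
    unfolding eq using continuous_on_add[OF g k] by blast
qed

lemma approximable_cmult:
  assumes "continuous_approximable M f"
  shows "continuous_approximable M (\<lambda>x. c * f x)"
  unfolding continuous_approximable_def
proof (intro allI impI)
  fix e :: real assume e: "0 < e"
  have pos: "0 < 1 + c\<^sup>2" by (simp add: add_pos_nonneg)
  then obtain g where g: "continuous_on UNIV g" and fg: "integrable M (\<lambda>x. (f x - g x)\<^sup>2)" "(\<integral>x. (f x - g x)\<^sup>2 \<partial>M) < e / (1 + c\<^sup>2)"
    using assms[unfolded continuous_approximable_def, rule_format, of "e / (1 + c\<^sup>2)"] e by auto
  have eq: "(c * f x - c * g x)\<^sup>2 = c\<^sup>2 * (f x - g x)\<^sup>2" for x
    by (simp add: power_mult_distrib right_diff_distrib[symmetric])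
  have nn: "0 \<le> (\<integral>x. (f x - g x)\<^sup>2 \<partial>M)" by simp
  have "c\<^sup>2 * (\<integral>x. (f x - g x)\<^sup>2 \<partial>M) \<le> (1 + c\<^sup>2) * (\<integral>x. (f x - g x)\<^sup>2 \<partial>M)"
    using nn by (intro mult_right_mono) auto
  also have "\<dots> < e" using fg(2) pos by (simp add: field_simps)
  finally show "\<exists>g. continuous_on UNIV g \<and> integrable M (\<lambda>x. (c * f x - g x)\<^sup>2) \<and> (\<integral>x. (c * f x - g x)\<^sup>2 \<partial>M) < e"
    using continuous_on_mult_left[OF g, of c] fg(1) by (intro exI[of _ "\<lambda>x. c * g x"]) (simp add: eq)
qed

text \<open>
  Indicators are covered already; sums, multiples and increasing limits (by dominated
  convergence, with dominating function \<open>f\<^sup>2\<close>) lead to all nonnegative functions.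
\<close>

lemma approximable_nonneg:
  assumes "f \<in> borel_measurable M" "\<And>x. 0 \<le> f x" "integrable M (\<lambda>x. (f x)\<^sup>2)"
  shows "continuous_approximable M f"
  using assms(1,2,3)
proof (induction rule: borel_measurable_induct_real)
  case (set A)
  then show ?case by (intro approximable_indicator)
next
  case (mult u c)
  show ?case
  proof (cases "c = 0")
    case True
    then show ?thesis using approximable_cmult[OF approximable_indicator[of "{}"], of 0] by simp
  next
    case False
    then have "integrable M (\<lambda>x. (u x)\<^sup>2)" using mult.prems by (simp add: power_mult_distrib)
    with mult.IH show ?thesis by (intro approximable_cmult)
  qed
next
  case (add u v)
  note [measurable] = add.hyps(1,3)
  have "integrable M (\<lambda>x. (u x)\<^sup>2)" "integrable M (\<lambda>x. (v x)\<^sup>2)"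
    using add.hyps by (auto intro!: Bochner_Integration.integrable_bound[OF add.prems] AE_I2 power_mono)
  with add show ?case by (intro approximable_add) auto
next
  case (seq U)
  note [measurable] = seq.hyps(1) assms(1)
  have Ule: "U i x \<le> f x" if "x \<in> space M" for i x
    using seq.hyps(3) seq.hyps(4)[OF that] by (intro incseq_le[of "\<lambda>i. U i x"]) (auto simp: incseq_def le_fun_def)
  have sq: "(U i x)\<^sup>2 \<le> (f x)\<^sup>2" "(f x - U i x)\<^sup>2 \<le> (f x)\<^sup>2" if "x \<in> space M" for i x
    using Ule[OF that, of i] seq.hyps(2)[of i x] by (auto intro!: power_mono)
  have intU: "integrable M (\<lambda>x. (U i x)\<^sup>2)" for i
    by (rule Bochner_Integration.integrable_bound[OF seq.prems]) (use sq in auto)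
  have intd: "integrable M (\<lambda>x. (f x - U i x)\<^sup>2)" for i
    by (rule Bochner_Integration.integrable_bound[OF seq.prems]) (use sq in auto)
  have lim: "(\<lambda>i. \<integral>x. (f x - U i x)\<^sup>2 \<partial>M) \<longlonglongrightarrow> (\<integral>x. 0 \<partial>M)"
  proof (rule integral_dominated_convergence[OF _ _ seq.prems])
    show "AE x in M. (\<lambda>i. (f x - U i x)\<^sup>2) \<longlonglongrightarrow> 0"
    proof (intro AE_I2)
      fix x assume "x \<in> space M"
      then have "(\<lambda>i. (f x - U i x)\<^sup>2) \<longlonglongrightarrow> (f x - f x)\<^sup>2" by (intro tendsto_intros seq.hyps(4))
      then show "(\<lambda>i. (f x - U i x)\<^sup>2) \<longlonglongrightarrow> 0" by simp
    qed
  qed (use sq in auto)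
  show ?case
  proof (rule approximable_limit)
    fix e :: real assume "0 < e"
    then have "\<forall>\<^sub>F i in sequentially. (\<integral>x. (f x - U i x)\<^sup>2 \<partial>M) < e"
      using lim by (auto dest: order_tendstoD(2))
    then obtain i where "(\<integral>x. (f x - U i x)\<^sup>2 \<partial>M) < e" by (auto simp: eventually_sequentially)
    then show "\<exists>h. h \<in> borel_measurable M \<and> continuous_approximable M h \<and>
      integrable M (\<lambda>x. (f x - h x)\<^sup>2) \<and> (\<integral>x. (f x - h x)\<^sup>2 \<partial>M) < e"
      using seq.IH[of i] intU[of i] intd[of i] seq.hyps(1) by blast
  qed (rule assms(1))
qed

lemma approximable_square_integrable:
  assumes "f \<in> square_integrable M"
  shows "continuous_approximable M f"
proof -
  have f [measurable]: "f \<in> borel_measurable M" and int: "integrable M (\<lambda>x. (f x)\<^sup>2)"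
    using assms by (auto simp: square_integrable_def)
  have m [measurable]: "(\<lambda>x. max 0 (f x)) \<in> borel_measurable M" "(\<lambda>x. max 0 (- f x)) \<in> borel_measurable M" by auto
  have "continuous_approximable M (\<lambda>x. max 0 (f x))" "continuous_approximable M (\<lambda>x. max 0 (- f x))"
    by (auto intro!: approximable_nonneg Bochner_Integration.integrable_bound[OF int] AE_I2 simp: max_def)
  then have "continuous_approximable M (\<lambda>x. max 0 (f x) + (-1) * max 0 (- f x))"
    by (intro approximable_add approximable_cmult) auto
  moreover have "(\<lambda>x. max 0 (f x) + (-1) * max 0 (- f x)) = f" by (auto simp: max_def)
  ultimately show ?thesis by simp
qed

end

section \<open>The resistance recursion\<close>

text \<open>
  The recursion of the resistances in the symmetric case \<open>y = z\<close>, with the function \<^const>\<open>phi\<close> evaluated.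
\<close>

definition resistance_pair :: "(nat \<Rightarrow> real) \<Rightarrow> (nat \<Rightarrow> real) \<Rightarrow> bool" where
  "resistance_pair x y \<longleftrightarrow> (\<forall>n. 0 < y n \<and> y n < x n \<and>
     x n = x (Suc n) + (x (Suc n) + y (Suc n))\<^sup>2 / (2 * (x (Suc n) + 2 * y (Suc n))) \<and>
     y n = y (Suc n) + y (Suc n) * (x (Suc n) + y (Suc n)) / (x (Suc n) + 2 * y (Suc n)))"

text \<open>
  Since the recursion is homogeneous, it induces a map of the ratio \<open>t = y / x\<close>, going from level
  \<open>n + 1\<close> to level \<open>n\<close>.  It is an increasing bijection of the unit interval, which is why the recursion
  can be solved for the next level in exactly one way.
\<close>

definition ratio_map :: "real \<Rightarrow> real" where
  "ratio_map t = t * (4 + 6 * t) / (3 + 6 * t + t\<^sup>2)"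

lemma ratio_denominator_pos: "0 \<le> t \<Longrightarrow> 0 < 3 + 6 * t + (t::real)\<^sup>2"
  by (simp add: add_pos_nonneg)

lemma resistance_step_ratio:
  fixes x y t :: real
  assumes "0 < x" "0 < y" "t = y / x"
  shows "x + (x + y)\<^sup>2 / (2 * (x + 2 * y)) = x * ((3 + 6 * t + t\<^sup>2) / (2 + 4 * t))"
    and "y + y * (x + y) / (x + 2 * y) = y * ((2 + 3 * t) / (1 + 2 * t))"
    and "(y + y * (x + y) / (x + 2 * y)) / (x + (x + y)\<^sup>2 / (2 * (x + 2 * y))) = ratio_map t"
proof -
  have y: "y = t * x" and t: "0 < t" using assms by auto
  have q: "0 < 3 + 6 * t + t\<^sup>2" using t by (simp add: ratio_denominator_pos)
  have e: "x + y = x * (1 + t)" "x + 2 * y = x * (1 + 2 * t)" by (simp_all add: y algebra_simps)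
  have "(x + y)\<^sup>2 / (2 * (x + 2 * y)) = x * ((1 + t)\<^sup>2 / (2 + 4 * t))"
  proof -
    have "(x + y)\<^sup>2 / (2 * (x + 2 * y)) = x * (x * (1 + t)\<^sup>2) / (x * (2 + 4 * t))"
      unfolding e by (simp add: power2_eq_square algebra_simps)
    then show ?thesis using assms(1) by simp
  qed
  then have "x + (x + y)\<^sup>2 / (2 * (x + 2 * y)) = x * (1 + (1 + t)\<^sup>2 / (2 + 4 * t))"
    by (simp add: algebra_simps)
  also have "1 + (1 + t)\<^sup>2 / (2 + 4 * t) = (3 + 6 * t + t\<^sup>2) / (2 + 4 * t)"
    using t by (simp add: add_divide_eq_iff divide_add_eq_iff power2_eq_square field_simps)
  finally show X: "x + (x + y)\<^sup>2 / (2 * (x + 2 * y)) = x * ((3 + 6 * t + t\<^sup>2) / (2 + 4 * t))" .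
  have "(x + y) / (x + 2 * y) = (1 + t) / (1 + 2 * t)"
    using assms(1) unfolding e by simp
  then have "y + y * (x + y) / (x + 2 * y) = y * (1 + (1 + t) / (1 + 2 * t))"
    by (simp only: distrib_left[of y 1] times_divide_eq_right[of y "x + y", symmetric] mult_1_right)
  also have "1 + (1 + t) / (1 + 2 * t) = (2 + 3 * t) / (1 + 2 * t)"
    using t by (simp add: field_simps)
  finally show Y: "y + y * (x + y) / (x + 2 * y) = y * ((2 + 3 * t) / (1 + 2 * t))" .
  have *: "t * x * (A / B) / (x * (Q / (2 * B))) = t * (2 * A) / Q" if "0 < B" "0 < Q" for A B Q
    using assms(1) that by (simp add: field_simps)
  have e2: "2 + 4 * t = 2 * (1 + 2 * t)" "2 * (2 + 3 * t) = 4 + 6 * t" by simp_all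
  have "y * ((2 + 3 * t) / (1 + 2 * t)) / (x * ((3 + 6 * t + t\<^sup>2) / (2 + 4 * t))) = ratio_map t"
    unfolding y e2(1) using *[of "1 + 2 * t" "3 + 6 * t + t\<^sup>2" "2 + 3 * t"] t q
    by (simp only: e2(2) ratio_map_def)
  then show "(y + y * (x + y) / (x + 2 * y)) / (x + (x + y)\<^sup>2 / (2 * (x + 2 * y))) = ratio_map t"
    unfolding X Y .
qed

lemma ratio_map_inj:
  assumes "0 < s" "0 < t" "ratio_map s = ratio_map t"
  shows "s = t"
proof -
  have "t * (4 + 6 * t) * (3 + 6 * s + s\<^sup>2) = s * (4 + 6 * s) * (3 + 6 * t + t\<^sup>2)"
    using assms ratio_denominator_pos[of s] ratio_denominator_pos[of t]
    by (simp add: ratio_map_def frac_eq_eq)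
  then have "(t - s) * (12 + 18 * (t + s) + 32 * (t * s)) = 0"
    by (simp add: algebra_simps power2_eq_square)
  moreover have "0 < 12 + 18 * (t + s) + 32 * (t * s)"
    using assms by (intro add_pos_pos) auto
  ultimately show ?thesis by auto
qed

lemma ratio_map_surj:
  assumes "0 < r" "r < 1"
  shows "\<exists>t. 0 < t \<and> t < 1 \<and> ratio_map t = r"
proof -
  have "\<exists>t\<ge>0. t \<le> 1 \<and> ratio_map t = r"
  proof (rule IVT')
    show "ratio_map 0 \<le> r" "r \<le> ratio_map 1" using assms by (auto simp: ratio_map_def)
    show "continuous_on {0..1} ratio_map"
      unfolding ratio_map_def
      by (intro continuous_intros) (auto dest!: ratio_denominator_pos)
  qed simp
  then obtain t where t: "0 \<le> t" "t \<le> 1" "ratio_map t = r" by blast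
  have "t \<noteq> 0" "t \<noteq> 1" using t(3) assms by (auto simp: ratio_map_def)
  with t show ?thesis by (intro exI[of _ t]) auto
qed

lemma resistance_step_surj:
  fixes X Y :: real
  assumes "0 < Y" "Y < X"
  shows "\<exists>x y. 0 < y \<and> y < x \<and> X = x + (x + y)\<^sup>2 / (2 * (x + 2 * y)) \<and> Y = y + y * (x + y) / (x + 2 * y)"
proof -
  obtain t where t: "0 < t" "t < 1" "ratio_map t = Y / X"
    using ratio_map_surj[of "Y / X"] assms by auto
  define q where "q = (3 + 6 * t + t\<^sup>2) / (2 + 4 * t)"
  have q: "0 < q" using t ratio_denominator_pos[of t] by (simp add: q_def)
  define x where "x = X / q"
  define y where "y = t * x"
  have x: "0 < x" and y: "0 < y" and tyx: "t = y / x" and yx: "y < x"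
    using assms t q by (auto simp: x_def y_def divide_strict_right_mono)
  have X: "X = x + (x + y)\<^sup>2 / (2 * (x + 2 * y))"
    unfolding resistance_step_ratio(1)[OF x y tyx] using q by (simp add: x_def flip: q_def)
  have "(y + y * (x + y) / (x + 2 * y)) / X = Y / X"
    using resistance_step_ratio(3)[OF x y tyx] unfolding X[symmetric] t(3) .
  then have "Y = y + y * (x + y) / (x + 2 * y)"
    using assms by simp
  with X y yx show ?thesis by blast
qed

lemma resistance_pair_exists:
  assumes "0 < y0" "y0 < x0"
  shows "\<exists>x y. resistance_pair x y \<and> x 0 = x0 \<and> y 0 = y0"
proof -
  define P where "P p \<longleftrightarrow> 0 < snd p \<and> snd p < fst p" for p :: "real \<times> real"
  define Q where "Q p q \<longleftrightarrow> fst p = fst q + (fst q + snd q)\<^sup>2 / (2 * (fst q + 2 * snd q)) \<and>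
      snd p = snd q + snd q * (fst q + snd q) / (fst q + 2 * snd q)" for p q :: "real \<times> real"
  have ex: "\<exists>q. P q \<and> Q p q" if p: "P p" for p
  proof -
    obtain x y where "0 < y \<and> y < x \<and> fst p = x + (x + y)\<^sup>2 / (2 * (x + 2 * y)) \<and>
        snd p = y + y * (x + y) / (x + 2 * y)"
      using resistance_step_surj[of "snd p" "fst p"] p unfolding P_def by blast
    then show ?thesis by (intro exI[of _ "(x, y)"]) (simp add: P_def Q_def)
  qed
  define s where "s = rec_nat (x0, y0) (\<lambda>_ p. SOME q. P q \<and> Q p q)"
  have s0: "s 0 = (x0, y0)" and sS: "s (Suc n) = (SOME q. P q \<and> Q (s n) q)" for n
    by (simp_all add: s_def)
  have Ps: "P (s n)" for n
  proof (induction n)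
    case 0
    then show ?case using assms by (simp add: s0 P_def)
  next
    case (Suc n)
    show ?case unfolding sS using someI_ex[OF ex[OF Suc]] by blast
  qed
  have Qs: "Q (s n) (s (Suc n))" for n
    unfolding sS using someI_ex[OF ex[OF Ps[of n]]] by blast
  have "resistance_pair (\<lambda>n. fst (s n)) (\<lambda>n. snd (s n))"
    using Ps Qs unfolding resistance_pair_def P_def Q_def by blast
  then show ?thesis by (intro exI[of _ "\<lambda>n. fst (s n)"] exI[of _ "\<lambda>n. snd (s n)"]) (simp add: s0)
qed

text \<open>
  The difference of the second and third components is multiplied by a positive factor in one step, so it
  vanishes on level \<open>n + 1\<close> if it vanishes on level \<open>n\<close>: the symmetry \<open>y = z\<close> is not an assumption on the
  sequence but a consequence.  Then the ratio is determined, and by homogeneity everything is.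
\<close>

lemma resistance_step_inj:
  assumes pos: "0 < x" "0 < y" "0 < z" "0 < x'" "0 < y'"
    and eq: "x + phi x y z = x' + (x' + y')\<^sup>2 / (2 * (x' + 2 * y'))"
      "y + phi y z x = y' + y' * (x' + y') / (x' + 2 * y')"
      "z + phi z x y = y' + y' * (x' + y') / (x' + 2 * y')"
  shows "x = x'" "y = y'" "z = y'"
proof -
  have S: "0 < x + y + z" using pos by simp
  have "phi y z x - phi z x y = (y - z) * ((y + z) / (2 * (x + y + z)))"
    using S by (simp add: phi_def diff_divide_distrib[symmetric] ac_simps) (simp add: algebra_simps)
  with eq(2,3) have "(y - z) * (1 + (y + z) / (2 * (x + y + z))) = 0"
    by (simp add: algebra_simps)
  moreover have "0 < 1 + (y + z) / (2 * (x + y + z))" using pos by (simp add: add_pos_pos)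
  ultimately have yz: "y = z" by auto
  have "phi x y y = (x + y)\<^sup>2 / (2 * (x + 2 * y))" "phi y y x = y * (x + y) / (x + 2 * y)"
    using pos by (auto simp: phi_def power2_eq_square frac_eq_eq algebra_simps)
  with eq(1,2) yz have e: "x + (x + y)\<^sup>2 / (2 * (x + 2 * y)) = x' + (x' + y')\<^sup>2 / (2 * (x' + 2 * y'))"
    "y + y * (x + y) / (x + 2 * y) = y' + y' * (x' + y') / (x' + 2 * y')" by auto
  have "ratio_map (y / x) = ratio_map (y' / x')"
    using resistance_step_ratio(3)[of x y "y / x"] resistance_step_ratio(3)[of x' y' "y' / x'"] pos e by simp
  then have t: "y / x = y' / x'" by (rule ratio_map_inj[rotated 2]) (use pos in auto)
  let ?t = "y / x"
  have "x * ((3 + 6 * ?t + ?t\<^sup>2) / (2 + 4 * ?t)) = x' * ((3 + 6 * ?t + ?t\<^sup>2) / (2 + 4 * ?t))"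
    using resistance_step_ratio(1)[of x y "y / x"] resistance_step_ratio(1)[of x' y' "y' / x'"] pos e t by simp
  moreover have "0 < (3 + 6 * ?t + ?t\<^sup>2) / (2 + 4 * ?t)"
    using pos by (intro divide_pos_pos ratio_denominator_pos add_pos_pos) auto
  ultimately show x: "x = x'" by (metis mult_right_cancel less_irrefl)
  with t pos show "y = y'" by simp
  with yz show "z = y'" by simp
qed

lemma resistances_of_pair:
  assumes "resistance_pair x y"
  shows "resistances (x 0, y 0, y 0) = (\<lambda>n. (x n, y n, y n))"
  unfolding resistances_def
proof (rule the_equality)
  have xy: "0 < y n" "y n < x n" for n using assms unfolding resistance_pair_def by blast+
  have x: "0 < x n" for n using xy[of n] by linarith
  have eq: "x n = x (Suc n) + (x (Suc n) + y (Suc n))\<^sup>2 / (2 * (x (Suc n) + 2 * y (Suc n)))"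
    "y n = y (Suc n) + y (Suc n) * (x (Suc n) + y (Suc n)) / (x (Suc n) + 2 * y (Suc n))" for n
    using assms unfolding resistance_pair_def by blast+
  have phi: "phi (x n) (y n) (y n) = (x n + y n)\<^sup>2 / (2 * (x n + 2 * y n))"
    "phi (y n) (y n) (x n) = y n * (x n + y n) / (x n + 2 * y n)"
    "phi (y n) (x n) (y n) = y n * (x n + y n) / (x n + 2 * y n)" for n
    using xy[of n] x[of n] by (auto simp: phi_def power2_eq_square frac_eq_eq algebra_simps)
  have "(x (n - 1), y (n - 1), y (n - 1)) =
      (x n + phi (x n) (y n) (y n), y n + phi (y n) (y n) (x n), y n + phi (y n) (x n) (y n))" if "1 \<le> n" for n
    using eq[of "n - 1"] that by (simp add: phi)
  then show "resistance_sequence (\<lambda>n. (x n, y n, y n)) \<and> (x 0, y 0, y 0) = (x 0, y 0, y 0)"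
    using xy x unfolding resistance_sequence_def by blast
  fix s assume s: "resistance_sequence s \<and> s 0 = (x 0, y 0, y 0)"
  have "s n = (x n, y n, y n)" for n
  proof (induction n)
    case 0
    then show ?case using s by simp
  next
    case (Suc n)
    obtain u v w where uvw: "s (Suc n) = (u, v, w)" by (cases "s (Suc n)")
    from s have "\<forall>n. case s n of (x, y, z) \<Rightarrow> x > 0 \<and> y > 0 \<and> z > 0" by (simp add: resistance_sequence_def)
    from spec[OF this, of "Suc n"] have pos: "0 < u" "0 < v" "0 < w" by (auto simp: uvw)
    from s have "\<forall>n\<ge>1. case s n of (x, y, z) \<Rightarrow> s (n - 1) = (x + phi x y z, y + phi y z x, z + phi z x y)"
      by (simp add: resistance_sequence_def)
    from spec[OF this, of "Suc n"] have "s n = (u + phi u v w, v + phi v w u, w + phi w u v)" by (simp add: uvw)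
    with Suc have "u + phi u v w = x n" "v + phi v w u = y n" "w + phi w u v = y n" by auto
    then show ?case
      using resistance_step_inj[OF pos x[of "Suc n"] xy(1)[of "Suc n"]] eq[of n] uvw by simp
  qed
  then show "s = (\<lambda>n. (x n, y n, y n))" by auto
qed

lemma resistance_pair_shift:
  assumes "resistance_pair x y"
  shows "resistance_pair (\<lambda>n. x (k + n)) (\<lambda>n. y (k + n))"
  using assms unfolding resistance_pair_def add_Suc_right by blast

lemma comparableI:
  assumes "0 < l" "\<And>n. 0 \<le> g n" "\<And>n. l * g n \<le> f n" "\<And>n. f n \<le> u * g n"
  shows "comparable f g"
  unfolding comparable_def
proof (intro exI[of _ "max u (inverse l)"] conjI allI)
  show pos: "0 < max u (inverse l)" using assms(1) by (simp add: less_max_iff_disj)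
  fix n
  have "inverse (max u (inverse l)) \<le> l"
    using pos assms(1) by (metis inverse_inverse_eq le_imp_inverse_le max.cobounded2 positive_imp_inverse_positive)
  then show "inverse (max u (inverse l)) * g n \<le> f n"
    using assms(2,3)[of n] mult_right_mono order_trans by blast
  show "f n \<le> max u (inverse l) * g n"
    using assms(2,4)[of n] mult_right_mono[of u "max u (inverse l)" "g n"] by simp
qed

context
  fixes x y t :: "nat \<Rightarrow> real"
  assumes pair: "resistance_pair x y"
  defines "t \<equiv> \<lambda>n. y n / x n"
begin

lemma pair_pos: "0 < y n" "y n < x n" "0 < x n"
proof -
  show *: "0 < y n" "y n < x n" using pair unfolding resistance_pair_def by blast+
  then show "0 < x n" by linarith
qed

lemma ratio_bounds: "0 < t n" "t n < 1"
  using pair_pos[of n] by (auto simp: t_def)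

lemma pair_step:
  "x n = x (Suc n) * ((3 + 6 * t (Suc n) + (t (Suc n))\<^sup>2) / (2 + 4 * t (Suc n)))"
  "y n = y (Suc n) * ((2 + 3 * t (Suc n)) / (1 + 2 * t (Suc n)))"
  "t n = ratio_map (t (Suc n))"
proof -
  have e: "x n = x (Suc n) + (x (Suc n) + y (Suc n))\<^sup>2 / (2 * (x (Suc n) + 2 * y (Suc n)))"
    "y n = y (Suc n) + y (Suc n) * (x (Suc n) + y (Suc n)) / (x (Suc n) + 2 * y (Suc n))"
    using pair unfolding resistance_pair_def by blast+
  note r = resistance_step_ratio[OF pair_pos(3)[of "Suc n"] pair_pos(1)[of "Suc n"], of "t (Suc n)"]
  show "x n = x (Suc n) * ((3 + 6 * t (Suc n) + (t (Suc n))\<^sup>2) / (2 + 4 * t (Suc n)))"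
    using r(1) e(1) by (simp add: t_def)
  show "y n = y (Suc n) * ((2 + 3 * t (Suc n)) / (1 + 2 * t (Suc n)))"
    using r(2) e(2) by (simp add: t_def)
  show "t n = ratio_map (t (Suc n))"
    using r(3) e by (simp add: t_def)
qed

lemma ratio_decreasing: "t (Suc n) < t n"
proof -
  let ?s = "t (Suc n)"
  have s: "0 < ?s" "?s < 1" by (rule ratio_bounds)+
  have "?s\<^sup>2 < 1" using s by (simp add: power_less_one_iff abs_square_less_1)
  then have "3 + 6 * ?s + ?s\<^sup>2 < 4 + 6 * ?s" by simp
  then have "1 < (4 + 6 * ?s) / (3 + 6 * ?s + ?s\<^sup>2)"
    using s ratio_denominator_pos[of ?s] by simp
  then have "?s * 1 < ?s * ((4 + 6 * ?s) / (3 + 6 * ?s + ?s\<^sup>2))"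
    using s by (intro mult_strict_left_mono) auto
  then show ?thesis by (simp add: pair_step(3)[of n] ratio_map_def)
qed

lemma ratio_antimono: "m \<le> n \<Longrightarrow> t n \<le> t m"
  using lift_Suc_antimono_le[of t] ratio_decreasing less_imp_le by blast

text \<open>
  The quotient \<open>ratio_map t / t\<close> decreases in \<open>t\<close> and exceeds one for \<open>t < 1\<close>; as the ratios decrease, it is
  bounded below by its value at \<open>t 0\<close>.
\<close>

lemma ratio_geometric: "\<exists>q. 0 < q \<and> q < 1 \<and> (\<forall>n. t n \<le> t 0 * q ^ n)"
proof -
  define g where "g s = (4 + 6 * s) / (3 + 6 * s + s\<^sup>2)" for s :: real
  have s0: "0 < t 0" "t 0 < 1" by (rule ratio_bounds)+
  have "(t 0)\<^sup>2 < 1" using s0 by (simp add: abs_square_less_1)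
  then have g1: "1 < g (t 0)" using s0 ratio_denominator_pos[of "t 0"] by (simp add: g_def)
  have g_anti: "g s \<le> g r" if "0 < r" "r \<le> s" for r s
  proof -
    have "0 \<le> (s - r) * (6 + 4 * (r + s) + 6 * (r * s))"
      using that by (intro mult_nonneg_nonneg add_nonneg_nonneg) auto
    then have "(4 + 6 * s) * (3 + 6 * r + r\<^sup>2) \<le> (4 + 6 * r) * (3 + 6 * s + s\<^sup>2)"
      by (simp add: algebra_simps power2_eq_square)
    then show ?thesis
      using that ratio_denominator_pos[of r] ratio_denominator_pos[of s]
      by (simp add: g_def divide_le_eq le_divide_eq mult.commute pos_divide_le_eq pos_le_divide_eq)
  qed
  have "t n \<le> t 0 * (1 / g (t 0)) ^ n" for n
  proof (induction n)
    case (Suc n)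
    have "t n = t (Suc n) * g (t (Suc n))"
      using pair_step(3)[of n] by (simp add: ratio_map_def g_def)
    moreover have "g (t 0) \<le> g (t (Suc n))"
      by (intro g_anti ratio_bounds ratio_antimono) auto
    ultimately have "t (Suc n) * g (t 0) \<le> t n"
      using ratio_bounds[of "Suc n"] by simp
    then have "t (Suc n) \<le> t n * (1 / g (t 0))" using g1 by (simp add: field_simps)
    also have "\<dots> \<le> t 0 * (1 / g (t 0)) ^ n * (1 / g (t 0))"
      using Suc g1 by (intro mult_right_mono) auto
    finally show ?case by (simp add: mult_ac)
  qed simp
  with g1 show ?thesis by (intro exI[of _ "1 / g (t 0)"]) auto
qed

lemma ratio_sum_bounded: "\<exists>T. \<forall>n. (\<Sum>k<n. t (Suc k)) \<le> T"
proof -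
  obtain q where q: "0 < q" "q < 1" "\<And>n. t n \<le> t 0 * q ^ n" using ratio_geometric by blast
  have sm: "summable (\<lambda>n. t 0 * q ^ n)" using q by (intro summable_mult summable_geometric) auto
  have "(\<Sum>k<n. t (Suc k)) \<le> (\<Sum>k. t 0 * q ^ k)" for n
  proof -
    have "(\<Sum>k<n. t (Suc k)) \<le> (\<Sum>k<n. t 0 * q ^ k)"
    proof (intro sum_mono)
      fix k
      have "t (Suc k) \<le> t k" by (rule less_imp_le[OF ratio_decreasing])
      with q(3)[of k] show "t (Suc k) \<le> t 0 * q ^ k" by linarith
    qed
    also have "\<dots> \<le> (\<Sum>k. t 0 * q ^ k)"
      using q ratio_bounds[of 0] by (intro sum_le_suminf[OF sm]) auto
    finally show ?thesis .
  qed
  then show ?thesis by blast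
qed

text \<open>
  From one level to the next, \<open>2 ^ n * y n\<close> is multiplied by \<open>(2 + 4 s) / (2 + 3 s)\<close>, where \<open>s\<close> is the new
  ratio.  This factor lies between \<open>1\<close> and \<open>exp s\<close>, and the ratios are summable.
\<close>

lemma y_asymptotics: "\<exists>u. \<forall>n. y 0 \<le> 2 ^ n * y n \<and> 2 ^ n * y n \<le> u"
proof -
  obtain T where T: "\<And>n. (\<Sum>k<n. t (Suc k)) \<le> T" using ratio_sum_bounded by blast
  have "y 0 \<le> 2 ^ n * y n \<and> 2 ^ n * y n \<le> y 0 * exp (\<Sum>k<n. t (Suc k))" for n
  proof (induction n)
    case (Suc n)
    let ?s = "t (Suc n)"
    have s: "0 < ?s" by (rule ratio_bounds)
    have yS: "2 * y (Suc n) = y n * ((2 + 4 * ?s) / (2 + 3 * ?s))"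
      using s pair_step(2)[of n] by (simp add: field_simps)
    have "1 \<le> (2 + 4 * ?s) / (2 + 3 * ?s)" using s by simp
    then have lo: "y n \<le> 2 * y (Suc n)"
      unfolding yS using pair_pos(1)[of n] mult_left_mono[of 1 "(2 + 4 * ?s) / (2 + 3 * ?s)" "y n"] by simp
    have "(2 + 4 * ?s) / (2 + 3 * ?s) \<le> 1 + ?s"
    proof -
      have "2 + 4 * ?s \<le> (1 + ?s) * (2 + 3 * ?s)" using s by (simp add: algebra_simps)
      then show ?thesis using s by (simp add: divide_le_eq)
    qed
    also have "\<dots> \<le> exp ?s" by (rule exp_ge_add_one_self)
    finally have hi: "2 * y (Suc n) \<le> y n * exp ?s"
      unfolding yS using pair_pos(1)[of n] by (intro mult_left_mono) auto
    have e: "2 ^ Suc n * y (Suc n) = 2 ^ n * (2 * y (Suc n))" by simp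
    have "2 ^ n * y n \<le> 2 ^ Suc n * y (Suc n)" unfolding e using lo by (intro mult_left_mono) auto
    moreover have "2 ^ Suc n * y (Suc n) \<le> (2 ^ n * y n) * exp ?s"
      unfolding e using mult_left_mono[OF hi, of "2 ^ n"] by (simp only: mult.assoc) simp
    moreover have "(2 ^ n * y n) * exp ?s \<le> y 0 * exp (\<Sum>k<n. t (Suc k)) * exp ?s"
      using Suc by (intro mult_right_mono) auto
    moreover have "y 0 * exp (\<Sum>k<Suc n. t (Suc k)) = y 0 * exp (\<Sum>k<n. t (Suc k)) * exp ?s"
      by (simp add: exp_add)
    ultimately show ?case using Suc by linarith
  qed simp
  moreover have "y 0 * exp (\<Sum>k<n. t (Suc k)) \<le> y 0 * exp T" for n
    using T[of n] pair_pos(1)[of 0] by simp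
  ultimately show ?thesis by (meson order_trans)
qed

text \<open>
  As for \<open>y\<close>: now \<open>(3/2) ^ n * x n\<close> is divided in each step by a factor between \<open>1\<close> and \<open>exp s\<close>.
\<close>

lemma x_asymptotics: "\<exists>l>0. \<forall>n. l \<le> (3/2) ^ n * x n \<and> (3/2) ^ n * x n \<le> x 0"
proof -
  obtain T where T: "\<And>n. (\<Sum>k<n. t (Suc k)) \<le> T" using ratio_sum_bounded by blast
  have "x 0 \<le> (3/2) ^ n * x n * exp (\<Sum>k<n. t (Suc k)) \<and> (3/2) ^ n * x n \<le> x 0" for n
  proof (induction n)
    case (Suc n)
    let ?s = "t (Suc n)"
    have s: "0 < ?s" "?s < 1" by (rule ratio_bounds)+
    define r where "r = (6 + 12 * ?s + 2 * ?s\<^sup>2) / (6 + 12 * ?s)"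
    have xS: "x n = 3/2 * x (Suc n) * r"
    proof -
      have "(3 + 6 * ?s + ?s\<^sup>2) / (2 + 4 * ?s) = 3/2 * r"
      proof -
        have "3/2 * r = (3 * (6 + 12 * ?s + 2 * ?s\<^sup>2)) / (2 * (6 + 12 * ?s))"
          by (simp add: r_def)
        also have "\<dots> = (6 * (3 + 6 * ?s + ?s\<^sup>2)) / (6 * (2 + 4 * ?s))"
          by (rule arg_cong2[where f = "(/)"]) (simp_all add: algebra_simps)
        also have "\<dots> = (3 + 6 * ?s + ?s\<^sup>2) / (2 + 4 * ?s)"
          by (subst mult_divide_mult_cancel_left) simp_all
        finally show ?thesis ..
      qed
      then show ?thesis using pair_step(1)[of n] by (metis mult.assoc mult.commute)
    qed
    have r1: "1 \<le> r" using s by (simp add: r_def)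
    have "2 * ?s\<^sup>2 \<le> 2 * ?s" using s by (simp add: power2_eq_square)
    moreover have "0 \<le> 4 * ?s + 12 * ?s\<^sup>2" using s by simp
    ultimately have "6 + 12 * ?s + 2 * ?s\<^sup>2 \<le> (1 + ?s) * (6 + 12 * ?s)"
      by (simp add: algebra_simps power2_eq_square)
    then have "r \<le> 1 + ?s" using s by (simp add: r_def divide_le_eq)
    also have "\<dots> \<le> exp ?s" by (rule exp_ge_add_one_self)
    finally have re: "r \<le> exp ?s" .
    have x1: "0 < x (Suc n)" by (rule pair_pos)
    have lo: "x n \<le> 3/2 * x (Suc n) * exp ?s"
      unfolding xS using re x1 by (intro mult_left_mono) auto
    have hi: "3/2 * x (Suc n) \<le> x n"
      unfolding xS using mult_left_mono[OF r1, of "3/2 * x (Suc n)"] x1 by simp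
    have "(3/2) ^ n * x n * exp (\<Sum>k<n. t (Suc k)) \<le> (3/2) ^ n * (3/2 * x (Suc n) * exp ?s) * exp (\<Sum>k<n. t (Suc k))"
      using lo by (intro mult_right_mono mult_left_mono) auto
    moreover have "(3/2) ^ n * (3/2 * x (Suc n) * exp ?s) * exp (\<Sum>k<n. t (Suc k))
        = (3/2) ^ Suc n * x (Suc n) * exp (\<Sum>k<Suc n. t (Suc k))"
      by (simp add: exp_add)
    moreover have "(3/2) ^ Suc n * x (Suc n) = (3/2) ^ n * (3/2 * x (Suc n))" by simp
    moreover have "(3/2) ^ n * (3/2 * x (Suc n)) \<le> (3/2) ^ n * x n"
      using hi by (intro mult_left_mono) auto
    ultimately show ?case using Suc by linarith
  qed simp
  moreover have "(3/2) ^ n * x n * exp (\<Sum>k<n. t (Suc k)) \<le> (3/2) ^ n * x n * exp T" for n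
    using T[of n] pair_pos(3)[of n] by simp
  ultimately have "x 0 \<le> (3/2) ^ n * x n * exp T \<and> (3/2) ^ n * x n \<le> x 0" for n
    by (meson order_trans)
  then have "x 0 * exp (- T) \<le> (3/2) ^ n * x n \<and> (3/2) ^ n * x n \<le> x 0" for n
    by (simp add: exp_minus field_simps)
  then show ?thesis using pair_pos(3)[of 0] by (intro exI[of _ "x 0 * exp (- T)"]) auto
qed

end

section \<open>The conductances\<close>

text \<open>
  The equations say that the triangle with conductances \<open>a n\<close>, \<open>b n\<close>, \<open>b n\<close> is the trace on its
  vertices of three triangles of half the size with the conductances of index \<open>n + 1\<close>: they give the
  energies of the minimizing extensions of the vertex values \<open>1, 0, 0\<close> and \<open>0, 1, -1\<close>, up to a factor
  \<open>2\<close>.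
\<close>

definition conductance_pair :: "(nat \<Rightarrow> real) \<Rightarrow> (nat \<Rightarrow> real) \<Rightarrow> bool" where
  "conductance_pair a b \<longleftrightarrow> (\<forall>n. 0 < b n \<and> b n < a n \<and>
     b n = b (Suc n) * (2 * a (Suc n) + b (Suc n)) / (3 * a (Suc n) + 2 * b (Suc n)) \<and>
     b n + 2 * a n = a (Suc n) + 2 * b (Suc n) * (a (Suc n) + b (Suc n)) / (2 * a (Suc n) + 3 * b (Suc n)))"

text \<open>
  In the symmetric case \<open>r = x y + y y + y x\<close> factorizes as \<open>y (2 x + y)\<close>.
\<close>

lemma star_delta_pair:
  assumes "0 < y" "0 < x"
  shows "star_delta (x, y, y) = (x / (y * (2 * x + y)), 1 / (2 * x + y), 1 / (2 * x + y))"
proof -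
  have r: "x * y + y * y + y * x = y * (2 * x + y)" by (simp add: algebra_simps)
  show ?thesis unfolding star_delta_def Let_def split r using assms by simp
qed

lemma conductance_sum:
  fixes x y :: real
  assumes "0 < y" "0 < x"
  shows "1 / (2 * x + y) + 2 * (x / (y * (2 * x + y))) = 1 / y"
proof -
  have D: "0 < 2 * x + y" using assms by simp
  have "1 / (2 * x + y) = y / (y * (2 * x + y))" using assms by simp
  then have "1 / (2 * x + y) + 2 * (x / (y * (2 * x + y))) = (2 * x + y) / (y * (2 * x + y))"
    by (simp only: add_divide_distrib)
  also have "\<dots> = 1 / y" using D by simp
  finally show ?thesis .
qed

lemma star_delta_involution:
  fixes x y :: real
  assumes "0 < y" "0 < x"
  shows "star_delta (star_delta (x, y, y)) = (x, y, y)"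
proof -
  let ?a = "x / (y * (2 * x + y))" and ?b = "1 / (2 * x + y)"
  have D: "0 < 2 * x + y" using assms by simp
  have ab: "0 < ?b" "0 < ?a" using assms by auto
  have "2 * ?a + ?b = 1 / y"
    using conductance_sum[OF assms] by simp
  then have "star_delta (?a, ?b, ?b) = (?a / (?b * (1 / y)), 1 / (1 / y), 1 / (1 / y))"
    by (simp only: star_delta_pair[OF ab])
  also have "\<dots> = (x, y, y)"
  proof -
    have "?a = x * (?b * (1 / y))" by simp
    moreover have "?b * (1 / y) \<noteq> 0" using assms D by simp
    ultimately have "?a / (?b * (1 / y)) = x" by (metis nonzero_mult_div_cancel_right)
    then show ?thesis by simp
  qed
  finally show ?thesis unfolding star_delta_pair[OF assms] .
qed

lemma divide_less_scaled:
  fixes x y d :: real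
  assumes "0 < y" "y < x" "0 < d"
  shows "1 / d < x / (y * d)"
proof -
  have "1 / d = y / (y * d)" using assms by simp
  also have "\<dots> < x / (y * d)" using assms by (intro divide_strict_right_mono) auto
  finally show ?thesis .
qed

text \<open>
  Write \<open>u, v\<close> for the resistances of the next level.  The recursion gives \<open>2 x + y = 3 u + 2 v\<close> and
  \<open>y = v (2 u + 3 v) / (u + 2 v)\<close>, and with \<open>k = 1 / (v (2 u + v))\<close> the new conductances are \<open>u k\<close> and \<open>v k\<close>.
  Both identities then reduce to \<open>v k (2 u + v) = 1\<close>.
\<close>

lemma conductance_pair_of_resistance_pair:
  assumes pair: "resistance_pair x y"
  shows "conductance_pair (\<lambda>n. x n / (y n * (2 * x n + y n))) (\<lambda>n. 1 / (2 * x n + y n))"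
  unfolding conductance_pair_def
proof (intro allI conjI)
  fix n
  have pos: "0 < y n" "y n < x n" "0 < x n" for n using pair_pos[OF pair] by auto
  then have Dn: "0 < 2 * x n + y n" for n by (simp add: add_pos_pos)
  define u where "u = x (Suc n)"
  define v where "v = y (Suc n)"
  have uv: "0 < u" "0 < v" unfolding u_def v_def by (rule pos)+
  have xn: "x n = u + (u + v)\<^sup>2 / (2 * (u + 2 * v))" and yn: "y n = v + v * (u + v) / (u + 2 * v)"
    using pair unfolding resistance_pair_def u_def v_def by blast+
  show "0 < 1 / (2 * x n + y n)" using Dn by simp
  show "1 / (2 * x n + y n) < x n / (y n * (2 * x n + y n))"
    using pos[of n] Dn[of n] by (intro divide_less_scaled)
  have yn': "y n = v * (2 * u + 3 * v) / (u + 2 * v)"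
    unfolding yn using uv by (simp add: field_simps)
  have "2 * x n + y n = 2 * u + v + ((u + v)\<^sup>2 / (u + 2 * v) + v * (u + v) / (u + 2 * v))"
  proof -
    have "2 * (A / (2 * B)) = A / B" for A B :: real by simp
    then have "2 * ((u + v)\<^sup>2 / (2 * (u + 2 * v))) = (u + v)\<^sup>2 / (u + 2 * v)" .
    moreover have "2 * (u + P) + (v + Q) = 2 * u + v + (R + Q)" if "2 * P = R" for P Q R
      using that by simp
    ultimately show ?thesis unfolding xn yn by blast
  qed
  also have "(u + v)\<^sup>2 / (u + 2 * v) + v * (u + v) / (u + 2 * v) = u + v"
    using uv by (simp add: add_divide_distrib[symmetric] power2_eq_square field_simps)
  finally have D: "2 * x n + y n = 3 * u + 2 * v" by simp
  let ?D = "2 * u + v"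
  have D0: "0 < ?D" using uv by simp
  define k where "k = 1 / (v * ?D)"
  have k: "0 < k" using uv by (simp add: k_def)
  have al: "u / (v * ?D) = u * k" and be: "1 / ?D = v * k" using uv by (simp_all add: k_def)
  have b1: "v * k * (2 * (u * k) + v * k) / (3 * (u * k) + 2 * (v * k)) = 1 / (3 * u + 2 * v)"
  proof -
    have "v * k * (2 * (u * k) + v * k) / (3 * (u * k) + 2 * (v * k)) = (v * k * ?D) * k / ((3 * u + 2 * v) * k)"
      by (simp add: algebra_simps)
    also have "v * k * ?D = 1" using uv by (simp add: k_def)
    finally show ?thesis using k by simp
  qed
  show "1 / (2 * x n + y n) = 1 / (2 * x (Suc n) + y (Suc n)) *
      (2 * (x (Suc n) / (y (Suc n) * (2 * x (Suc n) + y (Suc n)))) + 1 / (2 * x (Suc n) + y (Suc n))) /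
      (3 * (x (Suc n) / (y (Suc n) * (2 * x (Suc n) + y (Suc n)))) + 2 * (1 / (2 * x (Suc n) + y (Suc n))))"
    unfolding u_def[symmetric] v_def[symmetric] al be b1 D ..
  have "1 / (2 * x n + y n) + 2 * (x n / (y n * (2 * x n + y n))) = 1 / y n"
    by (rule conductance_sum) (rule pos)+
  also have "\<dots> = (u + 2 * v) / (v * (2 * u + 3 * v))" by (simp add: yn')
  also have "\<dots> = u * k + 2 * (v * k) * (u * k + v * k) / (2 * (u * k) + 3 * (v * k))"
  proof -
    have E: "0 < 2 * u + 3 * v" using uv by simp
    have "2 * (v * k) * (u * k + v * k) / (2 * (u * k) + 3 * (v * k)) = (2 * v * (u + v) * k) * k / ((2 * u + 3 * v) * k)"
      by (simp add: algebra_simps)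
    also have "\<dots> = (2 * v * (u + v) * k) / (2 * u + 3 * v)" using k by simp
    finally have "u * k + 2 * (v * k) * (u * k + v * k) / (2 * (u * k) + 3 * (v * k))
        = ((u * (2 * u + 3 * v) + 2 * v * (u + v)) * k) / (2 * u + 3 * v)"
      using E by (simp add: field_simps)
    also have "u * (2 * u + 3 * v) + 2 * v * (u + v) = (u + 2 * v) * ?D" by (simp add: algebra_simps)
    also have "(u + 2 * v) * ?D * k = (u + 2 * v) / v" using D0 by (simp add: k_def)
    finally show ?thesis by simp
  qed
  finally show "1 / (2 * x n + y n) + 2 * (x n / (y n * (2 * x n + y n))) =
      x (Suc n) / (y (Suc n) * (2 * x (Suc n) + y (Suc n))) +
      2 * (1 / (2 * x (Suc n) + y (Suc n))) *
      (x (Suc n) / (y (Suc n) * (2 * x (Suc n) + y (Suc n))) + 1 / (2 * x (Suc n) + y (Suc n))) /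
      (2 * (x (Suc n) / (y (Suc n) * (2 * x (Suc n) + y (Suc n)))) + 3 * (1 / (2 * x (Suc n) + y (Suc n))))"
    unfolding u_def[symmetric] v_def[symmetric] al be .
qed

lemma conductances_comparable:
  assumes pair: "resistance_pair x y"
  shows "comparable (\<lambda>n. x n / (y n * (2 * x n + y n))) (\<lambda>n. 2 ^ n)"
    and "comparable (\<lambda>n. 1 / (2 * x n + y n)) (\<lambda>n. (3/2) ^ n)"
proof -
  note pos = pair_pos[OF pair]
  obtain u where u: "\<And>n. y 0 \<le> 2 ^ n * y n" "\<And>n. 2 ^ n * y n \<le> u" using y_asymptotics[OF pair] by blast
  obtain l where l: "0 < l" "\<And>n. l \<le> (3/2) ^ n * x n" "\<And>n. (3/2) ^ n * x n \<le> x 0"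
    using x_asymptotics[OF pair] by blast
  have "0 < u" using u(2)[of 0] pos(1)[of 0] by simp
  show "comparable (\<lambda>n. x n / (y n * (2 * x n + y n))) (\<lambda>n. 2 ^ n)"
  proof (rule comparableI[of "1 / (3 * u)" _ _ "1 / y 0"])
    fix n
    have r: "1/3 \<le> x n / (2 * x n + y n)" "x n / (2 * x n + y n) \<le> 1"
      using pos[of n] by (simp_all add: le_divide_eq divide_le_eq)
    have eq: "x n / (y n * (2 * x n + y n)) = x n / (2 * x n + y n) * (1 / y n)" by simp
    have "1 / (3 * u) * 2 ^ n \<le> 1/3 * (1 / y n)"
      using u(2)[of n] pos(1)[of n] \<open>0 < u\<close> by (simp add: field_simps)
    also have "\<dots> \<le> x n / (2 * x n + y n) * (1 / y n)"
      using r pos(1)[of n] by (intro mult_right_mono) auto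
    finally show "1 / (3 * u) * 2 ^ n \<le> x n / (y n * (2 * x n + y n))" unfolding eq .
    have "x n / (2 * x n + y n) * (1 / y n) \<le> 1 * (1 / y n)"
      using r pos(1)[of n] by (intro mult_right_mono) auto
    also have "\<dots> \<le> 1 / y 0 * 2 ^ n"
      using u(1)[of n] pos(1)[of n] pos(1)[of 0] by (simp add: field_simps)
    finally show "x n / (y n * (2 * x n + y n)) \<le> 1 / y 0 * 2 ^ n" unfolding eq .
  qed (use \<open>0 < u\<close> in auto)
  show "comparable (\<lambda>n. 1 / (2 * x n + y n)) (\<lambda>n. (3/2) ^ n)"
  proof (rule comparableI[of "1 / (3 * x 0)" _ _ "1 / l"])
    fix n
    have "(3/2) ^ n * (2 * x n + y n) \<le> (3/2) ^ n * (3 * x n)"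
      using pos[of n] by (intro mult_left_mono) auto
    also have "\<dots> \<le> 3 * x 0" using l(3)[of n] by simp
    finally show "1 / (3 * x 0) * (3/2) ^ n \<le> 1 / (2 * x n + y n)"
      using pos[of n] pos(3)[of 0] by (simp add: pos_le_divide_eq pos_divide_le_eq)
    have "l \<le> (3/2) ^ n * x n" by (rule l)
    also have "\<dots> \<le> (3/2) ^ n * (2 * x n + y n)"
      using pos[of n] by (intro mult_left_mono) auto
    finally show "1 / (2 * x n + y n) \<le> 1 / l * (3/2) ^ n"
      using pos[of n] l(1) by (simp add: pos_le_divide_eq pos_divide_le_eq mult.commute)
  qed (use pos(3)[of 0] in auto)
qed

lemma conductance_ratio_increasing:
  assumes "resistance_pair x y"
  shows "(x n / (y n * (2 * x n + y n))) / (1 / (2 * x n + y n)) <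
    (x (Suc n) / (y (Suc n) * (2 * x (Suc n) + y (Suc n)))) / (1 / (2 * x (Suc n) + y (Suc n)))"
proof -
  note pos = pair_pos[OF assms]
  have *: "(x n / (y n * (2 * x n + y n))) / (1 / (2 * x n + y n)) = x n / y n" for n
    using pos[of n] by (simp add: add_pos_pos)
  have "y (Suc n) / x (Suc n) < y n / x n" by (rule ratio_decreasing[OF assms])
  then show ?thesis unfolding * using pos by (simp add: field_simps)
qed

lemma conductances_of_resistance_pair:
  assumes pair: "resistance_pair x y"
    and "a = (\<lambda>n. x n / (y n * (2 * x n + y n)))" "b = (\<lambda>n. 1 / (2 * x n + y n))"
  shows "conductances (a k) (b k) n = (a (k + n), b (k + n), b (k + n))"
proof -
  note pos = pair_pos[OF pair]
  have sd: "star_delta (x n, y n, y n) = (a n, b n, b n)" for n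
    using star_delta_pair[OF pos(1)[of n] pos(3)[of n]] by (simp add: assms)
  have "star_delta (a k, b k, b k) = (x k, y k, y k)"
    using star_delta_involution[OF pos(1)[of k] pos(3)[of k]] by (simp add: sd)
  moreover have "resistances (x k, y k, y k) = (\<lambda>n. (x (k + n), y (k + n), y (k + n)))"
    using resistances_of_pair[OF resistance_pair_shift[OF pair, of k]] by simp
  ultimately show ?thesis by (simp add: conductances_def sd)
qed

lemma resistance_pair_of_conductances:
  assumes "0 < b0" "b0 < a0"
  shows "\<exists>x y. resistance_pair x y \<and> a0 = x 0 / (y 0 * (2 * x 0 + y 0)) \<and> b0 = 1 / (2 * x 0 + y 0)"
proof -
  let ?x = "a0 / (b0 * (2 * a0 + b0))" and ?y = "1 / (2 * a0 + b0)"
  have "0 < ?y" "?y < ?x" using assms divide_less_scaled[of b0 a0 "2 * a0 + b0"] by auto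
  then obtain x y where xy: "resistance_pair x y" "x 0 = ?x" "y 0 = ?y"
    using resistance_pair_exists by blast
  have "0 < a0" using assms by simp
  then have sd: "star_delta (a0, b0, b0) = (x 0, y 0, y 0)"
    using star_delta_pair[OF assms(1)] xy by simp
  then have "star_delta (x 0, y 0, y 0) = (a0, b0, b0)"
    using star_delta_involution[OF assms(1) \<open>0 < a0\<close>] by simp
  then have "a0 = x 0 / (y 0 * (2 * x 0 + y 0))" "b0 = 1 / (2 * x 0 + y 0)"
    using star_delta_pair[OF pair_pos(1)[OF xy(1)] pair_pos(3)[OF xy(1)], of 0 0] by auto
  with xy(1) show ?thesis by blast
qed

section \<open>Harmonic extension on one cell\<close>

definition triple_energy :: "real \<Rightarrow> real \<Rightarrow> (nat \<Rightarrow> real) \<Rightarrow> real" where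
  "triple_energy \<alpha> \<beta> v = \<beta> * (v 1 - v 2)\<^sup>2 + \<beta> * (v 1 - v 3)\<^sup>2 + \<alpha> * (v 2 - v 3)\<^sup>2"

text \<open>
  The harmonic values at the midpoints, for conductances \<open>\<alpha>, \<beta>\<close> on the subcells;
  they solve the three equations of \<open>harmonic_mid_equations\<close>.
\<close>

definition mid23 :: "real \<Rightarrow> real \<Rightarrow> (nat \<Rightarrow> real) \<Rightarrow> real" where
  "mid23 \<alpha> \<beta> v = (\<beta> * v 1 + (3 * \<alpha> + \<beta>) * ((v 2 + v 3) / 2)) / (3 * \<alpha> + 2 * \<beta>)"

definition mid12 :: "real \<Rightarrow> real \<Rightarrow> (nat \<Rightarrow> real) \<Rightarrow> real" where
  "mid12 \<alpha> \<beta> v = (2 * v 1 + v 2 + v 3 + 2 * mid23 \<alpha> \<beta> v) / 6 + \<beta> / (2 * \<alpha> + 3 * \<beta>) * ((v 2 - v 3) / 2)"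

definition mid13 :: "real \<Rightarrow> real \<Rightarrow> (nat \<Rightarrow> real) \<Rightarrow> real" where
  "mid13 \<alpha> \<beta> v = (2 * v 1 + v 2 + v 3 + 2 * mid23 \<alpha> \<beta> v) / 6 - \<beta> / (2 * \<alpha> + 3 * \<beta>) * ((v 2 - v 3) / 2)"

text \<open>
  The vertex values of the \<open>i\<close>-th subcell.  The sum \<open>i + j\<close> tells which midpoint the cells
  \<open>i\<close> and \<open>j\<close> share.
\<close>

definition harmonic_step :: "real \<Rightarrow> real \<Rightarrow> (nat \<Rightarrow> real) \<Rightarrow> nat \<Rightarrow> nat \<Rightarrow> real" where
  "harmonic_step \<alpha> \<beta> v i j = (if i = j then v i
     else if i + j = 3 then mid12 \<alpha> \<beta> v else if i + j = 4 then mid13 \<alpha> \<beta> v else mid23 \<alpha> \<beta> v)"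

lemma harmonic_step_sym: "harmonic_step \<alpha> \<beta> v i j = harmonic_step \<alpha> \<beta> v j i"
  by (simp add: harmonic_step_def add.commute)

lemma harmonic_step_diag [simp]: "harmonic_step \<alpha> \<beta> v i i = v i"
  by (simp add: harmonic_step_def)

lemma triple_energy_nonneg: "0 \<le> \<alpha> \<Longrightarrow> 0 \<le> \<beta> \<Longrightarrow> 0 \<le> triple_energy \<alpha> \<beta> v"
  by (simp add: triple_energy_def)

lemma harmonic_mid_equations:
  assumes "0 < \<alpha>" "0 < \<beta>"
  shows "(3 * \<beta> + \<alpha>) * mid12 \<alpha> \<beta> v = \<beta> * (v 1 + v 2 + mid23 \<alpha> \<beta> v) + \<alpha> * mid13 \<alpha> \<beta> v"
    and "(3 * \<beta> + \<alpha>) * mid13 \<alpha> \<beta> v = \<beta> * (v 1 + v 3 + mid23 \<alpha> \<beta> v) + \<alpha> * mid12 \<alpha> \<beta> v"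
    and "2 * (\<alpha> + \<beta>) * mid23 \<alpha> \<beta> v = \<beta> * (mid12 \<alpha> \<beta> v + mid13 \<alpha> \<beta> v) + \<alpha> * (v 2 + v 3)"
proof -
  define s where "s = (2 * v 1 + v 2 + v 3 + 2 * mid23 \<alpha> \<beta> v) / 6"
  define d where "d = \<beta> / (2 * \<alpha> + 3 * \<beta>) * ((v 2 - v 3) / 2)"
  have m12: "mid12 \<alpha> \<beta> v = s + d" and m13: "mid13 \<alpha> \<beta> v = s - d"
    by (simp_all add: mid12_def mid13_def s_def d_def)
  have E: "0 < 2 * \<alpha> + 3 * \<beta>" "0 < 3 * \<alpha> + 2 * \<beta>" using assms by simp_all
  have "e * (\<beta> / e * t) = \<beta> * t" if "0 < e" for e t :: real using that by simp
  from this[OF E(1)] have d: "(2 * \<alpha> + 3 * \<beta>) * d = \<beta> * ((v 2 - v 3) / 2)" unfolding d_def .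
  have s: "6 * s = 2 * v 1 + v 2 + v 3 + 2 * mid23 \<alpha> \<beta> v" by (simp add: s_def)
  have r: "(3 * \<alpha> + 2 * \<beta>) * mid23 \<alpha> \<beta> v = \<beta> * v 1 + (3 * \<alpha> + \<beta>) * ((v 2 + v 3) / 2)"
    using E(2) by (simp add: mid23_def)
  have s\<beta>: "6 * (\<beta> * s) = \<beta> * (2 * v 1 + v 2 + v 3 + 2 * mid23 \<alpha> \<beta> v)"
    using s by (metis mult.left_commute)
  show "(3 * \<beta> + \<alpha>) * mid12 \<alpha> \<beta> v = \<beta> * (v 1 + v 2 + mid23 \<alpha> \<beta> v) + \<alpha> * mid13 \<alpha> \<beta> v"
    unfolding m12 m13 using d s\<beta> by (simp add: algebra_simps)
  show "(3 * \<beta> + \<alpha>) * mid13 \<alpha> \<beta> v = \<beta> * (v 1 + v 3 + mid23 \<alpha> \<beta> v) + \<alpha> * mid12 \<alpha> \<beta> v"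
    unfolding m12 m13 using d s\<beta> by (simp add: algebra_simps)
  show "2 * (\<alpha> + \<beta>) * mid23 \<alpha> \<beta> v = \<beta> * (mid12 \<alpha> \<beta> v + mid13 \<alpha> \<beta> v) + \<alpha> * (v 2 + v 3)"
  proof -
    let ?r = "mid23 \<alpha> \<beta> v"
    have "3 * (2 * (\<alpha> + \<beta>) * ?r - (\<beta> * (s + d + (s - d)) + \<alpha> * (v 2 + v 3)))
        = 2 * ((3 * \<alpha> + 2 * \<beta>) * ?r - (\<beta> * v 1 + (3 * \<alpha> + \<beta>) * ((v 2 + v 3) / 2)))
          - (6 * (\<beta> * s) - \<beta> * (2 * v 1 + v 2 + v 3 + 2 * ?r))"
      by (simp add: field_simps)
    also have "\<dots> = 0" unfolding r s\<beta> by simp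
    finally show ?thesis unfolding m12 m13 by simp
  qed
qed

text \<open>
  Expanding the quadratic polynomial around the harmonic values, the linear terms vanish by the equations.
\<close>

lemma midpoint_energy_expand:
  fixes p q r :: real
  assumes e1: "(3 * \<beta> + \<alpha>) * p = \<beta> * (A + B + r) + \<alpha> * q"
    and e2: "(3 * \<beta> + \<alpha>) * q = \<beta> * (A + C + r) + \<alpha> * p"
    and e3: "2 * (\<alpha> + \<beta>) * r = \<beta> * (p + q) + \<alpha> * (B + C)"
  defines "S \<equiv> \<lambda>A B C P Q R.
      (\<beta> * (A - P)\<^sup>2 + \<beta> * (A - Q)\<^sup>2 + \<alpha> * (P - Q)\<^sup>2) +
      (\<beta> * (P - B)\<^sup>2 + \<beta> * (P - R)\<^sup>2 + \<alpha> * (B - R)\<^sup>2) +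
      (\<beta> * (Q - R)\<^sup>2 + \<beta> * (Q - C)\<^sup>2 + \<alpha> * (R - C)\<^sup>2)"
  shows "S A B C P Q R = S A B C p q r + S 0 0 0 (P - p) (Q - q) (R - r)"
proof -
  have "S A B C P Q R - S A B C p q r - S 0 0 0 (P - p) (Q - q) (R - r) =
      2 * ((P - p) * ((3 * \<beta> + \<alpha>) * p - (\<beta> * (A + B + r) + \<alpha> * q)) +
           (Q - q) * ((3 * \<beta> + \<alpha>) * q - (\<beta> * (A + C + r) + \<alpha> * p)) +
           (R - r) * (2 * (\<alpha> + \<beta>) * r - (\<beta> * (p + q) + \<alpha> * (B + C))))"
    unfolding S_def by algebra
  also have "\<dots> = 0" unfolding e1 e2 e3 by simp
  finally show ?thesis by simp
qed

text \<open>
  Vertex values are split into the mean \<open>M\<close> of the second and third value relative to the first, and the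
  difference \<open>d\<close> of the second and third.  By symmetry the energy of the harmonic values has no mixed term
  in \<open>M\<close> and \<open>d\<close>.  Its two coefficients are the two expressions by which the conductances of the coarser
  level are given.
\<close>

lemma harmonic_energy_value:
  fixes \<alpha> \<beta> a0 b0 :: real
  assumes pos: "0 < \<alpha>" "0 < \<beta>"
    and b0: "b0 = \<beta> * (2 * \<alpha> + \<beta>) / (3 * \<alpha> + 2 * \<beta>)"
    and a0: "b0 + 2 * a0 = \<alpha> + 2 * \<beta> * (\<alpha> + \<beta>) / (2 * \<alpha> + 3 * \<beta>)"
  shows "triple_energy \<alpha> \<beta> (harmonic_step \<alpha> \<beta> v 1) + triple_energy \<alpha> \<beta> (harmonic_step \<alpha> \<beta> v 2)
      + triple_energy \<alpha> \<beta> (harmonic_step \<alpha> \<beta> v 3) = triple_energy a0 b0 v"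
proof -
  define A where "A = v 1"
  define M where "M = (v 2 + v 3) / 2 - v 1"
  define d where "d = v 2 - v 3"
  define \<rho> where "\<rho> = (3 * \<alpha> + \<beta>) / (3 * \<alpha> + 2 * \<beta>)"
  define \<kappa> where "\<kappa> = \<beta> / (2 * \<alpha> + 3 * \<beta>)"
  define D where "D = 3 * \<alpha> + 2 * \<beta>"
  define E where "E = 2 * \<alpha> + 3 * \<beta>"
  have D: "0 < D" and E: "0 < E" using pos by (simp_all add: D_def E_def)
  have v: "v 1 = A" "v 2 = A + M + d / 2" "v 3 = A + M - d / 2"
    by (simp_all add: A_def M_def d_def field_simps)
  have \<rho>D: "\<rho> * D = 3 * \<alpha> + \<beta>" and \<kappa>E: "\<kappa> * E = \<beta>"
    using D E by (simp_all add: \<rho>_def \<kappa>_def D_def E_def)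
  have \<rho>1: "(1 - \<rho>) * D = \<beta>" using \<rho>D by (simp add: D_def algebra_simps)
  have r: "mid23 \<alpha> \<beta> v = A + \<rho> * M"
  proof -
    have "mid23 \<alpha> \<beta> v * D = \<beta> * A + (3 * \<alpha> + \<beta>) * (A + M)"
      using D unfolding mid23_def D_def[symmetric] v by simp
    also have "\<dots> = A * D + (3 * \<alpha> + \<beta>) * M" by (simp add: D_def algebra_simps)
    also have "\<dots> = (A + \<rho> * M) * D" unfolding \<rho>D[symmetric] by (simp add: algebra_simps)
    finally show ?thesis using D by simp
  qed
  define e where "e = (1 + \<rho>) / 3"
  define \<delta> where "\<delta> = \<kappa> * d"
  have p: "mid12 \<alpha> \<beta> v = A + e * M + \<delta> / 2" and q: "mid13 \<alpha> \<beta> v = A + e * M - \<delta> / 2"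
    unfolding mid12_def mid13_def r unfolding v \<kappa>_def[symmetric] e_def \<delta>_def by (simp_all add: field_simps)
  have even: "\<beta> * (e\<^sup>2 + (e - 1)\<^sup>2 + (e - \<rho>)\<^sup>2) + \<alpha> * (1 - \<rho>)\<^sup>2 = b0"
  proof -
    have "(\<beta> * (e\<^sup>2 + (e - 1)\<^sup>2 + (e - \<rho>)\<^sup>2) + \<alpha> * (1 - \<rho>)\<^sup>2) * (3 * D\<^sup>2)
        = 2 * \<beta> * ((1 - \<rho>) * D * D + (\<rho> * D)\<^sup>2) + 3 * \<alpha> * ((1 - \<rho>) * D)\<^sup>2"
      by (simp add: e_def power2_eq_square field_simps)
    also have "\<dots> = 3 * (\<beta> * (2 * \<alpha> + \<beta>) * D)"
      unfolding \<rho>D \<rho>1 unfolding D_def by (simp add: power2_eq_square algebra_simps)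
    also have "\<dots> = b0 * (3 * D\<^sup>2)"
      using D unfolding b0 D_def[symmetric] by (simp add: power2_eq_square)
    finally show ?thesis using D by simp
  qed
  have odd: "2 * \<kappa>\<^sup>2 * (\<alpha> + \<beta>) + \<beta> * (\<kappa> - 1)\<^sup>2 + \<alpha> = b0 + 2 * a0"
  proof -
    have k1: "(\<kappa> - 1) * E = - 2 * (\<alpha> + \<beta>)" using \<kappa>E by (simp add: E_def algebra_simps)
    have "(2 * \<kappa>\<^sup>2 * (\<alpha> + \<beta>) + \<beta> * (\<kappa> - 1)\<^sup>2 + \<alpha>) * E\<^sup>2
        = 2 * (\<kappa> * E)\<^sup>2 * (\<alpha> + \<beta>) + \<beta> * ((\<kappa> - 1) * E)\<^sup>2 + \<alpha> * E\<^sup>2"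
      by (simp add: power2_eq_square algebra_simps)
    also have "\<dots> = (\<alpha> * E + 2 * \<beta> * (\<alpha> + \<beta>)) * E"
      unfolding \<kappa>E k1 unfolding E_def by (simp add: power2_eq_square algebra_simps)
    also have "\<dots> = (b0 + 2 * a0) * E\<^sup>2"
    proof -
      have "(x * E + y) * E = (x + y / E) * E\<^sup>2" for x y :: real
        using E by (simp add: power2_eq_square distrib_right)
      then show ?thesis unfolding a0 E_def[symmetric] .
    qed
    finally show ?thesis using E by simp
  qed
  have "triple_energy \<alpha> \<beta> (harmonic_step \<alpha> \<beta> v 1) + triple_energy \<alpha> \<beta> (harmonic_step \<alpha> \<beta> v 2)
      + triple_energy \<alpha> \<beta> (harmonic_step \<alpha> \<beta> v 3)
      = (\<beta> * (e * M + \<delta> / 2)\<^sup>2 + \<beta> * (e * M - \<delta> / 2)\<^sup>2 + \<alpha> * \<delta>\<^sup>2)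
      + (\<beta> * ((e - 1) * M + (\<delta> - d) / 2)\<^sup>2 + \<beta> * ((e - \<rho>) * M + \<delta> / 2)\<^sup>2 + \<alpha> * ((1 - \<rho>) * M + d / 2)\<^sup>2)
      + (\<beta> * ((e - \<rho>) * M - \<delta> / 2)\<^sup>2 + \<beta> * ((e - 1) * M - (\<delta> - d) / 2)\<^sup>2 + \<alpha> * ((1 - \<rho>) * M - d / 2)\<^sup>2)"
  proof -
    have s: "(x - y)\<^sup>2 = z\<^sup>2" if "x - y = z \<or> x - y = - z" for x y z :: real using that by auto
    show ?thesis
      unfolding triple_energy_def
      by (intro arg_cong2[where f = "(+)"] arg_cong2[where f = "(*)"] refl s)
         (simp_all add: harmonic_step_def p q r v v(1)[simplified] field_simps)
  qed
  also have "\<dots> = 2 * M\<^sup>2 * (\<beta> * (e\<^sup>2 + (e - 1)\<^sup>2 + (e - \<rho>)\<^sup>2) + \<alpha> * (1 - \<rho>)\<^sup>2)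
      + d\<^sup>2 / 2 * (2 * \<kappa>\<^sup>2 * (\<alpha> + \<beta>) + \<beta> * (\<kappa> - 1)\<^sup>2 + \<alpha>)"
    unfolding \<delta>_def by (simp add: power2_eq_square algebra_simps)
  also have "\<dots> = 2 * M\<^sup>2 * b0 + d\<^sup>2 / 2 * (b0 + 2 * a0)" by (simp only: even odd)
  also have "\<dots> = triple_energy a0 b0 v"
    unfolding triple_energy_def v by (simp add: power2_eq_square algebra_simps)
  finally show ?thesis .
qed

lemma sum_three: "(\<Sum>i\<in>{1,2,3::nat}. g i) = g 1 + g 2 + (g 3 :: 'a :: comm_monoid_add)"
  by (simp add: add.assoc)

text \<open>
  The energy of arbitrary midpoint values is the energy of the coarse cell plus a nonnegative remainder
  that vanishes for the harmonic values.  This yields both the monotonicity of the energies and the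
  existence of extensions without increase of energy.
\<close>

lemma triple_energy_subdivide:
  fixes \<alpha> \<beta> a0 b0 :: real
  assumes pos: "0 < \<alpha>" "0 < \<beta>"
    and b0: "b0 = \<beta> * (2 * \<alpha> + \<beta>) / (3 * \<alpha> + 2 * \<beta>)"
    and a0: "b0 + 2 * a0 = \<alpha> + 2 * \<beta> * (\<alpha> + \<beta>) / (2 * \<alpha> + 3 * \<beta>)"
    and w: "\<And>i j. i \<in> {1,2,3} \<Longrightarrow> j \<in> {1,2,3} \<Longrightarrow> w i j = w j i" "\<And>i. i \<in> {1,2,3} \<Longrightarrow> w i i = v i"
  shows "(\<Sum>i\<in>{1,2,3}. triple_energy \<alpha> \<beta> (w i)) = triple_energy a0 b0 v +
    (\<Sum>i\<in>{1,2,3}. triple_energy \<alpha> \<beta> (\<lambda>j. w i j - harmonic_step \<alpha> \<beta> v i j))"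
proof -
  have d: "w 1 1 = v 1" "w 2 2 = v 2" "w 3 3 = v 3" and o: "w 2 1 = w 1 2" "w 3 1 = w 1 3" "w 3 2 = w 2 3"
    using w(1)[of 2 1] w(1)[of 3 1] w(1)[of 3 2] w(2)[of 1] w(2)[of 2] w(2)[of 3] by auto
  let ?p = "mid12 \<alpha> \<beta> v" and ?q = "mid13 \<alpha> \<beta> v" and ?r = "mid23 \<alpha> \<beta> v"
  have h: "harmonic_step \<alpha> \<beta> v 1 2 = ?p" "harmonic_step \<alpha> \<beta> v 2 1 = ?p" "harmonic_step \<alpha> \<beta> v 1 3 = ?q"
    "harmonic_step \<alpha> \<beta> v 3 1 = ?q" "harmonic_step \<alpha> \<beta> v 2 3 = ?r" "harmonic_step \<alpha> \<beta> v 3 2 = ?r"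
    by (simp_all add: harmonic_step_def)
  have "(\<Sum>i\<in>{1,2,3}. triple_energy \<alpha> \<beta> (w i)) =
    (triple_energy \<alpha> \<beta> (harmonic_step \<alpha> \<beta> v 1) + triple_energy \<alpha> \<beta> (harmonic_step \<alpha> \<beta> v 2)
      + triple_energy \<alpha> \<beta> (harmonic_step \<alpha> \<beta> v 3)) +
    (\<Sum>i\<in>{1,2,3}. triple_energy \<alpha> \<beta> (\<lambda>j. w i j - harmonic_step \<alpha> \<beta> v i j))"
    unfolding sum_three triple_energy_def h d o harmonic_step_diag
    using midpoint_energy_expand[OF harmonic_mid_equations[OF pos, of v], of "w 1 2" "w 1 3" "w 2 3"]
    by simp
  then show ?thesis unfolding harmonic_energy_value[OF pos b0 a0] .
qed

text \<open>
  Maximum principle: at the midpoint with the largest value, the equation expresses that value by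
  values that are not larger, with positive weight on a vertex.
\<close>

lemma harmonic_values_le:
  fixes p q r :: real
  assumes pos: "0 < \<alpha>" "0 < \<beta>"
    and e1: "(3 * \<beta> + \<alpha>) * p = \<beta> * (A + B + r) + \<alpha> * q"
    and e2: "(3 * \<beta> + \<alpha>) * q = \<beta> * (A + C + r) + \<alpha> * p"
    and e3: "2 * (\<alpha> + \<beta>) * r = \<beta> * (p + q) + \<alpha> * (B + C)"
    and u: "A \<le> u" "B \<le> u" "C \<le> u"
  shows "p \<le> u \<and> q \<le> u \<and> r \<le> u"
proof -
  have x: "\<beta> * A \<le> \<beta> * u" "\<beta> * B \<le> \<beta> * u" "\<beta> * C \<le> \<beta> * u" "\<alpha> * B \<le> \<alpha> * u" "\<alpha> * C \<le> \<alpha> * u"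
    using u pos by simp_all
  consider "q \<le> p" "r \<le> p" | "p \<le> q" "r \<le> q" | "p \<le> r" "q \<le> r" by linarith
  then show ?thesis
  proof cases
    case 1
    then have "\<alpha> * q \<le> \<alpha> * p" "\<beta> * r \<le> \<beta> * p" using pos by simp_all
    with e1 x have "\<beta> * p \<le> \<beta> * u" by (simp add: algebra_simps)
    then have "p \<le> u" using pos by simp
    with 1 show ?thesis by linarith
  next
    case 2
    then have "\<alpha> * p \<le> \<alpha> * q" "\<beta> * r \<le> \<beta> * q" using pos by simp_all
    with e2 x have "\<beta> * q \<le> \<beta> * u" by (simp add: algebra_simps)
    then have "q \<le> u" using pos by simp
    with 2 show ?thesis by linarith
  next
    case 3
    then have "\<beta> * p \<le> \<beta> * r" "\<beta> * q \<le> \<beta> * r" using pos by simp_all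
    with e3 x have "\<alpha> * r \<le> \<alpha> * u" by (simp add: algebra_simps)
    then have "r \<le> u" using pos by simp
    with 3 show ?thesis by linarith
  qed
qed

text \<open>
  The lower bound is the upper bound for the negated values.
\<close>

lemma harmonic_step_bounds:
  assumes pos: "0 < \<alpha>" "0 < \<beta>" and v: "\<And>i. i \<in> {1,2,3} \<Longrightarrow> l \<le> v i \<and> v i \<le> u"
    and i: "i \<in> {1,2,3}"
  shows "l \<le> harmonic_step \<alpha> \<beta> v i j \<and> harmonic_step \<alpha> \<beta> v i j \<le> u"
proof -
  have v': "l \<le> v 1" "l \<le> v 2" "l \<le> v 3" "v 1 \<le> u" "v 2 \<le> u" "v 3 \<le> u"
    using v[of 1] v[of 2] v[of 3] by simp_all
  note e = harmonic_mid_equations[OF pos, of v]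
  have up: "mid12 \<alpha> \<beta> v \<le> u \<and> mid13 \<alpha> \<beta> v \<le> u \<and> mid23 \<alpha> \<beta> v \<le> u"
    by (rule harmonic_values_le[OF pos e v'(4-6)])
  have "- mid12 \<alpha> \<beta> v \<le> - l \<and> - mid13 \<alpha> \<beta> v \<le> - l \<and> - mid23 \<alpha> \<beta> v \<le> - l"
    by (rule harmonic_values_le[OF pos, of _ "- v 1" "- v 2" _ _ "- v 3"])
       (use e v' in \<open>simp_all add: algebra_simps\<close>)
  with up v[OF i] show ?thesis unfolding harmonic_step_def by auto
qed

text \<open>
  As \<open>\<beta> \<le> \<alpha>\<close>, every edge has conductance at least \<open>\<beta>\<close>.
\<close>

lemma triple_energy_ge_edge:
  assumes "0 < \<beta>" "\<beta> \<le> \<alpha>" "i \<in> {1,2,3}" "j \<in> {1,2,3}"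
  shows "\<beta> * (v i - v j)\<^sup>2 \<le> triple_energy \<alpha> \<beta> v"
proof -
  have "\<beta> * (v 2 - v 3)\<^sup>2 \<le> \<alpha> * (v 2 - v 3)\<^sup>2" using assms by (intro mult_right_mono) auto
  moreover have "0 \<le> \<beta> * (v 1 - v 2)\<^sup>2" "0 \<le> \<beta> * (v 1 - v 3)\<^sup>2" "0 \<le> \<beta> * (v 2 - v 3)\<^sup>2" using assms by simp_all
  ultimately have *: "\<beta> * (v 1 - v 2)\<^sup>2 \<le> triple_energy \<alpha> \<beta> v" "\<beta> * (v 1 - v 3)\<^sup>2 \<le> triple_energy \<alpha> \<beta> v"
    "\<beta> * (v 2 - v 3)\<^sup>2 \<le> triple_energy \<alpha> \<beta> v" "0 \<le> triple_energy \<alpha> \<beta> v"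
    unfolding triple_energy_def by linarith+
  from assms(3,4) show ?thesis
    by (elim three_cases) (simp_all only: * power2_commute[of "v 2" "v 1"] power2_commute[of "v 3" "v 1"]
      power2_commute[of "v 3" "v 2"] diff_self power_zero_numeral mult_zero_right)
qed

section \<open>Energies on the gasket\<close>

definition vertex_values :: "(complex \<Rightarrow> real) \<Rightarrow> nat \<Rightarrow> real" where
  "vertex_values u i = u (sg_vertex i)"

locale gasket_energy =
  fixes a b :: "nat \<Rightarrow> real"
  assumes pair: "conductance_pair a b"
    and growth: "comparable b (\<lambda>n. (3/2) ^ n)"
begin

lemma ab_pos: "0 < b n" "b n < a n" "0 < a n"
proof -
  show *: "0 < b n" "b n < a n" using pair unfolding conductance_pair_def by blast+
  then show "0 < a n" by linarith
qed

lemma renormalization: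
  "b n = b (Suc n) * (2 * a (Suc n) + b (Suc n)) / (3 * a (Suc n) + 2 * b (Suc n))"
  "b n + 2 * a n = a (Suc n) + 2 * b (Suc n) * (a (Suc n) + b (Suc n)) / (2 * a (Suc n) + 3 * b (Suc n))"
  using pair unfolding conductance_pair_def by blast+

text \<open>
  The conductances are those of the sequence from index \<open>k\<close> on.  The index is needed because restriction
  to a first-level cell replaces \<open>k\<close> by \<open>Suc k\<close>; inductions over the level run over all \<open>k\<close> at once.
\<close>

definition level :: "nat \<Rightarrow> nat \<Rightarrow> (complex \<Rightarrow> real) \<Rightarrow> real" where
  "level k n u = (\<Sum>w\<in>sg_words n. triple_energy (a (k + n)) (b (k + n)) (vertex_values (u \<circ> sg_word_map w)))"

lemma level_0: "level k 0 u = triple_energy (a k) (b k) (vertex_values u)"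
  by (simp add: level_def)

lemma level_Suc: "level k (Suc n) u = (\<Sum>i\<in>{1,2,3}. level (Suc k) n (u \<circ> sg_map i))"
  by (simp only: level_def sum_sg_words_Suc sg_word_map_Cons comp_assoc add_Suc_right add_Suc)

lemma level_nonneg: "0 \<le> level k n u"
  unfolding level_def
  by (intro sum_nonneg triple_energy_nonneg) (auto intro: less_imp_le ab_pos)

lemma level_cong:
  assumes "\<And>x. x \<in> gasket \<Longrightarrow> u x = v x"
  shows "level k n u = level k n v"
  unfolding level_def
proof (intro sum.cong refl)
  fix w assume w: "w \<in> sg_words n"
  have "vertex_values (u \<circ> sg_word_map w) i = vertex_values (v \<circ> sg_word_map w) i" if "i \<in> {1,2,3}" for i
    using assms[OF sg_word_map_gasket[OF w sg_vertex_gasket[OF that]]] by (simp add: vertex_values_def)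
  then show "triple_energy (a (k + n)) (b (k + n)) (vertex_values (u \<circ> sg_word_map w)) =
      triple_energy (a (k + n)) (b (k + n)) (vertex_values (v \<circ> sg_word_map w))"
    by (simp add: triple_energy_def)
qed

text \<open>
  The vertex values on the three cells agree at the shared midpoints, so the subdivision identity applies.
\<close>

lemma subdivided_vertex_values:
  "(\<Sum>i\<in>{1,2,3}. triple_energy (a (Suc k)) (b (Suc k)) (vertex_values (u \<circ> sg_map i))) =
    triple_energy (a k) (b k) (vertex_values u) +
    (\<Sum>i\<in>{1,2,3}. triple_energy (a (Suc k)) (b (Suc k))
      (\<lambda>j. vertex_values (u \<circ> sg_map i) j - harmonic_step (a (Suc k)) (b (Suc k)) (vertex_values u) i j))"
  by (rule triple_energy_subdivide[OF ab_pos(3) ab_pos(1) renormalization])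
     (simp_all only: vertex_values_def comp_apply sg_map_vertex_commute sg_map_vertex)

lemma level_mono_Suc: "level k n u \<le> level k (Suc n) u"
proof (induction n arbitrary: k u)
  case 0
  have "0 \<le> (\<Sum>i\<in>{1,2,3}. triple_energy (a (Suc k)) (b (Suc k))
      (\<lambda>j. vertex_values (u \<circ> sg_map i) j - harmonic_step (a (Suc k)) (b (Suc k)) (vertex_values u) i j))"
    by (intro sum_nonneg triple_energy_nonneg less_imp_le ab_pos)
  then show ?case
    unfolding level_Suc[of k 0] level_0 subdivided_vertex_values by linarith
next
  case (Suc n)
  show ?case unfolding level_Suc[of k n] level_Suc[of k "Suc n"] by (intro sum_mono Suc.IH)
qed

lemma edge_le_level:
  assumes w: "w \<in> sg_words n" and ij: "i \<in> {1,2,3}" "j \<in> {1,2,3}"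
  shows "b (k + n) * (u (sg_word_map w (sg_vertex i)) - u (sg_word_map w (sg_vertex j)))\<^sup>2 \<le> level k n u"
proof -
  have "b (k + n) * (u (sg_word_map w (sg_vertex i)) - u (sg_word_map w (sg_vertex j)))\<^sup>2
      \<le> triple_energy (a (k + n)) (b (k + n)) (vertex_values (u \<circ> sg_word_map w))"
    using triple_energy_ge_edge[OF ab_pos(1) less_imp_le[OF ab_pos(2)] ij, of "k + n" "vertex_values (u \<circ> sg_word_map w)"]
    by (simp add: vertex_values_def)
  also have "\<dots> \<le> level k n u"
    unfolding level_def using w
    by (intro member_le_sum) (auto intro: triple_energy_nonneg less_imp_le ab_pos)
  finally show ?thesis .
qed

text \<open>
  As the energies increase with the level, this says that the limit energy is at most \<open>E\<close>.
\<close>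

definition bounded_energy :: "nat \<Rightarrow> (complex \<Rightarrow> real) \<Rightarrow> real \<Rightarrow> bool" where
  "bounded_energy k u E \<longleftrightarrow> (\<forall>n. level k n u \<le> E)"

lemma bounded_energy_Suc:
  assumes "\<And>i. i \<in> {1,2,3} \<Longrightarrow> bounded_energy (Suc k) (u \<circ> sg_map i) (E i)"
  shows "bounded_energy k u (E 1 + E 2 + E 3)"
  unfolding bounded_energy_def
proof
  fix n
  have "level k n u \<le> level k (Suc n) u" by (rule level_mono_Suc)
  also have "\<dots> \<le> (\<Sum>i\<in>{1,2,3}. E i)"
    unfolding level_Suc using assms by (intro sum_mono) (auto simp: bounded_energy_def)
  finally show "level k n u \<le> E 1 + E 2 + E 3" by (simp only: sum_three)
qed

subsection \<open>Energy controls oscillation\<close>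

text \<open>
  An edge of level \<open>n\<close> on which \<open>u\<close> changes by \<open>t\<close> contributes at least \<open>b n * t\<^sup>2\<close> to the energy \<open>E\<close>, so
  \<open>t\<close> is at most \<open>osc n * sqrt E\<close>.
\<close>

definition osc :: "nat \<Rightarrow> real" where
  "osc n = 1 / sqrt (b n)"

lemma osc_pos: "0 < osc n"
  using ab_pos(1)[of n] by (simp add: osc_def)

lemma square_le_osc:
  assumes "b n * t\<^sup>2 \<le> E"
  shows "\<bar>t\<bar> \<le> osc n * sqrt E"
proof -
  have "t\<^sup>2 \<le> E / b n" using assms ab_pos(1)[of n] by (simp add: field_simps)
  then have "sqrt (t\<^sup>2) \<le> sqrt (E / b n)" by (rule real_sqrt_le_mono)
  then show ?thesis by (simp add: osc_def real_sqrt_divide)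
qed

text \<open>
  The conductances \<open>b n\<close> grow at least like \<open>(3/2) ^ n\<close>, so the numbers \<open>osc n\<close> are dominated by a
  geometric series.
\<close>

lemma osc_sum_bounded: "\<exists>C\<ge>0. \<forall>k n. (\<Sum>m<n. osc (k + m)) \<le> C"
proof -
  obtain C where C: "0 < C" "\<And>n. inverse C * (3/2) ^ n \<le> b n"
    using growth unfolding comparable_def by blast
  define s where "s = sqrt (2/3 :: real)"
  have s: "0 < s" "s < 1" by (simp_all add: s_def)
  have le: "osc (k + m) \<le> sqrt C * s ^ m" for k m
  proof -
    have "inverse C * (3/2) ^ m \<le> inverse C * (3/2) ^ (k + m)"
      using C(1) by (intro mult_left_mono power_increasing) auto
    also have "\<dots> \<le> b (k + m)" by (rule C)
    finally have "inverse C * (3/2) ^ m \<le> b (k + m)" .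
    then have "1 / b (k + m) \<le> 1 / (inverse C * (3/2) ^ m)"
      using C(1) ab_pos(1) by (intro divide_left_mono) auto
    also have "\<dots> = C * (2/3) ^ m" using C(1) by (simp add: power_divide field_simps)
    finally have "sqrt (1 / b (k + m)) \<le> sqrt (C * (2/3) ^ m)" by (rule real_sqrt_le_mono)
    then show ?thesis by (simp add: osc_def s_def real_sqrt_divide real_sqrt_mult real_sqrt_power)
  qed
  have sm: "summable (\<lambda>m. sqrt C * s ^ m)" using s by (intro summable_mult summable_geometric) auto
  have "(\<Sum>m<n. osc (k + m)) \<le> (\<Sum>m. sqrt C * s ^ m)" for k n
  proof -
    have "(\<Sum>m<n. osc (k + m)) \<le> (\<Sum>m<n. sqrt C * s ^ m)" by (intro sum_mono le)
    also have "\<dots> \<le> (\<Sum>m. sqrt C * s ^ m)" using s C(1) by (intro sum_le_suminf[OF sm]) auto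
    finally show ?thesis .
  qed
  moreover have "0 \<le> (\<Sum>m. sqrt C * s ^ m)" using s C(1) by (intro suminf_nonneg[OF sm]) auto
  ultimately show ?thesis by blast
qed

text \<open>
  Follow the cells that contain \<open>x\<close>.  The first corners of a cell and of its \<open>i\<close>-th subcell are joined
  by an edge of each of the two levels, through the common \<open>i\<close>-th corner.
\<close>

lemma chain_of_cells:
  assumes E: "bounded_energy k u E" and x: "x \<in> gasket"
  shows "\<exists>w\<in>sg_words n. \<exists>y\<in>gasket. x = sg_word_map w y \<and>
    \<bar>u (sg_word_map w (sg_vertex 1)) - u (sg_vertex 1)\<bar> \<le> (\<Sum>m<n. (osc (k + m) + osc (Suc k + m)) * sqrt E)"
proof (induction n)
  case 0
  show ?case using x by (intro bexI[of _ "[]"] bexI[of _ x]) auto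
next
  case (Suc n)
  then obtain w y where w: "w \<in> sg_words n" "y \<in> gasket" "x = sg_word_map w y"
    and le: "\<bar>u (sg_word_map w (sg_vertex 1)) - u (sg_vertex 1)\<bar> \<le> (\<Sum>m<n. (osc (k + m) + osc (Suc k + m)) * sqrt E)"
    by blast
  obtain i z where i: "i \<in> {1,2,3}" "z \<in> gasket" "y = sg_map i z" using w(2) by (rule gasket_cases)
  have w': "w @ [i] \<in> sg_words (Suc n)"
    using w(1) i(1) by (auto simp: sg_words_def)
  have m: "sg_word_map (w @ [i]) p = sg_word_map w (sg_map i p)" for p by (simp add: sg_word_map_append)
  have "b (k + n) * (u (sg_word_map w (sg_vertex i)) - u (sg_word_map w (sg_vertex 1)))\<^sup>2 \<le> E"
    using edge_le_level[OF w(1) i(1), of 1 k u] E by (fastforce simp: bounded_energy_def intro: order_trans)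
  then have 1: "\<bar>u (sg_word_map w (sg_vertex i)) - u (sg_word_map w (sg_vertex 1))\<bar> \<le> osc (k + n) * sqrt E"
    by (rule square_le_osc)
  have "b (k + Suc n) * (u (sg_word_map (w @ [i]) (sg_vertex 1)) - u (sg_word_map (w @ [i]) (sg_vertex i)))\<^sup>2 \<le> E"
    using edge_le_level[OF w' _ i(1), of 1 k u] E by (fastforce simp: bounded_energy_def intro: order_trans)
  then have 2: "\<bar>u (sg_word_map (w @ [i]) (sg_vertex 1)) - u (sg_word_map (w @ [i]) (sg_vertex i))\<bar> \<le> osc (k + Suc n) * sqrt E"
    by (rule square_le_osc)
  have 3: "sg_word_map (w @ [i]) (sg_vertex i) = sg_word_map w (sg_vertex i)" by (simp add: m sg_map_vertex)
  have "\<bar>u (sg_word_map (w @ [i]) (sg_vertex 1)) - u (sg_vertex 1)\<bar>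
      \<le> (\<Sum>m<Suc n. (osc (k + m) + osc (Suc k + m)) * sqrt E)"
    using le 1 2 unfolding 3 by (simp add: distrib_right)
  then show ?case using w' i w(3) m by (intro bexI[of _ "w @ [i]"] bexI[of _ z]) auto
qed

text \<open>
  The first corners of the cells around \<open>x\<close> converge to \<open>x\<close>, and \<open>u\<close> is continuous there.  The
  constant depends neither on \<open>u\<close> nor on \<open>k\<close>.
\<close>

lemma oscillation_bound:
  "\<exists>C\<ge>0. \<forall>k u E x. continuous_on gasket u \<longrightarrow> bounded_energy k u E \<longrightarrow> x \<in> gasket \<longrightarrow>
     \<bar>u x - u (sg_vertex 1)\<bar> \<le> C * sqrt E"
proof -
  obtain C where C: "0 \<le> C" "\<And>k n. (\<Sum>m<n. osc (k + m)) \<le> C" using osc_sum_bounded by blast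
  have "\<bar>u x - u (sg_vertex 1)\<bar> \<le> 2 * C * sqrt E"
    if u: "continuous_on gasket u" and E: "bounded_energy k u E" and x: "x \<in> gasket" for k u E x
  proof -
    have E0: "0 \<le> E" using E level_nonneg[of k 0 u] order_trans unfolding bounded_energy_def by blast
    have "\<forall>n. \<exists>w. w \<in> sg_words n \<and> x \<in> sg_cell w \<and>
      \<bar>u (sg_word_map w (sg_vertex 1)) - u (sg_vertex 1)\<bar> \<le> (\<Sum>m<n. (osc (k + m) + osc (Suc k + m)) * sqrt E)"
      using chain_of_cells[OF E x] by blast
    then obtain w where w: "\<And>n. w n \<in> sg_words n" "\<And>n. x \<in> sg_cell (w n)"
      and le: "\<And>n. \<bar>u (sg_word_map (w n) (sg_vertex 1)) - u (sg_vertex 1)\<bar> \<le> (\<Sum>m<n. (osc (k + m) + osc (Suc k + m)) * sqrt E)"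
      by metis
    define y where "y n = sg_word_map (w n) (sg_vertex 1)" for n
    have yK: "y n \<in> gasket" for n unfolding y_def by (rule sg_word_map_gasket[OF w(1)]) (simp add: sg_vertex_gasket)
    have "dist (y n) x \<le> diameter gasket * (1/2) ^ n" for n
    proof -
      have "y n \<in> sg_cell (w n)" unfolding y_def by (intro imageI sg_vertex_gasket) auto
      then have "dist (y n) x \<le> diameter (sg_cell (w n))"
        by (rule diameter_bounded_bound[OF diameter_sg_cell(1)[OF w(1)] _ w(2)])
      also have "\<dots> \<le> diameter gasket * (1/2) ^ n" by (rule diameter_sg_cell(2)[OF w(1)])
      finally show ?thesis .
    qed
    moreover have "(\<lambda>n. diameter gasket * (1/2) ^ n) \<longlonglongrightarrow> diameter gasket * 0"
      by (intro tendsto_intros) auto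
    ultimately have "(\<lambda>n. dist (y n) x) \<longlonglongrightarrow> 0"
      by (intro Lim_null_comparison[of "\<lambda>n. dist (y n) x" "\<lambda>n. diameter gasket * (1/2) ^ n"]) auto
    then have "y \<longlonglongrightarrow> x" by (rule iffD2[OF tendsto_dist_iff])
    then have "(\<lambda>n. u (y n)) \<longlonglongrightarrow> u x"
      by (rule continuous_on_tendsto_compose[OF u _ x]) (simp add: yK)
    then have lim: "(\<lambda>n. \<bar>u (y n) - u (sg_vertex 1)\<bar>) \<longlonglongrightarrow> \<bar>u x - u (sg_vertex 1)\<bar>"
      by (intro tendsto_intros)
    have "\<bar>u (y n) - u (sg_vertex 1)\<bar> \<le> 2 * C * sqrt E" for n
    proof -
      have "\<bar>u (y n) - u (sg_vertex 1)\<bar> \<le> (\<Sum>m<n. (osc (k + m) + osc (Suc k + m)) * sqrt E)"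
        unfolding y_def by (rule le)
      also have "\<dots> = ((\<Sum>m<n. osc (k + m)) + (\<Sum>m<n. osc (Suc k + m))) * sqrt E"
        by (simp only: sum_distrib_right[symmetric] sum.distrib)
      also have "\<dots> \<le> (C + C) * sqrt E" using E0 by (intro mult_right_mono add_mono C(2)) auto
      finally show ?thesis by simp
    qed
    then show ?thesis using LIMSEQ_le_const2[OF lim] by blast
  qed
  then show ?thesis using C(1) by (intro exI[of _ "2 * C"]) auto
qed

subsection \<open>Harmonic functions\<close>

abbreviation hstep :: "nat \<Rightarrow> (nat \<Rightarrow> real) \<Rightarrow> nat \<Rightarrow> nat \<Rightarrow> real" where
  "hstep k v \<equiv> harmonic_step (a (Suc k)) (b (Suc k)) v"

text \<open>
  Subdivide \<open>m\<close> times with harmonic midpoint values and interpolate affinely inside the resulting cells.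
\<close>

primrec happrox :: "nat \<Rightarrow> nat \<Rightarrow> (nat \<Rightarrow> real) \<Rightarrow> complex \<Rightarrow> real" where
  "happrox 0 k v = (\<lambda>z. \<Sum>i\<in>{1,2,3}. bary i z * v i)"
| "happrox (Suc m) k v = glue (\<lambda>i. happrox m (Suc k) (hstep k v i))"

lemma hstep_energy_sum:
  "(\<Sum>i\<in>{1,2,3}. triple_energy (a (Suc k)) (b (Suc k)) (hstep k v i)) = triple_energy (a k) (b k) v"
  using harmonic_energy_value[OF ab_pos(3) ab_pos(1) renormalization] by (simp only: sum_three)

lemma hstep_energy_le:
  assumes "i \<in> {1,2,3}"
  shows "triple_energy (a (Suc k)) (b (Suc k)) (hstep k v i) \<le> triple_energy (a k) (b k) v"
  unfolding hstep_energy_sum[of k v, symmetric] using assms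
  by (intro member_le_sum triple_energy_nonneg less_imp_le ab_pos) auto

lemma hstep_bounds:
  assumes "\<And>i. i \<in> {1,2,3} \<Longrightarrow> l \<le> v i \<and> v i \<le> u" "i \<in> {1,2,3}"
  shows "l \<le> hstep k v i j \<and> hstep k v i j \<le> u"
  by (rule harmonic_step_bounds[OF ab_pos(3) ab_pos(1) assms])

lemma happrox_vertex: "j \<in> {1,2,3} \<Longrightarrow> happrox m k v (sg_vertex j) = v j"
  and gluable_happrox: "gluable (\<lambda>i. happrox m k (hstep n v i))"
proof (induction m arbitrary: k v j n)
  case 0
  have *: "happrox 0 k v (sg_vertex j) = v j" if j: "j \<in> {1,2,3}" for k v j
    using that by (elim three_cases) (auto simp: sum_three bary_vertex simp del: One_nat_def sum.insert)
  { case 1 then show ?case by (rule *) }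
  { case 2 show ?case unfolding gluable_def using * harmonic_step_sym by metis }
next
  case (Suc m)
  have *: "happrox (Suc m) k v (sg_vertex j) = v j" if j: "j \<in> {1,2,3}" for k v j
  proof -
    have "happrox (Suc m) k v (sg_map j (sg_vertex j)) = happrox m (Suc k) (hstep k v j) (sg_vertex j)"
      unfolding happrox.simps by (rule glue_sg_map[OF Suc.IH(2) j sg_vertex_gasket[OF j]])
    then show ?thesis using Suc.IH(1)[OF j] by (simp add: sg_map_vertex)
  qed
  { case 1 then show ?case by (rule *) }
  { case 2 show ?case unfolding gluable_def using * harmonic_step_sym by metis }
qed

lemma happrox_sg_map:
  "i \<in> {1,2,3} \<Longrightarrow> x \<in> gasket \<Longrightarrow> happrox (Suc m) k v (sg_map i x) = happrox m (Suc k) (hstep k v i) x"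
  unfolding happrox.simps by (rule glue_sg_map[OF gluable_happrox])

lemma continuous_on_happrox: "continuous_on gasket (happrox m k v)"
proof (induction m arbitrary: k v)
  case 0
  show ?case unfolding happrox.simps by (intro continuous_intros continuous_on_bary)
next
  case (Suc m)
  show ?case unfolding happrox.simps by (intro continuous_on_glue gluable_happrox Suc.IH)
qed

lemma happrox_bounds:
  assumes "\<And>i. i \<in> {1,2,3} \<Longrightarrow> l \<le> v i \<and> v i \<le> u" "x \<in> gasket"
  shows "l \<le> happrox m k v x \<and> happrox m k v x \<le> u"
  using assms
proof (induction m arbitrary: k v x)
  case 0
  have s: "(\<Sum>i\<in>{1,2,3}. bary i x) = 1" using bary_sum[of x] by (simp only: sum_three)
  have nn: "0 \<le> bary i x" if "i \<in> {1,2,3}" for i using bary_gasket[OF 0(2) that] .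
  have "(\<Sum>i\<in>{1,2,3}. bary i x * l) \<le> (\<Sum>i\<in>{1,2,3}. bary i x * v i)"
    "(\<Sum>i\<in>{1,2,3}. bary i x * v i) \<le> (\<Sum>i\<in>{1,2,3}. bary i x * u)"
    using 0(1) nn by (intro sum_mono mult_left_mono; blast)+
  then show ?case unfolding happrox.simps sum_distrib_right[symmetric] s by simp
next
  case (Suc m)
  obtain i y where i: "i \<in> {1,2,3}" "y \<in> gasket" "x = sg_map i y" using Suc.prems(2) by (rule gasket_cases)
  have "l \<le> happrox m (Suc k) (hstep k v i) y \<and> happrox m (Suc k) (hstep k v i) y \<le> u"
    using hstep_bounds[OF Suc.prems(1) i(1)] i(2) by (intro Suc.IH) auto
  then show ?case unfolding i(3) happrox_sg_map[OF i(1,2)] .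
qed

lemma happrox_near_vertex_value:
  assumes i: "i \<in> {1,2,3}" and x: "x \<in> gasket"
  shows "\<bar>happrox m k v x - v i\<bar> \<le> osc k * sqrt (triple_energy (a k) (b k) v)"
proof -
  let ?d = "osc k * sqrt (triple_energy (a k) (b k) v)"
  have "\<bar>v j - v i\<bar> \<le> ?d" if "j \<in> {1,2,3}" for j
    by (rule square_le_osc, rule triple_energy_ge_edge[OF ab_pos(1) less_imp_le[OF ab_pos(2)] that i])
  then have "v i - ?d \<le> v j \<and> v j \<le> v i + ?d" if "j \<in> {1,2,3}" for j
    using that by (simp add: abs_le_iff) (smt (verit))
  from happrox_bounds[OF this x] have "v i - ?d \<le> happrox m k v x \<and> happrox m k v x \<le> v i + ?d" .
  then show ?thesis by linarith
qed

text \<open>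
  Approximants \<open>m\<close> and \<open>m + 1\<close> agree at a common corner of a cell of level \<open>m\<close> and of its subcell, and each
  varies little around it because the energy of a single cell never exceeds the initial one.
\<close>

lemma happrox_increment:
  assumes "x \<in> gasket"
  shows "\<bar>happrox (Suc m) k v x - happrox m k v x\<bar>
    \<le> (osc (k + m) + osc (Suc k + m)) * sqrt (triple_energy (a k) (b k) v)"
  using assms
proof (induction m arbitrary: k v x)
  case 0
  obtain i y where i: "i \<in> {1,2,3}" "y \<in> gasket" "x = sg_map i y" using 0 by (rule gasket_cases)
  have 1: "\<bar>happrox 0 k v x - v i\<bar> \<le> osc k * sqrt (triple_energy (a k) (b k) v)"
    by (rule happrox_near_vertex_value[OF i(1) 0])
  have "\<bar>happrox 0 (Suc k) (hstep k v i) y - hstep k v i i\<bar>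
      \<le> osc (Suc k) * sqrt (triple_energy (a (Suc k)) (b (Suc k)) (hstep k v i))"
    by (rule happrox_near_vertex_value[OF i(1,2)])
  also have "\<dots> \<le> osc (Suc k) * sqrt (triple_energy (a k) (b k) v)"
    using osc_pos[of "Suc k"] hstep_energy_le[OF i(1)] by (intro mult_left_mono real_sqrt_le_mono) auto
  finally have 2: "\<bar>happrox (Suc 0) k v x - v i\<bar> \<le> osc (Suc k) * sqrt (triple_energy (a k) (b k) v)"
    unfolding i(3) happrox_sg_map[OF i(1,2)] by simp
  show ?case using 1 2 unfolding distrib_right add_0_right by linarith
next
  case (Suc m)
  obtain i y where i: "i \<in> {1,2,3}" "y \<in> gasket" "x = sg_map i y" using Suc.prems by (rule gasket_cases)
  have "\<bar>happrox (Suc m) (Suc k) (hstep k v i) y - happrox m (Suc k) (hstep k v i) y\<bar>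
     \<le> (osc (Suc k + m) + osc (Suc (Suc k) + m)) * sqrt (triple_energy (a (Suc k)) (b (Suc k)) (hstep k v i))"
    by (rule Suc.IH[OF i(2)])
  also have "\<dots> \<le> (osc (Suc k + m) + osc (Suc (Suc k) + m)) * sqrt (triple_energy (a k) (b k) v)"
    using less_imp_le[OF osc_pos] hstep_energy_le[OF i(1)] by (intro mult_left_mono real_sqrt_le_mono add_nonneg_nonneg) auto
  finally show ?case unfolding i(3) happrox_sg_map[OF i(1,2)] by simp
qed

definition harmonic :: "nat \<Rightarrow> (nat \<Rightarrow> real) \<Rightarrow> complex \<Rightarrow> real" where
  "harmonic k v x = lim (\<lambda>m. happrox m k v x)"

text \<open>
  The increments are dominated by the summable numbers of the oscillation estimate, so the Weierstrass
  test applies.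
\<close>

lemma uniform_limit_harmonic: "uniform_limit gasket (\<lambda>m. happrox m k v) (harmonic k v) sequentially"
proof -
  let ?E = "sqrt (triple_energy (a k) (b k) v)"
  obtain C where C: "0 \<le> C" "\<And>k n. (\<Sum>m<n. osc (k + m)) \<le> C" using osc_sum_bounded by blast
  have "summable (\<lambda>m. osc (k + m))" for k
    using less_imp_le[OF osc_pos] by (rule summableI_nonneg_bounded) (rule C(2))
  then have sm: "summable (\<lambda>m. (osc (k + m) + osc (Suc k + m)) * ?E)"
    by (intro summable_mult2 summable_add)
  have "uniformly_convergent_on gasket (\<lambda>n x. \<Sum>m<n. happrox (Suc m) k v x - happrox m k v x)"
    by (rule Weierstrass_m_test'_ev[OF _ sm]) (use happrox_increment in \<open>auto simp del: happrox.simps\<close>)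
  then obtain g where g: "uniform_limit gasket (\<lambda>n x. \<Sum>m<n. happrox (Suc m) k v x - happrox m k v x) g sequentially"
    by (auto simp: uniformly_convergent_on_def)
  have "uniform_limit gasket (\<lambda>n x. happrox 0 k v x + (\<Sum>m<n. happrox (Suc m) k v x - happrox m k v x))
      (\<lambda>x. happrox 0 k v x + g x) sequentially"
    by (intro uniform_limit_intros g)
  moreover have "happrox 0 k v x + (\<Sum>m<n. happrox (Suc m) k v x - happrox m k v x) = happrox n k v x" for n x
    using sum_lessThan_telescope[of "\<lambda>m. happrox m k v x" n] by (simp del: happrox.simps)
  ultimately have h: "uniform_limit gasket (\<lambda>m. happrox m k v) (\<lambda>x. happrox 0 k v x + g x) sequentially"
    by (simp only: eta_contract_eq)
  have "harmonic k v x = happrox 0 k v x + g x" if "x \<in> gasket" for x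
    unfolding harmonic_def by (intro limI tendsto_uniform_limitI[OF h that])
  then show ?thesis
    using h uniform_limit_cong'[of gasket "\<lambda>m. happrox m k v" "\<lambda>m. happrox m k v" "harmonic k v" "\<lambda>x. happrox 0 k v x + g x" sequentially]
    by simp
qed

lemma happrox_tendsto: "x \<in> gasket \<Longrightarrow> (\<lambda>m. happrox m k v x) \<longlonglongrightarrow> harmonic k v x"
  by (rule tendsto_uniform_limitI[OF uniform_limit_harmonic])

lemma continuous_on_harmonic: "continuous_on gasket (harmonic k v)"
  by (rule uniform_limit_theorem[OF _ uniform_limit_harmonic]) (auto simp: continuous_on_happrox)

lemma harmonic_vertex: "j \<in> {1,2,3} \<Longrightarrow> harmonic k v (sg_vertex j) = v j"
  using LIMSEQ_unique[OF happrox_tendsto[OF sg_vertex_gasket]] by (simp add: happrox_vertex)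

lemma harmonic_sg_map:
  assumes "i \<in> {1,2,3}" "x \<in> gasket"
  shows "harmonic k v (sg_map i x) = harmonic (Suc k) (hstep k v i) x"
proof (rule LIMSEQ_unique)
  show "(\<lambda>m. happrox (Suc m) k v (sg_map i x)) \<longlonglongrightarrow> harmonic k v (sg_map i x)"
    by (intro LIMSEQ_Suc happrox_tendsto sg_map_gasket assms)
  show "(\<lambda>m. happrox (Suc m) k v (sg_map i x)) \<longlonglongrightarrow> harmonic (Suc k) (hstep k v i) x"
    unfolding happrox_sg_map[OF assms] by (intro happrox_tendsto assms)
qed

lemma harmonic_bounds:
  assumes "\<And>i. i \<in> {1,2,3} \<Longrightarrow> l \<le> v i \<and> v i \<le> u" "x \<in> gasket"
  shows "l \<le> harmonic k v x \<and> harmonic k v x \<le> u"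
proof -
  have "l \<le> happrox m k v x \<and> happrox m k v x \<le> u" for m
    by (rule happrox_bounds[where v = v and l = l and u = u, OF assms])
  then show ?thesis
    using LIMSEQ_le_const[OF happrox_tendsto[OF assms(2)]] LIMSEQ_le_const2[OF happrox_tendsto[OF assms(2)]] by blast
qed

text \<open>
  Restricted to a first-level cell, a harmonic function is again harmonic, for the conductances that start
  one level later; its energy is preserved under each subdivision.
\<close>

lemma level_harmonic: "level k n (harmonic k v) = triple_energy (a k) (b k) v"
proof (induction n arbitrary: k v)
  case 0
  show ?case by (simp add: level_0 triple_energy_def vertex_values_def harmonic_vertex del: One_nat_def)
next
  case (Suc n)
  have "level k (Suc n) (harmonic k v) = (\<Sum>i\<in>{1,2,3}. level (Suc k) n (harmonic (Suc k) (hstep k v i)))"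
    unfolding level_Suc by (intro sum.cong refl level_cong) (simp add: harmonic_sg_map)
  then show ?case unfolding Suc.IH hstep_energy_sum .
qed

text \<open>
  If \<open>f\<close> varies by at most \<open>e\<close> on each cell of level \<open>n\<close>, then the function with the values of \<open>f\<close> at the
  corners of these cells that is harmonic inside them is \<open>e\<close>-close to \<open>f\<close> by the maximum principle.
\<close>

lemma piecewise_harmonic_approximation:
  assumes "\<And>w x y. w \<in> sg_words n \<Longrightarrow> x \<in> gasket \<Longrightarrow> y \<in> gasket \<Longrightarrow> \<bar>f (sg_word_map w x) - f (sg_word_map w y)\<bar> \<le> e"
  shows "\<exists>u E. continuous_on gasket u \<and> bounded_energy k u E \<and> (\<forall>x\<in>gasket. \<bar>u x - f x\<bar> \<le> e) \<and>
    (\<forall>j\<in>{1,2,3}. u (sg_vertex j) = f (sg_vertex j))"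
  using assms
proof (induction n arbitrary: k f)
  case 0
  let ?v = "vertex_values f"
  have "\<bar>harmonic k ?v x - f x\<bar> \<le> e" if x: "x \<in> gasket" for x
  proof -
    have "f x - e \<le> ?v i \<and> ?v i \<le> f x + e" if "i \<in> {1,2,3}" for i
      using 0[of "[]" "sg_vertex i" x] x sg_vertex_gasket[OF that] by (simp add: vertex_values_def abs_le_iff)
    from harmonic_bounds[OF this x] have "f x - e \<le> harmonic k ?v x \<and> harmonic k ?v x \<le> f x + e" .
    then show ?thesis by linarith
  qed
  then show ?case
    by (intro exI[of _ "harmonic k ?v"] exI[of _ "triple_energy (a k) (b k) ?v"])
       (auto simp: continuous_on_harmonic bounded_energy_def level_harmonic harmonic_vertex vertex_values_def simp del: One_nat_def)
next
  case (Suc n)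
  define P where "P i u E \<longleftrightarrow> continuous_on gasket u \<and> bounded_energy (Suc k) u E \<and>
    (\<forall>x\<in>gasket. \<bar>u x - f (sg_map i x)\<bar> \<le> e) \<and> (\<forall>j\<in>{1,2,3}. u (sg_vertex j) = f (sg_map i (sg_vertex j)))"
    for i u E
  have "\<exists>u E. P i u E" if i: "i \<in> {1,2,3}" for i
  proof -
    have "\<bar>(f \<circ> sg_map i) (sg_word_map w x) - (f \<circ> sg_map i) (sg_word_map w y)\<bar> \<le> e"
      if "w \<in> sg_words n" "x \<in> gasket" "y \<in> gasket" for w x y
      using Suc.prems[of "i # w" x y] that i by (auto simp: sg_words_Suc)
    then show ?thesis using Suc.IH[of "f \<circ> sg_map i" "Suc k"] unfolding P_def by simp
  qed
  then obtain u E where P: "\<And>i. i \<in> {1,2,3} \<Longrightarrow> P i (u i) (E i)" by metis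
  have u: "\<And>i. i \<in> {1,2,3} \<Longrightarrow> continuous_on gasket (u i)"
    "\<And>i. i \<in> {1,2,3} \<Longrightarrow> bounded_energy (Suc k) (u i) (E i)"
    "\<And>i x. i \<in> {1,2,3} \<Longrightarrow> x \<in> gasket \<Longrightarrow> \<bar>u i x - f (sg_map i x)\<bar> \<le> e"
    "\<And>i j. i \<in> {1,2,3} \<Longrightarrow> j \<in> {1,2,3} \<Longrightarrow> u i (sg_vertex j) = f (sg_map i (sg_vertex j))"
    using P unfolding P_def by blast+
  have gl: "gluable u" unfolding gluable_def using u(4) sg_map_vertex_commute by simp
  have cont: "continuous_on gasket (glue u)" by (rule continuous_on_glue[OF gl u(1)])
  have en: "bounded_energy k (glue u) (E 1 + E 2 + E 3)"
  proof (rule bounded_energy_Suc)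
    fix i :: nat assume i: "i \<in> {1,2,3}"
    have "level (Suc k) n (glue u \<circ> sg_map i) = level (Suc k) n (u i)" for n
      by (rule level_cong) (simp add: glue_sg_map[OF gl i])
    then show "bounded_energy (Suc k) (glue u \<circ> sg_map i) (E i)" using u(2)[OF i] by (simp add: bounded_energy_def)
  qed
  have near: "\<bar>glue u x - f x\<bar> \<le> e" if x: "x \<in> gasket" for x
  proof -
    obtain i y where i: "i \<in> {1,2,3}" "y \<in> gasket" "x = sg_map i y" using x by (rule gasket_cases)
    show ?thesis unfolding i(3) glue_sg_map[OF gl i(1,2)] by (rule u(3)[OF i(1,2)])
  qed
  have vert: "glue u (sg_vertex j) = f (sg_vertex j)" if j: "j \<in> {1,2,3}" for j
    using glue_sg_map[OF gl j sg_vertex_gasket[OF j]] u(4)[OF j j] by (simp only: sg_map_vertex)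
  show ?case using cont en near vert by (intro exI[of _ "glue u"] exI[of _ "E 1 + E 2 + E 3"]) blast
qed

lemma uniform_approximation:
  assumes f: "continuous_on gasket f" and e: "0 < e"
  shows "\<exists>u E. continuous_on gasket u \<and> bounded_energy k u E \<and> (\<forall>x\<in>gasket. \<bar>u x - f x\<bar> \<le> e)"
proof -
  have "uniformly_continuous_on gasket f" by (rule compact_uniformly_continuous[OF f compact_gasket])
  then obtain d where d: "0 < d" "\<And>x y. x \<in> gasket \<Longrightarrow> y \<in> gasket \<Longrightarrow> dist y x < d \<Longrightarrow> dist (f y) (f x) < e"
    unfolding uniformly_continuous_on_def using e by blast
  obtain n where n: "diameter gasket * (1/2) ^ n < d" using small_cells[OF d(1)] by blast
  have "\<bar>f (sg_word_map w x) - f (sg_word_map w y)\<bar> \<le> e" if w: "w \<in> sg_words n" and xy: "x \<in> gasket" "y \<in> gasket" for w x y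
  proof -
    have "dist (sg_word_map w x) (sg_word_map w y) \<le> diameter (sg_cell w)"
      using xy by (intro diameter_bounded_bound diameter_sg_cell(1)[OF w]) auto
    also have "\<dots> < d" using diameter_sg_cell(2)[OF w] n by linarith
    finally show ?thesis
      using d(2)[OF sg_word_map_gasket[OF w xy(2)] sg_word_map_gasket[OF w xy(1)]] by (simp add: dist_real_def)
  qed
  then show ?thesis using piecewise_harmonic_approximation[of n f e k] by blast
qed

end

section \<open>The limit form\<close>

definition triple_form :: "real \<Rightarrow> real \<Rightarrow> (nat \<Rightarrow> real) \<Rightarrow> (nat \<Rightarrow> real) \<Rightarrow> real" where
  "triple_form \<alpha> \<beta> v w = \<beta> * ((v 1 - v 2) * (w 1 - w 2)) + \<beta> * ((v 1 - v 3) * (w 1 - w 3))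
     + \<alpha> * ((v 2 - v 3) * (w 2 - w 3))"

lemma triple_energy_mono_edges:
  assumes "0 \<le> \<alpha>" "0 \<le> \<beta>" "\<And>i j. i \<in> {1,2,3} \<Longrightarrow> j \<in> {1,2,3} \<Longrightarrow> \<bar>v i - v j\<bar> \<le> \<bar>w i - w j\<bar>"
  shows "triple_energy \<alpha> \<beta> v \<le> triple_energy \<alpha> \<beta> w"
  unfolding triple_energy_def using assms
  by (intro add_mono mult_left_mono) (simp_all add: abs_le_square_iff[symmetric])

lemma triple_energy_mono_coefficients:
  assumes "\<alpha>' \<le> C * \<alpha>" "\<beta>' \<le> C * \<beta>"
  shows "triple_energy \<alpha>' \<beta>' v \<le> C * triple_energy \<alpha> \<beta> v"
proof -
  have "triple_energy \<alpha>' \<beta>' v \<le> triple_energy (C * \<alpha>) (C * \<beta>) v"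
    unfolding triple_energy_def using assms by (intro add_mono mult_right_mono) auto
  also have "\<dots> = C * triple_energy \<alpha> \<beta> v" by (simp add: triple_energy_def algebra_simps)
  finally show ?thesis .
qed

lemma comparable_le:
  assumes "comparable f g" "comparable f' g"
  shows "\<exists>C\<ge>0. \<forall>n. f n \<le> C * f' n"
proof -
  obtain A where A: "0 < A" "\<And>n. f n \<le> A * g n" using assms(1) unfolding comparable_def by blast
  obtain B where B: "0 < B" "\<And>n. inverse B * g n \<le> f' n" using assms(2) unfolding comparable_def by blast
  have "f n \<le> A * B * f' n" for n
  proof -
    have "g n \<le> B * f' n" using B(2)[of n] B(1) by (simp add: field_simps)
    then have "A * g n \<le> A * (B * f' n)" using A(1) by (intro mult_left_mono) auto
    with A(2)[of n] show ?thesis by (simp add: mult.assoc)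
  qed
  then show ?thesis using A(1) B(1) by (intro exI[of _ "A * B"]) auto
qed

lemma comparable_Suc:
  assumes "comparable f (\<lambda>n. q ^ n)" "0 < q"
  shows "comparable (\<lambda>n. f (Suc n)) (\<lambda>n. q ^ n)"
proof -
  obtain A where A: "0 < A" "\<And>n. inverse A * q ^ n \<le> f n" "\<And>n. f n \<le> A * q ^ n"
    using assms(1) unfolding comparable_def by blast
  show ?thesis
    by (rule comparableI[of "inverse A * q" _ _ "A * q"])
       (use A(1) assms(2) A(2)[of "Suc _"] A(3)[of "Suc _"] in \<open>auto simp: mult.assoc\<close>)
qed

text \<open>
  The set where a continuous function does not vanish is relatively open, and nonempty relatively open sets
  have positive measure.  Hence almost everywhere statements about continuous functions hold everywhere.
\<close>

lemma AE_zero_on_open_imp: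
  assumes g: "continuous_on gasket g" and U: "open U" and ae: "AE y in gasket_measure. y \<in> U \<longrightarrow> g y = (0::real)"
    and x: "x \<in> gasket" "x \<in> U"
  shows "g x = 0"
proof (rule ccontr)
  assume nz: "g x \<noteq> 0"
  have "open (- {0::real})" by (rule open_Compl) simp
  then obtain V where V: "open V" "V \<inter> gasket = g -` (- {0}) \<inter> gasket"
    using g unfolding continuous_on_open_invariant by metis
  have "(U \<inter> V) \<inter> gasket \<noteq> {}" using x nz V(2) by blast
  then have "0 < emeasure gasket_measure ((U \<inter> V) \<inter> gasket)"
    using radon_full_support_gasket U V(1) unfolding radon_full_support_def by blast
  moreover have "emeasure gasket_measure ((U \<inter> V) \<inter> gasket) = 0"
  proof -
    have "AE y in gasket_measure. y \<notin> (U \<inter> V) \<inter> gasket"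
      using ae by (rule AE_mp) (use V(2) in auto)
    moreover have "(U \<inter> V) \<inter> gasket \<in> sets gasket_measure"
    proof -
      have "(U \<inter> V) \<inter> gasket \<in> sets borel"
        by (intro sets.Int borel_open U V(1) gasket_borel)
      then show ?thesis unfolding sets_gasket_measure by (simp add: sets_restrict_space_iff)
    qed
    ultimately have "(U \<inter> V) \<inter> gasket \<in> null_sets gasket_measure" by (rule iffD2[OF AE_iff_null_sets, rotated])
    then show ?thesis by (rule null_setsD1)
  qed
  ultimately show False by simp
qed

lemmas gasket_continuous_measurable =
  continuous_measurable[OF compact_gasket space_gasket_measure sets_gasket_measure gasket_measure.finite_measure_axioms]

lemma measure_gasket: "measure gasket_measure gasket = 1"
  by (simp add: measure_def emeasure_gasket_measure_gasket)

lemma integrable_continuous_square: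
  fixes u :: "complex \<Rightarrow> real"
  assumes "continuous_on gasket u"
  shows "integrable gasket_measure (\<lambda>x. (u x)\<^sup>2)"
proof -
  have "compact ((\<lambda>x. (u x)\<^sup>2) ` gasket)"
    by (intro compact_continuous_image continuous_intros assms compact_gasket)
  then obtain B where B: "\<And>x. x \<in> gasket \<Longrightarrow> norm ((u x)\<^sup>2) \<le> B"
    by (meson bounded_iff compact_imp_bounded image_eqI)
  show ?thesis
    by (rule gasket_measure.integrable_const_bound[of _ B])
       (use B gasket_continuous_measurable[OF assms] in \<open>auto simp: space_gasket_measure intro!: AE_I2\<close>)
qed

lemma continuous_square_integrable: "continuous_on gasket u \<Longrightarrow> u \<in> square_integrable gasket_measure"
  by (simp add: square_integrable_def integrable_continuous_square gasket_continuous_measurable)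

lemma integral_square_le:
  fixes u :: "complex \<Rightarrow> real"
  assumes u: "continuous_on gasket u" and le: "\<And>x. x \<in> gasket \<Longrightarrow> (u x)\<^sup>2 \<le> B"
  shows "(\<integral>x. (u x)\<^sup>2 \<partial>gasket_measure) \<le> B"
proof -
  have "(\<integral>x. (u x)\<^sup>2 \<partial>gasket_measure) \<le> (\<integral>x. B \<partial>gasket_measure)"
    by (intro integral_mono integrable_continuous_square u) (use le in \<open>auto simp: space_gasket_measure\<close>)
  then show ?thesis by (simp add: space_gasket_measure measure_gasket)
qed

locale gasket_conductances = gasket_energy +
  assumes conductances: "conductances (a k) (b k) n = (a (k + n), b (k + n), b (k + n))"
    and ratio_increasing: "a n / b n < a (Suc n) / b (Suc n)"
    and growth_a: "comparable a (\<lambda>n. 2 ^ n)"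
begin

abbreviation dom :: "nat \<Rightarrow> (complex \<Rightarrow> real) set" where "dom k \<equiv> energy_domain (a k) (b k)"

abbreviation form :: "nat \<Rightarrow> (complex \<Rightarrow> real) \<Rightarrow> (complex \<Rightarrow> real) \<Rightarrow> real" where
  "form k \<equiv> energy_form (a k) (b k)"

definition en :: "nat \<Rightarrow> (complex \<Rightarrow> real) \<Rightarrow> real" where "en k u = enn2real (energy (a k) (b k) u)"

lemma energy_level_eq: "energy_level (a k) (b k) n u = level k n u"
  by (simp add: energy_level_def conductances level_def triple_energy_def vertex_values_def Let_def)

lemma energy_eq_SUP: "energy (a k) (b k) u = (SUP n. ennreal (level k n u))"
  and energy_tendsto: "(\<lambda>n. ennreal (energy_level (a k) (b k) n u)) \<longlonglongrightarrow> energy (a k) (b k) u"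
proof -
  have "(\<lambda>n. ennreal (level k n u)) \<longlonglongrightarrow> (SUP n. ennreal (level k n u))"
    by (intro LIMSEQ_SUP incseq_SucI ennreal_leI level_mono_Suc)
  then show "energy (a k) (b k) u = (SUP n. ennreal (level k n u))"
    and "(\<lambda>n. ennreal (energy_level (a k) (b k) n u)) \<longlonglongrightarrow> energy (a k) (b k) u"
    by (simp_all add: energy_def energy_level_eq limI)
qed

lemma level_le_energy: "ennreal (level k n u) \<le> energy (a k) (b k) u"
  unfolding energy_eq_SUP by (rule SUP_upper) simp

lemma energy_le: "bounded_energy k u E \<Longrightarrow> energy (a k) (b k) u \<le> ennreal E"
  unfolding energy_eq_SUP bounded_energy_def by (intro SUP_least ennreal_leI) simp

lemma energy_cong:
  assumes "\<And>x. x \<in> gasket \<Longrightarrow> u x = v x"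
  shows "energy (a k) (b k) u = energy (a k) (b k) v"
  unfolding energy_eq_SUP using level_cong[OF assms] by simp

lemma domD:
  assumes "u \<in> dom k"
  shows "continuous_on gasket u" "energy (a k) (b k) u = ennreal (en k u)" "level k n u \<le> en k u"
    "bounded_energy k u (en k u)" "0 \<le> en k u" "(\<lambda>n. level k n u) \<longlonglongrightarrow> en k u"
proof -
  show "continuous_on gasket u" using assms by (simp add: energy_domain_def)
  show e: "energy (a k) (b k) u = ennreal (en k u)" using assms by (simp add: energy_domain_def en_def less_top)
  show n: "0 \<le> en k u" by (simp add: en_def)
  show le: "level k n u \<le> en k u" for n
    using level_le_energy[of k n u] n unfolding e by simp
  then show "bounded_energy k u (en k u)" by (simp add: bounded_energy_def)
  show "(\<lambda>n. level k n u) \<longlonglongrightarrow> en k u"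
    using energy_tendsto[of k u] n level_nonneg unfolding e energy_level_eq by simp
qed

lemma domI: "continuous_on gasket u \<Longrightarrow> bounded_energy k u E \<Longrightarrow> u \<in> dom k"
  using energy_le[of k u E] by (auto simp: energy_domain_def intro: le_less_trans)

lemma en_le: "u \<in> dom k \<Longrightarrow> bounded_energy k u E \<Longrightarrow> en k u \<le> E"
  using LIMSEQ_le_const2[OF domD(6)] unfolding bounded_energy_def by blast

definition level_form :: "nat \<Rightarrow> nat \<Rightarrow> (complex \<Rightarrow> real) \<Rightarrow> (complex \<Rightarrow> real) \<Rightarrow> real" where
  "level_form k n u v = (\<Sum>w\<in>sg_words n. triple_form (a (k + n)) (b (k + n))
     (vertex_values (u \<circ> sg_word_map w)) (vertex_values (v \<circ> sg_word_map w)))"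

lemma level_parallelogram:
  "level k n (\<lambda>x. u x + v x) + level k n (\<lambda>x. u x - v x) = 2 * level k n u + 2 * level k n v"
  unfolding level_def sum_distrib_left sum.distrib[symmetric]
  by (rule sum.cong) (simp_all add: triple_energy_def vertex_values_def power2_eq_square algebra_simps)

text \<open>
  Together with the monotone convergence of the energies, this shows that the bilinear forms of the levels
  converge, so the algebraic properties of the limit form are inherited.
\<close>

lemma level_polarization:
  "level_form k n u v = (level k n (\<lambda>x. u x + v x) - level k n (\<lambda>x. u x - v x)) / 4"
  unfolding level_def level_form_def sum_subtractf[symmetric] sum_divide_distrib
  by (rule sum.cong)
     (simp_all add: triple_energy_def triple_form_def vertex_values_def power2_eq_square field_simps)

lemma level_form_self: "level_form k n u u = level k n u"
  unfolding level_def level_form_def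
  by (rule sum.cong) (simp_all add: triple_energy_def triple_form_def power2_eq_square)

lemma level_form_sym: "level_form k n u v = level_form k n v u"
  unfolding level_form_def by (rule sum.cong) (simp_all add: triple_form_def algebra_simps)

lemma level_form_add: "level_form k n (\<lambda>x. u x + v x) w = level_form k n u w + level_form k n v w"
  unfolding level_form_def sum.distrib[symmetric]
  by (rule sum.cong) (simp_all add: triple_form_def vertex_values_def algebra_simps)

lemma level_form_cmult: "level_form k n (\<lambda>x. r * u x) w = r * level_form k n u w"
  unfolding level_form_def sum_distrib_left
  by (rule sum.cong) (simp_all add: triple_form_def vertex_values_def algebra_simps)

lemma level_cmult: "level k n (\<lambda>x. r * u x) = r\<^sup>2 * level k n u"
  unfolding level_form_self[symmetric] level_form_cmult
  by (subst level_form_sym) (simp add: level_form_cmult power2_eq_square)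

lemma dom_add: "u \<in> dom k \<Longrightarrow> v \<in> dom k \<Longrightarrow> (\<lambda>x. u x + v x) \<in> dom k"
  and dom_diff: "u \<in> dom k \<Longrightarrow> v \<in> dom k \<Longrightarrow> (\<lambda>x. u x - v x) \<in> dom k"
proof -
  assume uv: "u \<in> dom k" "v \<in> dom k"
  have "level k n (\<lambda>x. u x + v x) \<le> 2 * en k u + 2 * en k v \<and> level k n (\<lambda>x. u x - v x) \<le> 2 * en k u + 2 * en k v" for n
    using level_parallelogram[of k n u v] domD(3)[OF uv(1), of n] domD(3)[OF uv(2), of n]
      level_nonneg[of k n "\<lambda>x. u x + v x"] level_nonneg[of k n "\<lambda>x. u x - v x"] by linarith
  then have be: "bounded_energy k (\<lambda>x. u x + v x) (2 * en k u + 2 * en k v)" "bounded_energy k (\<lambda>x. u x - v x) (2 * en k u + 2 * en k v)"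
    by (simp_all add: bounded_energy_def)
  show "(\<lambda>x. u x + v x) \<in> dom k" "(\<lambda>x. u x - v x) \<in> dom k"
    by (rule domI[OF _ be(1)], intro continuous_intros domD(1)[OF uv(1)] domD(1)[OF uv(2)])
       (rule domI[OF _ be(2)], intro continuous_intros domD(1)[OF uv(1)] domD(1)[OF uv(2)])
qed

lemma dom_cmult:
  assumes u: "u \<in> dom k"
  shows "(\<lambda>x. r * u x) \<in> dom k"
proof (rule domI)
  show "continuous_on gasket (\<lambda>x. r * u x)" by (intro continuous_intros domD(1)[OF u])
  show "bounded_energy k (\<lambda>x. r * u x) (r\<^sup>2 * en k u)"
    by (simp add: bounded_energy_def level_cmult mult_left_mono domD(3)[OF u])
qed

lemma dom_const: "(\<lambda>x. c) \<in> dom k"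
  by (rule domI[where k = k and E = 0]) (auto simp: bounded_energy_def level_def triple_energy_def vertex_values_def)

lemma form_tendsto:
  assumes "u \<in> dom k" "v \<in> dom k"
  shows "(\<lambda>n. level_form k n u v) \<longlonglongrightarrow> form k u v"
  unfolding level_polarization energy_form_def en_def[symmetric]
  by (intro tendsto_intros domD(6) dom_add dom_diff assms) auto

lemma form_self: "u \<in> dom k \<Longrightarrow> form k u u = en k u"
  using LIMSEQ_unique[OF form_tendsto[of u k u]] domD(6)[of u k] by (simp add: level_form_self)

lemma form_sym:
  assumes "u \<in> dom k" "v \<in> dom k"
  shows "form k u v = form k v u"
  using LIMSEQ_unique[OF form_tendsto[OF assms]] form_tendsto[OF assms(2,1)] by (simp add: level_form_sym)

lemma form_add:
  assumes "u \<in> dom k" "v \<in> dom k" "w \<in> dom k"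
  shows "form k (\<lambda>x. u x + v x) w = form k u w + form k v w"
proof (rule LIMSEQ_unique)
  show "(\<lambda>n. level_form k n (\<lambda>x. u x + v x) w) \<longlonglongrightarrow> form k (\<lambda>x. u x + v x) w"
    by (intro form_tendsto dom_add assms)
  show "(\<lambda>n. level_form k n (\<lambda>x. u x + v x) w) \<longlonglongrightarrow> form k u w + form k v w"
    unfolding level_form_add by (intro tendsto_intros form_tendsto assms)
qed

lemma form_cmult:
  assumes "u \<in> dom k" "w \<in> dom k"
  shows "form k (\<lambda>x. r * u x) w = r * form k u w"
proof (rule LIMSEQ_unique)
  show "(\<lambda>n. level_form k n (\<lambda>x. r * u x) w) \<longlonglongrightarrow> form k (\<lambda>x. r * u x) w"
    by (intro form_tendsto dom_cmult assms)
  show "(\<lambda>n. level_form k n (\<lambda>x. r * u x) w) \<longlonglongrightarrow> r * form k u w"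
    unfolding level_form_cmult by (intro tendsto_intros form_tendsto assms)
qed

lemma form_cong:
  assumes "\<And>x. x \<in> gasket \<Longrightarrow> u x = v x"
  shows "form k u w = form k v w"
proof -
  have "energy (a k) (b k) (\<lambda>x. u x + w x) = energy (a k) (b k) (\<lambda>x. v x + w x)"
    "energy (a k) (b k) (\<lambda>x. u x - w x) = energy (a k) (b k) (\<lambda>x. v x - w x)"
    using assms by (auto intro: energy_cong)
  then show ?thesis by (simp add: energy_form_def)
qed

section \<open>The limit form is a regular, strongly local Dirichlet form\<close>

text \<open>
  By the oscillation estimate \<open>(u x)\<^sup>2\<close> is bounded by \<open>2 (u y)\<^sup>2\<close> plus a multiple of the energy; now integrate
  over \<open>y\<close> with respect to the normalized measure.
\<close>

lemma sup_norm_bound: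
  "\<exists>A\<ge>0. \<forall>u\<in>dom k. \<forall>x\<in>gasket. (u x)\<^sup>2 \<le> A * form_one gasket_measure (form k) u"
proof -
  obtain C where C: "0 \<le> C" "\<And>k u E x. continuous_on gasket u \<Longrightarrow> bounded_energy k u E \<Longrightarrow> x \<in> gasket \<Longrightarrow>
     \<bar>u x - u (sg_vertex 1)\<bar> \<le> C * sqrt E" using oscillation_bound by blast
  have "(u x)\<^sup>2 \<le> (8 * C\<^sup>2 + 2) * form_one gasket_measure (form k) u" if u: "u \<in> dom k" and x: "x \<in> gasket" for u x
  proof -
    have pw: "(u x)\<^sup>2 \<le> 8 * C\<^sup>2 * en k u + 2 * (u y)\<^sup>2" if y: "y \<in> gasket" for y
    proof -
      have "\<bar>u x - u y\<bar> \<le> 2 * C * sqrt (en k u)"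
        using C(2)[OF domD(1)[OF u] domD(4)[OF u] x] C(2)[OF domD(1)[OF u] domD(4)[OF u] y] by linarith
      then have "(u x - u y)\<^sup>2 \<le> (2 * C * sqrt (en k u))\<^sup>2"
        by (metis abs_ge_zero power2_abs power_mono)
      also have "\<dots> = 4 * C\<^sup>2 * en k u" using domD(5)[OF u] by (simp add: power_mult_distrib)
      finally show ?thesis using square_add_le[of "u x - u y" "u y"] by simp
    qed
    have "(\<integral>y. (u x)\<^sup>2 \<partial>gasket_measure) \<le> (\<integral>y. 8 * C\<^sup>2 * en k u + 2 * (u y)\<^sup>2 \<partial>gasket_measure)"
      using pw by (intro integral_mono) (auto simp: space_gasket_measure intro!: integrable_continuous_square domD(1)[OF u])
    also have "\<dots> = 8 * C\<^sup>2 * en k u + 2 * (\<integral>y. (u y)\<^sup>2 \<partial>gasket_measure)"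
      using integrable_continuous_square[OF domD(1)[OF u]] by (simp add: space_gasket_measure measure_gasket)
    finally have "(u x)\<^sup>2 \<le> 8 * C\<^sup>2 * en k u + 2 * (\<integral>y. (u y)\<^sup>2 \<partial>gasket_measure)"
      by (simp add: space_gasket_measure measure_gasket)
    also have "\<dots> \<le> (8 * C\<^sup>2 + 2) * en k u + (8 * C\<^sup>2 + 2) * (\<integral>y. (u y)\<^sup>2 \<partial>gasket_measure)"
      using domD(5)[OF u] by (intro add_mono mult_right_mono) auto
    finally show ?thesis by (simp add: form_one_def form_self[OF u] distrib_left)
  qed
  then show ?thesis by (intro exI[of _ "8 * C\<^sup>2 + 2"]) auto
qed

text \<open>
  A Cauchy sequence converges uniformly by \<open>sup_norm_bound\<close>.  On each level the energy of
  \<open>s n - u\<close> is the limit of the energies of \<open>s n - s m\<close>, which are small; as this holds on all levels,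
  the limit energy of \<open>s n - u\<close> is small as well.
\<close>

lemma complete_form:
  assumes s: "\<And>n. s n \<in> dom k"
    and cauchy: "\<And>e. 0 < e \<Longrightarrow> \<exists>N. \<forall>m\<ge>N. \<forall>n\<ge>N. form_one gasket_measure (form k) (\<lambda>x. s m x - s n x) < e"
  shows "\<exists>u\<in>dom k. (\<lambda>n. form_one gasket_measure (form k) (\<lambda>x. s n x - u x)) \<longlonglongrightarrow> 0"
proof -
  obtain A where A: "0 \<le> A" "\<And>u x. u \<in> dom k \<Longrightarrow> x \<in> gasket \<Longrightarrow> (u x)\<^sup>2 \<le> A * form_one gasket_measure (form k) u"
    using sup_norm_bound by blast
  have diff: "(\<lambda>x. s m x - s n x) \<in> dom k" for m n by (intro dom_diff s)
  have "uniformly_Cauchy_on gasket s"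
    unfolding uniformly_Cauchy_on_def
  proof (intro allI impI)
    fix e :: real assume e: "0 < e"
    define d where "d = e\<^sup>2 / (A + 1)"
    have "0 < d" using e A(1) by (simp add: d_def)
    then obtain N where N: "\<And>m n. N \<le> m \<Longrightarrow> N \<le> n \<Longrightarrow> form_one gasket_measure (form k) (\<lambda>x. s m x - s n x) < d"
      using cauchy by blast
    have "dist (s m x) (s n x) < e" if "x \<in> gasket" "N \<le> m" "N \<le> n" for x m n
    proof -
      have "(s m x - s n x)\<^sup>2 \<le> A * form_one gasket_measure (form k) (\<lambda>x. s m x - s n x)"
        by (rule A(2)[OF diff that(1)])
      also have "\<dots> \<le> A * d" using N[OF that(2,3)] A(1) by (intro mult_left_mono) auto
      also have "\<dots> < (A + 1) * d" using \<open>0 < d\<close> by (simp add: distrib_right)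
      also have "\<dots> = e\<^sup>2" using A(1) by (simp add: d_def)
      finally have "\<bar>s m x - s n x\<bar> < e" using e power2_less_imp_less[of "\<bar>s m x - s n x\<bar>" e] by simp
      then show ?thesis by (simp add: dist_real_def)
    qed
    then show "\<exists>M. \<forall>x\<in>gasket. \<forall>m\<ge>M. \<forall>n\<ge>M. dist (s m x) (s n x) < e" by blast
  qed
  then obtain u where u: "uniform_limit gasket s u sequentially"
    using Cauchy_uniformly_convergent uniformly_convergent_on_def by blast
  have lim: "(\<lambda>m. s m x) \<longlonglongrightarrow> u x" if "x \<in> gasket" for x by (rule tendsto_uniform_limitI[OF u that])
  have cu: "continuous_on gasket u"
    by (rule uniform_limit_theorem[OF always_eventually u]) (simp_all add: domD(1)[OF s])
  have near: "\<exists>N. \<forall>n\<ge>N. bounded_energy k (\<lambda>x. s n x - u x) e \<and> (\<forall>x\<in>gasket. (s n x - u x)\<^sup>2 \<le> A * e)" if e: "0 < e" for e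
  proof -
    obtain N where N: "\<And>m n. N \<le> m \<Longrightarrow> N \<le> n \<Longrightarrow> form_one gasket_measure (form k) (\<lambda>x. s m x - s n x) < e"
      using cauchy[OF e] by blast
    have "bounded_energy k (\<lambda>x. s n x - u x) e \<and> (\<forall>x\<in>gasket. (s n x - u x)\<^sup>2 \<le> A * e)" if n: "N \<le> n" for n
    proof
      have f1: "form_one gasket_measure (form k) (\<lambda>x. s n x - s m x) < e" if "N \<le> m" for m using N[OF n that] .
      have "level k j (\<lambda>x. s n x - u x) \<le> e" for j
      proof (rule LIMSEQ_le_const2)
        show "(\<lambda>m. level k j (\<lambda>x. s n x - s m x)) \<longlonglongrightarrow> level k j (\<lambda>x. s n x - u x)"
          unfolding level_def triple_energy_def vertex_values_def comp_def
          by (intro tendsto_intros lim sg_word_map_gasket sg_vertex_gasket) auto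
        have "level k j (\<lambda>x. s n x - s m x) \<le> e" if "N \<le> m" for m
        proof -
          have "level k j (\<lambda>x. s n x - s m x) \<le> en k (\<lambda>x. s n x - s m x)" by (rule domD(3)[OF diff])
          also have "\<dots> \<le> form_one gasket_measure (form k) (\<lambda>x. s n x - s m x)"
            by (simp add: form_one_def form_self[OF diff])
          also have "\<dots> \<le> e" using f1[OF that] by simp
          finally show ?thesis .
        qed
        then show "\<exists>N. \<forall>m\<ge>N. level k j (\<lambda>x. s n x - s m x) \<le> e" by blast
      qed
      then show "bounded_energy k (\<lambda>x. s n x - u x) e" by (simp add: bounded_energy_def)
      show "\<forall>x\<in>gasket. (s n x - u x)\<^sup>2 \<le> A * e"
      proof
        fix x assume x: "x \<in> gasket"
        show "(s n x - u x)\<^sup>2 \<le> A * e"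
        proof (rule LIMSEQ_le_const2)
          show "(\<lambda>m. (s n x - s m x)\<^sup>2) \<longlonglongrightarrow> (s n x - u x)\<^sup>2" by (intro tendsto_intros lim x)
          have "(s n x - s m x)\<^sup>2 \<le> A * e" if "N \<le> m" for m
            using A(2)[OF diff x, of n m] mult_left_mono[OF less_imp_le[OF f1[OF that]] A(1)] by linarith
          then show "\<exists>N. \<forall>m\<ge>N. (s n x - s m x)\<^sup>2 \<le> A * e" by blast
        qed
      qed
    qed
    then show ?thesis by blast
  qed
  obtain N where "bounded_energy k (\<lambda>x. s N x - u x) 1" using near[of 1] by auto
  then have "(\<lambda>x. s N x - u x) \<in> dom k"
    by (rule domI[rotated]) (intro continuous_intros domD(1)[OF s] cu)
  then have "(\<lambda>x. s N x - (s N x - u x)) \<in> dom k" by (rule dom_diff[OF s])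
  then have ud: "u \<in> dom k" by simp
  have sud: "(\<lambda>x. s n x - u x) \<in> dom k" for n by (intro dom_diff s ud)
  have "(\<lambda>n. form_one gasket_measure (form k) (\<lambda>x. s n x - u x)) \<longlonglongrightarrow> 0"
  proof (rule LIMSEQ_I)
    fix r :: real assume r: "0 < r"
    define e where "e = r / 2 / (1 + A)"
    have e: "0 < e" using r A(1) by (simp add: e_def)
    obtain N where N: "\<And>n. N \<le> n \<Longrightarrow> bounded_energy k (\<lambda>x. s n x - u x) e"
      "\<And>n x. N \<le> n \<Longrightarrow> x \<in> gasket \<Longrightarrow> (s n x - u x)\<^sup>2 \<le> A * e" using near[OF e] by blast
    have "norm (form_one gasket_measure (form k) (\<lambda>x. s n x - u x) - 0) < r" if n: "N \<le> n" for n
    proof -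
      have "en k (\<lambda>x. s n x - u x) \<le> e" by (rule en_le[OF sud N(1)[OF n]])
      moreover have "(\<integral>x. (s n x - u x)\<^sup>2 \<partial>gasket_measure) \<le> A * e"
        using N(2)[OF n] by (intro integral_square_le domD(1)[OF sud]) auto
      moreover have "e + A * e = r / 2"
      proof -
        have "e + A * e = (1 + A) * e" by (simp add: distrib_right)
        also have "\<dots> = r / 2"
        proof -
          have "c * (t / c) = t" if "0 < c" for c t :: real using that by simp
          from this[of "1 + A" "r / 2"] show ?thesis unfolding e_def using A(1) by linarith
        qed
        finally show ?thesis .
      qed
      moreover have "0 \<le> en k (\<lambda>x. s n x - u x)" by (rule domD(5)[OF sud])
      moreover have "0 \<le> (\<integral>x. (s n x - u x)\<^sup>2 \<partial>gasket_measure)" by simp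
      ultimately show ?thesis using r by (simp add: form_one_def form_self[OF sud])
    qed
    then show "\<exists>N. \<forall>n\<ge>N. norm (form_one gasket_measure (form k) (\<lambda>x. s n x - u x) - 0) < r" by blast
  qed
  with ud show ?thesis by blast
qed

text \<open>
  The unit contraction decreases every difference of vertex values.
\<close>

lemma dom_unit_contraction:
  assumes u: "u \<in> dom k"
  defines "v \<equiv> \<lambda>x. min (max (u x) 0) 1"
  shows "v \<in> dom k" "form k v v \<le> form k u u"
proof -
  have "level k n v \<le> level k n u" for n
    unfolding level_def
    by (intro sum_mono triple_energy_mono_edges less_imp_le[OF ab_pos(1)] less_imp_le[OF ab_pos(3)])
       (simp add: vertex_values_def v_def)
  then have be: "bounded_energy k v (en k u)"
    using domD(3)[OF u] order_trans unfolding bounded_energy_def by blast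
  have "continuous_on gasket v" unfolding v_def by (intro continuous_intros domD(1)[OF u])
  then show v: "v \<in> dom k" using be by (rule domI)
  show "form k v v \<le> form k u u" unfolding form_self[OF v] form_self[OF u] by (rule en_le[OF v be])
qed

lemma dom_dense_square_integrable:
  assumes f: "f \<in> square_integrable gasket_measure" and e: "0 < e"
  shows "\<exists>u\<in>dom k. (\<integral>x. (f x - u x)\<^sup>2 \<partial>gasket_measure) < e"
proof -
  have "continuous_approximable gasket_measure f"
    by (rule approximable_square_integrable[OF compact_gasket space_gasket_measure sets_gasket_measure
          gasket_measure.finite_measure_axioms f])
  then obtain g where g: "continuous_on UNIV g" "integrable gasket_measure (\<lambda>x. (f x - g x)\<^sup>2)"
    "(\<integral>x. (f x - g x)\<^sup>2 \<partial>gasket_measure) < e / 4"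
    unfolding continuous_approximable_def using e by (metis zero_less_divide_iff zero_less_numeral)
  have gK: "continuous_on gasket g" using g(1) by (rule continuous_on_subset) simp
  have e2: "0 < sqrt e / 2" using e by simp
  obtain u E where u: "continuous_on gasket u" "bounded_energy k u E" "\<And>x. x \<in> gasket \<Longrightarrow> \<bar>u x - g x\<bar> \<le> sqrt e / 2"
    using uniform_approximation[OF gK e2] by blast
  have cgu: "continuous_on gasket (\<lambda>x. g x - u x)" by (intro continuous_intros gK u)
  have "(g x - u x)\<^sup>2 \<le> e / 4" if "x \<in> gasket" for x
  proof -
    have "\<bar>g x - u x\<bar> \<le> sqrt e / 2" using u(3)[OF that] by (simp add: abs_minus_commute)
    then have "(g x - u x)\<^sup>2 \<le> (sqrt e / 2)\<^sup>2" by (metis abs_ge_zero power2_abs power_mono)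
    then show ?thesis using e by (simp add: power_divide)
  qed
  then have i2: "(\<integral>x. (g x - u x)\<^sup>2 \<partial>gasket_measure) \<le> e / 4" by (rule integral_square_le[OF cgu])
  have [measurable]: "f \<in> borel_measurable gasket_measure" using f by (simp add: square_integrable_def)
  note [measurable] = gasket_continuous_measurable[OF gK] gasket_continuous_measurable[OF u(1)]
  have "(\<integral>x. (f x - u x)\<^sup>2 \<partial>gasket_measure) < e"
    using integral_square_add(2)[of "\<lambda>x. f x - g x" gasket_measure "\<lambda>x. g x - u x"]
      g(2,3) integrable_continuous_square[OF cgu] i2 by simp
  then show ?thesis using domI[OF u(1,2)] by blast
qed

lemma AE_eq_imp_eq:
  assumes "u \<in> dom k" "v \<in> dom k" "AE x in gasket_measure. u x = v x" "x \<in> gasket"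
  shows "u x = v x"
proof -
  have "u x - v x = 0"
  proof (rule AE_zero_on_open_imp[where U = UNIV and g = "\<lambda>x. u x - v x"])
    show "continuous_on gasket (\<lambda>x. u x - v x)"
      by (intro continuous_intros domD(1)[OF assms(1)] domD(1)[OF assms(2)])
    show "AE y in gasket_measure. y \<in> UNIV \<longrightarrow> u y - v y = 0" using assms(3) by eventually_elim simp
  qed (use assms in auto)
  then show ?thesis by simp
qed

lemma dirichlet_form_gasket: "dirichlet_form gasket_measure (dom k) (form k)"
  unfolding dirichlet_form_def
proof (intro conjI allI ballI impI)
  show "dom k \<subseteq> square_integrable gasket_measure" using continuous_square_integrable domD(1) by blast
  show "(\<lambda>x. 0) \<in> dom k" by (rule dom_const)
  show "(\<lambda>x. u x + v x) \<in> dom k" if "u \<in> dom k" "v \<in> dom k" for u v using that by (rule dom_add)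
  show "(\<lambda>x. r * u x) \<in> dom k" if "u \<in> dom k" for r u using that by (rule dom_cmult)
  show "\<exists>u\<in>dom k. (\<integral>x. (f x - u x)\<^sup>2 \<partial>gasket_measure) < e" if "f \<in> square_integrable gasket_measure" "0 < e" for f e
    using that by (rule dom_dense_square_integrable)
  show "form k u w = form k v w" if "u \<in> dom k" "v \<in> dom k" "w \<in> dom k" "AE x in gasket_measure. u x = v x" for u v w
    using AE_eq_imp_eq[OF that(1,2,4)] by (rule form_cong)
  show "form k u v = form k v u" if "u \<in> dom k" "v \<in> dom k" for u v using that by (rule form_sym)
  show "form k (\<lambda>x. u x + v x) w = form k u w + form k v w" if "u \<in> dom k" "v \<in> dom k" "w \<in> dom k" for u v w
    using that by (rule form_add)
  show "form k (\<lambda>x. r * u x) w = r * form k u w" if "u \<in> dom k" "w \<in> dom k" for r u w using that by (rule form_cmult)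
  show "0 \<le> form k u u" if "u \<in> dom k" for u using form_self[OF that] domD(5)[OF that] by simp
  show "\<exists>u\<in>dom k. (\<lambda>n. form_one gasket_measure (form k) (\<lambda>x. s n x - u x)) \<longlonglongrightarrow> 0"
    if "\<forall>n. s n \<in> dom k" "\<forall>e>0. \<exists>N. \<forall>m\<ge>N. \<forall>n\<ge>N. form_one gasket_measure (form k) (\<lambda>x. s m x - s n x) < e" for s
    using that by (intro complete_form) auto
  show "\<exists>v\<in>dom k. (AE x in gasket_measure. v x = min (max (u x) 0) 1) \<and> form k v v \<le> form k u u" if "u \<in> dom k" for u
    using dom_unit_contraction[OF that] by (intro bexI[of _ "\<lambda>x. min (max (u x) 0) 1"]) auto
qed

lemma regular_dirichlet_form_gasket: "regular_dirichlet_form gasket gasket_measure (dom k) (form k)"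
  unfolding regular_dirichlet_form_def
proof (intro conjI ballI allI impI)
  have ccs: "u \<in> continuous_compact_support gasket" if "continuous_on gasket u" for u
    using that compact_gasket by (auto simp: continuous_compact_support_def)
  show "radon_full_support gasket gasket_measure" by (rule radon_full_support_gasket)
  show "dirichlet_form gasket_measure (dom k) (form k)" by (rule dirichlet_form_gasket)
  fix e :: real assume e: "0 < e"
  show "\<exists>w\<in>dom k. \<exists>v\<in>continuous_compact_support gasket. (AE x in gasket_measure. w x = v x) \<and>
      form_one gasket_measure (form k) (\<lambda>x. u x - w x) < e" if u: "u \<in> dom k" for u
  proof -
    have "form k (\<lambda>x. 0) (\<lambda>x. 0) = 0"
      using form_cmult[of "\<lambda>x. 0" k "\<lambda>x. 0" 0, OF dom_const dom_const] by simp
    then have "form_one gasket_measure (form k) (\<lambda>x. u x - u x) < e" using e by (simp add: form_one_def)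
    then show ?thesis using u ccs[OF domD(1)[OF u]] by (intro bexI[of _ u]) auto
  qed
  show "\<exists>w\<in>dom k. \<exists>v\<in>continuous_compact_support gasket. (AE x in gasket_measure. w x = v x) \<and>
      (\<forall>x\<in>gasket. \<bar>f x - v x\<bar> < e)" if f: "f \<in> continuous_compact_support gasket" for f
  proof -
    have "continuous_on gasket f" using f by (simp add: continuous_compact_support_def)
    then obtain u E where u: "continuous_on gasket u" "bounded_energy k u E" "\<And>x. x \<in> gasket \<Longrightarrow> \<bar>u x - f x\<bar> \<le> e / 2"
      using uniform_approximation[of f "e / 2" k] e by auto
    have "\<bar>f x - u x\<bar> < e" if "x \<in> gasket" for x using u(3)[OF that] e by linarith
    then show ?thesis using domI[OF u(1,2)] ccs[OF u(1)] by (intro bexI[of _ u]) auto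
  qed
qed

text \<open>
  The open set \<open>U\<close>, on which \<open>v\<close> is constant, and the open sets on which \<open>u\<close> vanishes cover the gasket.
  By Lebesgue's covering lemma every sufficiently small cell lies in one of them, and then it
  contributes nothing to the form of its level.
\<close>

lemma strongly_local_gasket: "strongly_local gasket gasket_measure (dom k) (form k)"
  unfolding strongly_local_def
proof (intro ballI impI)
  fix u v assume u: "u \<in> dom k" and v: "v \<in> dom k"
  let ?S = "ae_support gasket gasket_measure u"
  assume "\<exists>U c. open U \<and> ?S \<subseteq> U \<and> (AE y in gasket_measure. y \<in> U \<longrightarrow> v y = c)"
  then obtain U c where U: "open U" "?S \<subseteq> U" "AE y in gasket_measure. y \<in> U \<longrightarrow> v y = c" by blast
  have vc: "v x = c" if x: "x \<in> gasket" "x \<in> U" for x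
  proof -
    have "v x - c = 0"
    proof (rule AE_zero_on_open_imp[OF _ U(1) _ x, where g = "\<lambda>x. v x - c"])
      show "continuous_on gasket (\<lambda>x. v x - c)" by (intro continuous_intros domD(1)[OF v])
      show "AE y in gasket_measure. y \<in> U \<longrightarrow> v y - c = 0" using U(3) by eventually_elim simp
    qed
    then show ?thesis by simp
  qed
  \<comment> \<open>The first alternative handles the support of \<open>u\<close>, the second its complement.\<close>
  define \<C> where "\<C> = insert U {V. open V \<and> (\<forall>x\<in>gasket \<inter> V. u x = 0)}"
  have cover: "gasket \<subseteq> \<Union>\<C>"
  proof
    fix x assume x: "x \<in> gasket"
    show "x \<in> \<Union>\<C>"
    proof (cases "x \<in> ?S")
      case True
      then show ?thesis using U(2) by (auto simp: \<C>_def)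
    next
      case False
      then obtain V where V: "open V" "x \<in> V" "AE y in gasket_measure. y \<in> V \<longrightarrow> u y = 0"
        using x unfolding ae_support_def by blast
      have "u y = 0" if "y \<in> gasket \<inter> V" for y
        using AE_zero_on_open_imp[OF domD(1)[OF u] V(1,3)] that by blast
      then show ?thesis using V by (auto simp: \<C>_def)
    qed
  qed
  obtain \<delta> where \<delta>: "0 < \<delta>" "\<And>T. T \<subseteq> gasket \<Longrightarrow> diameter T < \<delta> \<Longrightarrow> \<exists>B\<in>\<C>. T \<subseteq> B"
  proof (rule Lebesgue_number_lemma[OF compact_gasket _ cover])
    show "\<C> \<noteq> {}" by (simp add: \<C>_def)
    show "open B" if "B \<in> \<C>" for B using that U(1) by (auto simp: \<C>_def)
  qed blast
  from eventually_small_cells[OF \<delta>(1)] have "\<forall>\<^sub>F n in sequentially. level_form k n u v = 0"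
  proof eventually_elim
    case (elim n)
    show ?case
      unfolding level_form_def
    proof (rule sum.neutral, rule ballI)
      fix w assume w: "w \<in> sg_words n"
      have cell: "sg_cell w \<subseteq> gasket" using sg_word_map_gasket[OF w] by blast
      moreover have "diameter (sg_cell w) < \<delta>" using diameter_sg_cell(2)[OF w] elim by linarith
      ultimately obtain B where B: "B \<in> \<C>" "sg_cell w \<subseteq> B" using \<delta>(2) by blast
      have vert: "sg_word_map w (sg_vertex i) \<in> gasket \<inter> B" if "i \<in> {1,2,3}" for i
        using B(2) cell sg_vertex_gasket[OF that] by blast
      show "triple_form (a (k + n)) (b (k + n)) (vertex_values (u \<circ> sg_word_map w)) (vertex_values (v \<circ> sg_word_map w)) = 0"
      proof (cases "B = U")
        case True
        then have "vertex_values (v \<circ> sg_word_map w) i = c" if "i \<in> {1,2,3}" for i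
          using vert[OF that] vc by (simp add: vertex_values_def)
        then show ?thesis by (simp add: triple_form_def)
      next
        case False
        then have "vertex_values (u \<circ> sg_word_map w) i = 0" if "i \<in> {1,2,3}" for i
          using vert[OF that] B(1) by (simp add: vertex_values_def \<C>_def)
        then show ?thesis by (simp add: triple_form_def)
      qed
    qed
  qed
  then have "(\<lambda>n. level_form k n u v) \<longlonglongrightarrow> 0" by (rule tendsto_eventually)
  then show "form k u v = 0" using LIMSEQ_unique form_tendsto[OF u v] by blast
qed

section \<open>Failure of self-similarity\<close>

lemma energy_subdivide:
  "energy (a k) (b k) u = (\<Sum>i\<in>{1,2,3}. energy (a (Suc k)) (b (Suc k)) (u \<circ> sg_map i))"
proof (rule LIMSEQ_unique)
  show "(\<lambda>n. ennreal (energy_level (a k) (b k) (Suc n) u)) \<longlonglongrightarrow> energy (a k) (b k) u"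
    by (rule LIMSEQ_Suc[OF energy_tendsto])
  have "ennreal (energy_level (a k) (b k) (Suc n) u) =
      (\<Sum>i\<in>{1,2,3}. ennreal (energy_level (a (Suc k)) (b (Suc k)) n (u \<circ> sg_map i)))" for n
    unfolding energy_level_eq level_Suc by (rule sum_ennreal[symmetric]) (rule level_nonneg)
  then show "(\<lambda>n. ennreal (energy_level (a k) (b k) (Suc n) u)) \<longlonglongrightarrow>
      (\<Sum>i\<in>{1,2,3}. energy (a (Suc k)) (b (Suc k)) (u \<circ> sg_map i))"
    by (simp only:) (intro tendsto_sum energy_tendsto)
qed

definition midpoint_data :: "(nat \<Rightarrow> nat \<Rightarrow> real) \<Rightarrow> bool" where
  "midpoint_data w \<longleftrightarrow> (\<forall>i\<in>{1,2,3}. w i i = 0 \<and> (\<forall>j\<in>{1,2,3}. w i j = w j i))"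

abbreviation midpoint_energy :: "nat \<Rightarrow> (nat \<Rightarrow> nat \<Rightarrow> real) \<Rightarrow> real" where
  "midpoint_energy k w \<equiv> (\<Sum>i\<in>{1,2,3}. triple_energy (a (Suc k)) (b (Suc k)) (w i))"

text \<open>
  The given values at the three midpoints, with value zero at the vertices, are extended
  harmonically for the conductances belonging to \<open>k\<close>; for all other conductances only an
  inequality is available.
\<close>

lemma midpoint_extension:
  assumes w: "midpoint_data w"
  shows "\<exists>v. continuous_on gasket v \<and> (\<forall>i\<in>{1,2,3}. v (sg_vertex i) = 0) \<and>
    energy (a k) (b k) v = ennreal (midpoint_energy k w) \<and>
    (\<forall>m. ennreal (midpoint_energy m w) \<le> energy (a m) (b m) v)"
proof -
  define h where "h i = harmonic (Suc k) (w i)" for i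
  have hv: "h i (sg_vertex j) = w i j" if "j \<in> {1,2,3}" for i j
    using that by (simp add: h_def harmonic_vertex)
  have w_sym: "w i j = w j i" and w_diag: "w i i = 0" if "i \<in> {1,2,3}" "j \<in> {1,2,3}" for i j
    using w that unfolding midpoint_data_def by blast+
  have gl: "gluable h"
    unfolding gluable_def
  proof (intro ballI)
    fix i j :: nat assume ij: "i \<in> {1,2,3}" "j \<in> {1,2,3}"
    show "h i (sg_vertex j) = h j (sg_vertex i)"
      unfolding hv[OF ij(1)] hv[OF ij(2)] by (rule w_sym[OF ij])
  qed
  let ?v = "glue h"
  have vF: "?v (sg_map i x) = h i x" if "i \<in> {1,2,3}" "x \<in> gasket" for i x by (rule glue_sg_map[OF gl that])
  have cont: "continuous_on gasket ?v"
    by (rule continuous_on_glue[OF gl]) (simp add: h_def continuous_on_harmonic)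
  have vert: "?v (sg_vertex i) = 0" if i: "i \<in> {1,2,3}" for i
    using vF[OF i sg_vertex_gasket[OF i]] hv[OF i, of i] w_diag[OF i i] by (simp add: sg_map_vertex)
  have lev: "level k (Suc n) ?v = midpoint_energy k w" for n
    unfolding level_Suc
  proof (rule sum.cong[OF refl])
    fix i :: nat assume i: "i \<in> {1,2,3}"
    have "level (Suc k) n (?v \<circ> sg_map i) = level (Suc k) n (harmonic (Suc k) (w i))"
      by (rule level_cong) (simp add: vF[OF i] h_def)
    then show "level (Suc k) n (?v \<circ> sg_map i) = triple_energy (a (Suc k)) (b (Suc k)) (w i)"
      by (simp add: level_harmonic)
  qed
  have "energy (a k) (b k) ?v = ennreal (midpoint_energy k w)"
  proof (rule LIMSEQ_unique)
    show "(\<lambda>n. ennreal (energy_level (a k) (b k) (Suc n) ?v)) \<longlonglongrightarrow> energy (a k) (b k) ?v"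
      by (rule LIMSEQ_Suc[OF energy_tendsto])
    show "(\<lambda>n. ennreal (energy_level (a k) (b k) (Suc n) ?v)) \<longlonglongrightarrow> ennreal (midpoint_energy k w)"
      unfolding energy_level_eq lev by (rule tendsto_const)
  qed
  moreover have "ennreal (midpoint_energy m w) \<le> energy (a m) (b m) ?v" for m
  proof -
    have "level m (Suc 0) ?v = midpoint_energy m w"
      unfolding level_Suc level_0
    proof (rule sum.cong[OF refl])
      fix i :: nat assume i: "i \<in> {1,2,3}"
      have "vertex_values (?v \<circ> sg_map i) j = w i j" if "j \<in> {1,2,3}" for j
        using vF[OF i sg_vertex_gasket[OF that]] hv[OF that] by (simp add: vertex_values_def)
      then show "triple_energy (a (Suc m)) (b (Suc m)) (vertex_values (?v \<circ> sg_map i)) = triple_energy (a (Suc m)) (b (Suc m)) (w i)"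
        by (simp add: triple_energy_def)
    qed
    then show ?thesis using level_le_energy[of m "Suc 0" ?v] by simp
  qed
  ultimately show ?thesis using cont vert by blast
qed

text \<open>
  Shifting the index changes the conductances only by a bounded factor.
\<close>

lemma level_Suc_le_level: "\<exists>C\<ge>0. \<forall>n v. level 1 n v \<le> C * level 0 n v"
proof -
  have cA: "comparable (\<lambda>n. a (Suc n)) (\<lambda>n. 2 ^ n)" by (rule comparable_Suc[OF growth_a]) simp
  have cB: "comparable (\<lambda>n. b (Suc n)) (\<lambda>n. (3/2) ^ n)" by (rule comparable_Suc[OF growth]) simp
  obtain A where A: "0 \<le> A" "\<And>n. a (Suc n) \<le> A * a n" using comparable_le[OF cA growth_a] by blast
  obtain B where B: "0 \<le> B" "\<And>n. b (Suc n) \<le> B * b n" using comparable_le[OF cB growth] by blast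
  have "level 1 n v \<le> max A B * level 0 n v" for n v
    unfolding level_def sum_distrib_left
  proof (intro sum_mono triple_energy_mono_coefficients)
    show "a (1 + n) \<le> max A B * a (0 + n)" "b (1 + n) \<le> max A B * b (0 + n)"
      using order_trans[OF A(2)[of n] mult_right_mono[of A "max A B" "a n"]]
        order_trans[OF B(2)[of n] mult_right_mono[of B "max A B" "b n"]]
        less_imp_le[OF ab_pos(1)[of n]] less_imp_le[OF ab_pos(3)[of n]] by auto
  qed
  with A(1) show ?thesis by (intro exI[of _ "max A B"]) auto
qed

text \<open>
  A function \<open>v\<close> vanishing at the vertices can be copied into the first cell and extended by zero.
  For this function the identity for the shifted conductances and the supposed self-similar identity
  give \<open>E\<^sub>1(v) = E\<^sub>0(v) / r\<^sub>1\<close>, where \<open>E\<^sub>k\<close> is the energy for the conductances from index \<open>k\<close> on.  Applied to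
  the harmonic extensions of midpoint values, once for each of the two energies, this shows that the energies
  of midpoint values for the conductances of indices \<open>2\<close> and \<open>1\<close> are proportional.  Two choices of the
  values then give \<open>a\<^sub>2 / b\<^sub>2 = a\<^sub>1 / b\<^sub>1\<close>, but the quotients increase strictly.
\<close>

lemma not_self_similar:
  assumes r: "\<And>i. i \<in> {1,2,3} \<Longrightarrow> 0 < r i"
  shows "\<not> (\<forall>u\<in>dom 0. energy (a 0) (b 0) u = (\<Sum>i\<in>{1,2,3}. ennreal (1 / r i) * energy (a 0) (b 0) (u \<circ> sg_map i)))"
proof
  assume ss: "\<forall>u\<in>dom 0. energy (a 0) (b 0) u = (\<Sum>i\<in>{1,2,3}. ennreal (1 / r i) * energy (a 0) (b 0) (u \<circ> sg_map i))"
  have r1: "0 < r 1" using r by simp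
  have zero: "energy (a k) (b k) (\<lambda>x. 0) = 0" for k
    unfolding energy_eq_SUP by (simp add: level_def triple_energy_def vertex_values_def)
  have key: "energy (a 1) (b 1) v = ennreal (1 / r 1) * energy (a 0) (b 0) v"
    if v: "continuous_on gasket v" "\<And>i. i \<in> {1,2,3} \<Longrightarrow> v (sg_vertex i) = 0"
      and fin: "energy (a 1) (b 1) v < \<infinity> \<or> energy (a 0) (b 0) v < \<infinity>" for v
  proof -
    have fin1: "energy (a 1) (b 1) v < \<infinity>"
    proof (cases "energy (a 0) (b 0) v < \<infinity>")
      case True
      then have v0: "v \<in> dom 0" using v(1) by (simp add: energy_domain_def)
      obtain C where C: "0 \<le> C" "\<And>n. level 1 n v \<le> C * level 0 n v" using level_Suc_le_level by blast
      have "bounded_energy 1 v (C * en 0 v)"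
        using C mult_left_mono[OF domD(3)[OF v0] C(1)] order_trans unfolding bounded_energy_def by blast
      from energy_le[OF this] show ?thesis by (rule le_less_trans) simp
    qed (use fin in simp)
    \<comment> \<open>Gluing is possible because \<open>v\<close> vanishes at the vertices.\<close>
    define h where "h i = (if i = 1 then v else (\<lambda>x. 0))" for i :: nat
    have gl: "gluable h" using v(2) by (auto simp: gluable_def h_def)
    let ?u = "glue h"
    have uF: "?u (sg_map i x) = h i x" if "i \<in> {1,2,3}" "x \<in> gasket" for i x by (rule glue_sg_map[OF gl that])
    have cont: "continuous_on gasket ?u"
      by (rule continuous_on_glue[OF gl]) (simp add: h_def v(1))
    have e: "energy (a k) (b k) (?u \<circ> sg_map i) = (if i = 1 then energy (a k) (b k) v else 0)"
      if i: "i \<in> {1,2,3}" for i k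
    proof -
      have "energy (a k) (b k) (?u \<circ> sg_map i) = energy (a k) (b k) (h i)"
        by (rule energy_cong) (simp add: uF[OF i])
      then show ?thesis by (simp add: h_def zero)
    qed
    have eu: "energy (a 0) (b 0) ?u = energy (a 1) (b 1) v"
      unfolding energy_subdivide[of 0] sum_three using e[of 1 1] e[of 2 1] e[of 3 1] by simp
    then have "?u \<in> dom 0" using cont fin1 by (simp add: energy_domain_def)
    with ss have "energy (a 0) (b 0) ?u = (\<Sum>i\<in>{1,2,3}. ennreal (1 / r i) * energy (a 0) (b 0) (?u \<circ> sg_map i))" by blast
    also have "\<dots> = ennreal (1 / r 1) * energy (a 0) (b 0) v"
      unfolding sum_three using e[of 1 0] e[of 2 0] e[of 3 0] by simp
    finally show ?thesis unfolding eu .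
  qed
  have Q: "midpoint_energy 1 w = midpoint_energy 0 w / r 1" if w: "midpoint_data w" for w
  proof (rule antisym)
    have nn: "0 \<le> midpoint_energy k w" for k
      by (intro sum_nonneg triple_energy_nonneg less_imp_le ab_pos)
    obtain v where v: "continuous_on gasket v" "\<forall>i\<in>{1,2,3}. v (sg_vertex i) = 0"
      "energy (a 0) (b 0) v = ennreal (midpoint_energy 0 w)" "ennreal (midpoint_energy 1 w) \<le> energy (a 1) (b 1) v"
      using midpoint_extension[OF w, of 0] by blast
    have "ennreal (midpoint_energy 1 w) \<le> ennreal (1 / r 1) * ennreal (midpoint_energy 0 w)"
      using v(4) key[OF v(1)] v(2,3) by simp
    also have "\<dots> = ennreal (midpoint_energy 0 w / r 1)" using r1 nn by (simp add: ennreal_mult[symmetric])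
    finally show "midpoint_energy 1 w \<le> midpoint_energy 0 w / r 1" using r1 nn by (simp add: ennreal_le_iff)
    obtain v where v: "continuous_on gasket v" "\<forall>i\<in>{1,2,3}. v (sg_vertex i) = 0"
      "energy (a 1) (b 1) v = ennreal (midpoint_energy 1 w)" "ennreal (midpoint_energy 0 w) \<le> energy (a 0) (b 0) v"
      using midpoint_extension[OF w, of 1] by blast
    have "ennreal (midpoint_energy 0 w / r 1) = ennreal (1 / r 1) * ennreal (midpoint_energy 0 w)"
      using r1 nn by (simp add: ennreal_mult[symmetric])
    also have "\<dots> \<le> ennreal (1 / r 1) * energy (a 0) (b 0) v" using v(4) by (rule mult_left_mono) simp
    also have "\<dots> = ennreal (midpoint_energy 1 w)" using key[OF v(1)] v(2,3) by simp
    finally show "midpoint_energy 0 w / r 1 \<le> midpoint_energy 1 w" using nn by (simp add: ennreal_le_iff)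
  qed
  \<comment> \<open>\<open>w1\<close> is one at the two midpoints next to the first vertex, \<open>w2\<close> at the opposite midpoint.\<close>
  define w1 :: "nat \<Rightarrow> nat \<Rightarrow> real" where "w1 i j = (if i + j = 3 \<or> i + j = 4 \<and> i \<noteq> j then 1 else 0)" for i j
  define w2 :: "nat \<Rightarrow> nat \<Rightarrow> real" where "w2 i j = (if i + j = 5 then 1 else 0)" for i j
  have "midpoint_data w1" "midpoint_data w2" by (auto simp: midpoint_data_def w1_def w2_def)
  from this[THEN Q] have e: "6 * b 2 = 6 * b 1 / r 1" "2 * b 2 + 2 * a 2 = (2 * b 1 + 2 * a 1) / r 1"
    by (simp_all add: triple_energy_def w1_def w2_def eval_nat_numeral)
  then have "b 2 = b 1 / r 1" "a 2 = a 1 / r 1" by (simp_all add: add_divide_distrib)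
  then have "a 2 / b 2 = a 1 / b 1" using r1 by simp
  with ratio_increasing[of 1] show False by (simp add: eval_nat_numeral)
qed

end

section \<open>Independence of the initial conductances\<close>

lemma gasket_conductances_of_resistance_pair:
  assumes pair: "resistance_pair x y"
    and a: "a = (\<lambda>n. x n / (y n * (2 * x n + y n)))" and b: "b = (\<lambda>n. 1 / (2 * x n + y n))"
  shows "gasket_conductances a b"
proof
  show "conductance_pair a b" unfolding a b by (rule conductance_pair_of_resistance_pair[OF pair])
  show "comparable b (\<lambda>n. (3/2) ^ n)" "comparable a (\<lambda>n. 2 ^ n)"
    unfolding a b by (rule conductances_comparable[OF pair])+
  show "conductances (a k) (b k) n = (a (k + n), b (k + n), b (k + n))" for k n
    by (rule conductances_of_resistance_pair[OF pair a b])
  show "a n / b n < a (Suc n) / b (Suc n)" for n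
    unfolding a b by (rule conductance_ratio_increasing[OF pair])
qed

text \<open>
  All conductance sequences have the same growth, so their energies are comparable.
\<close>

lemma energy_domain_subset:
  assumes "gasket_conductances a b" "gasket_conductances a' b'"
  shows "energy_domain (a 0) (b 0) \<subseteq> energy_domain (a' 0) (b' 0)"
proof
  interpret G: gasket_conductances a b by fact
  interpret H: gasket_conductances a' b' by fact
  fix u assume u: "u \<in> energy_domain (a 0) (b 0)"
  obtain A where A: "0 \<le> A" "\<And>n. a' n \<le> A * a n" using comparable_le[OF H.growth_a G.growth_a] by blast
  obtain B where B: "0 \<le> B" "\<And>n. b' n \<le> B * b n" using comparable_le[OF H.growth G.growth] by blast
  have "H.level 0 n u \<le> max A B * G.level 0 n u" for n
    unfolding G.level_def H.level_def sum_distrib_left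
  proof (intro sum_mono triple_energy_mono_coefficients)
    show "a' (0 + n) \<le> max A B * a (0 + n)" "b' (0 + n) \<le> max A B * b (0 + n)"
      using order_trans[OF A(2)[of n] mult_right_mono[of A "max A B" "a n"]]
        order_trans[OF B(2)[of n] mult_right_mono[of B "max A B" "b n"]]
        less_imp_le[OF G.ab_pos(1)[of n]] less_imp_le[OF G.ab_pos(3)[of n]] by auto
  qed
  moreover have "max A B * G.level 0 n u \<le> max A B * G.en 0 u" for n
    using A(1) by (intro mult_left_mono G.domD(3)[OF u]) auto
  ultimately have "H.bounded_energy 0 u (max A B * G.en 0 u)"
    unfolding H.bounded_energy_def using order_trans by blast
  then show "u \<in> energy_domain (a' 0) (b' 0)" by (rule H.domI[OF G.domD(1)[OF u]])
qed

theorem theorem1p2: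
  fixes x0 y0 z0 :: real and x y z a b c :: "nat \<Rightarrow> real"
  assumes "x0 > y0" and "y0 = z0" and "z0 > 0"
    and "\<And>n. (x n, y n, z n) = resistances (x0, y0, z0) n"
    and "\<And>n. (a n, b n, c n) = star_delta (x n, y n, z n)"
  shows "(a 0 > b 0 \<and> b 0 = c 0) \<and>
    (\<forall>n. a n = x n / (y n * (2 * x n + y n))) \<and> comparable a (\<lambda>n. 2 ^ n) \<and>
    (\<forall>n. b n = c n \<and> b n = 1 / (2 * x n + y n)) \<and> comparable b (\<lambda>n. (3 / 2) ^ n) \<and>
    (\<forall>u. continuous_on gasket u \<longrightarrow>
       (\<lambda>n. ennreal (energy_level (a 0) (b 0) n u)) \<longlonglongrightarrow> energy (a 0) (b 0) u) \<and>
    regular_dirichlet_form gasket gasket_measure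
       (energy_domain (a 0) (b 0)) (energy_form (a 0) (b 0)) \<and>
    strongly_local gasket gasket_measure
       (energy_domain (a 0) (b 0)) (energy_form (a 0) (b 0)) \<and>
    (\<forall>a' b'. a' > b' \<and> b' > 0 \<longrightarrow> energy_domain a' b' = energy_domain (a 0) (b 0)) \<and>
    (\<forall>u. continuous_on gasket u \<longrightarrow>
       energy (a 0) (b 0) u = (\<Sum>i\<in>{1,2,3}. energy (a 1) (b 1) (u \<circ> sg_map i))) \<and>
    \<not> (\<exists>r :: nat \<Rightarrow> real. (\<forall>i\<in>{1,2,3}. r i > 0) \<and>
        (\<forall>u\<in>energy_domain (a 0) (b 0).
           energy (a 0) (b 0) u =
             (\<Sum>i\<in>{1,2,3}. ennreal (1 / r i) * energy (a 0) (b 0) (u \<circ> sg_map i))))"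
proof -
  obtain \<xi> \<eta> where pair: "resistance_pair \<xi> \<eta>" and start: "\<xi> 0 = x0" "\<eta> 0 = y0"
    using resistance_pair_exists[of y0 x0] assms(1-3) by auto
  have "(x n, y n, z n) = (\<xi> n, \<eta> n, \<eta> n)" for n
    using resistances_of_pair[OF pair] by (simp add: assms(4) start flip: assms(2))
  then have xyz: "x = \<xi>" "y = \<eta>" "z = \<eta>" by auto
  note pos = pair_pos[OF pair]
  have "(a n, b n, c n) = (x n / (y n * (2 * x n + y n)), 1 / (2 * x n + y n), 1 / (2 * x n + y n))" for n
    using star_delta_pair[OF pos(1)[of n] pos(3)[of n]] by (simp add: assms(5) xyz)
  then have abc: "a = (\<lambda>n. x n / (y n * (2 * x n + y n)))" "b = (\<lambda>n. 1 / (2 * x n + y n))" "c = b"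
    by auto
  have G: "gasket_conductances a b"
    by (rule gasket_conductances_of_resistance_pair[OF pair]) (simp_all add: abc xyz)
  interpret gasket_conductances a b by (rule G)
  have independent: "energy_domain a' b' = energy_domain (a 0) (b 0)" if ab': "a' > b' \<and> b' > 0" for a' b'
  proof -
    obtain X Y where XY: "resistance_pair X Y" "a' = X 0 / (Y 0 * (2 * X 0 + Y 0))" "b' = 1 / (2 * X 0 + Y 0)"
      using resistance_pair_of_conductances[of b' a'] ab' by blast
    have H: "gasket_conductances (\<lambda>n. X n / (Y n * (2 * X n + Y n))) (\<lambda>n. 1 / (2 * X n + Y n))"
      by (rule gasket_conductances_of_resistance_pair[OF XY(1) refl refl])
    show ?thesis
      unfolding XY(2,3) using energy_domain_subset[OF G H] energy_domain_subset[OF H G] by (rule subset_antisym[rotated])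
  qed
  have "b 0 < a 0" by (rule ab_pos(2))
  moreover have "energy (a 0) (b 0) u = (\<Sum>i\<in>{1,2,3}. energy (a 1) (b 1) (u \<circ> sg_map i))" for u
    using energy_subdivide[of 0 u] by (simp only: One_nat_def)
  moreover have "\<not> (\<exists>r :: nat \<Rightarrow> real. (\<forall>i\<in>{1,2,3}. r i > 0) \<and>
        (\<forall>u\<in>energy_domain (a 0) (b 0). energy (a 0) (b 0) u =
             (\<Sum>i\<in>{1,2,3}. ennreal (1 / r i) * energy (a 0) (b 0) (u \<circ> sg_map i))))"
  proof (rule notI, elim exE conjE)
    fix r :: "nat \<Rightarrow> real"
    assume r: "\<forall>i\<in>{1,2,3}. r i > 0"
    assume "\<forall>u\<in>energy_domain (a 0) (b 0). energy (a 0) (b 0) u =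
        (\<Sum>i\<in>{1,2,3}. ennreal (1 / r i) * energy (a 0) (b 0) (u \<circ> sg_map i))"
    then show False using not_self_similar[of r, OF bspec[OF r]] by contradiction
  qed
  moreover note regular_dirichlet_form_gasket[of 0] strongly_local_gasket[of 0] energy_tendsto[of 0]
    growth growth_a independent
  moreover have "b n = c n" "a n = x n / (y n * (2 * x n + y n))" "b n = 1 / (2 * x n + y n)" for n
    by (simp_all only: abc)
  ultimately show ?thesis by (intro conjI allI impI) assumption+
qed

end
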